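(* Let $K$ be an imaginary quadratic field with maximal order $\mathcal{O}$, let $\mathfrak{b}\subset\mathcal{O}$ be a nonzero ideal and $A=\mathbb{C}/\mathcal{O}\times\mathbb{C}/\mathfrak{b}$. Let $R$ be a set of ideals $\mathfrak{a}\subset\mathcal{O}$ forming a set of representatives of the $2$-torsion subgroup $\operatorname{Cl}(\mathcal{O})[2]$ of the class group, and for each $\mathfrak{a}\in R$ let $\gamma_{\mathfrak{a}}\in G_A$ be the isometry and $\tau\in G_A$ the involution defined in the context; put $\gamma'_{\mathfrak{a}}:=\tau\circ\gamma_{\mathfrak{a}}$. Then the $2\cdot\#\operatorname{Cl}(\mathcal{O})[2]$ elements $\gamma_{\mathfrak{a}}$, $\gamma'_{\mathfrak{a}}$ ($\mathfrak{a}\in R$) form a complete set of pairwise distinct representatives of $G_A/H_A$. In particular $\#(G_A/H_A)=2\cdot\#\operatorname{Cl}(\mathcal{O})[2]$.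
   Context: Write $N$ for the norm of $K/\mathbb{Q}$ (on elements and on fractional ideals) and $\bar{\ }$ for complex conjugation. We identify $$\operatorname{End}(A)=\left\{\begin{pmatrix} a&b\\c&d\end{pmatrix}\in M_2(K): a,d\in\mathcal{O},\ b\in\mathfrak{b}^{-1},\ c\in\mathfrak{b}\right\},\qquad \operatorname{Aut}(A)=\{P\in\operatorname{End}(A):\det P\in\mathcal{O}^\times\}.$$ For $P=\begin{pmatrix} a&b\\c&d\end{pmatrix}\in M_2(K)$ put $P^\dagger=\begin{pmatrix}\bar a&\bar c/N(\mathfrak{b})\\ \bar b\,N(\mathfrak{b})&\bar d\end{pmatrix}$ (the Rosati involution of the product principal polarisation $\lambda_0=\operatorname{diag}(1,N(\mathfrak{b})^{-1})$). Let $$\mathrm{Herm}_2^{\mathrm{twist}}(\mathcal{O})=\{S\in\operatorname{End}(A):S^\dagger=S\}=\left\{\begin{pmatrix}x&b\\ \bar b\,N(\mathfrak{b})&y\end{pmatrix}:x,y\in\mathbb{Z},\ b\in\mathfrak{b}^{-1}\right\},$$ a free $\mathbb{Z}$-module of rank $4$. It is identified with $\operatorname{NS}(A)$ in such a way that the quadratic form $q_A(D)=\frac12(D.D)$ becomes $\det$ and the ample cone (set of polarisations) becomes the set of $S$ with positive trace and positive determinant. $G_A$ is the group of $\mathbb{Z}$-linear automorphisms of $\mathrm{Herm}_2^{\mathrm{twist}}(\mathcal{O})$ preserving $\det$ and preserving the ample cone. $H_A\subset G_A$ is the subgroup of the maps $h_P:S\mapsto P^\dagger SP$ for $P\in\operatorname{Aut}(A)$.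 For an ideal $\mathfrak{a}\subset\mathcal{O}$ whose class lies in $\operatorname{Cl}(\mathcal{O})[2]$, the $\mathcal{O}$-modules $\mathcal{O}\oplus\mathfrak{b}$ and $\mathfrak{a}\oplus\mathfrak{a}\mathfrak{b}$ are isomorphic; let $M_{\mathfrak{a}}\in\operatorname{GL}_2(K)$ be the matrix (acting on column vectors) of any chosen isomorphism $\mathcal{O}\oplus\mathfrak{b}\to\mathfrak{a}\oplus\mathfrak{a}\mathfrak{b}$, and set $$\gamma_{\mathfrak{a}}(S)=\frac{1}{N(\mathfrak{a})}M_{\mathfrak{a}}^\dagger S M_{\mathfrak{a}},\qquad S\in\mathrm{Herm}_2^{\mathrm{twist}}(\mathcal{O}).$$ The map $\gamma_{\mathfrak a}$ belongs to $G_A$, and its class in $G_A/H_A$ depends only on the ideal class of $\mathfrak{a}$. The involution $\tau\in G_A$ is $$\tau\begin{pmatrix}x&b\\ \bar b\,N(\mathfrak{b})&y\end{pmatrix}=\begin{pmatrix}y&b\\ \bar b\,N(\mathfrak{b})&x\end{pmatrix}.$$ *)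

theory Defs
  imports
    "HOL-Analysis.Analysis"
    "HOL-Algebra.Embedded_Algebras"
    "HOL-Algebra.Ideal_Product"
    "HOL-Algebra.QuotRing"
    "HOL-Algebra.Left_Coset"
    "HOL-Algebra.Bij"
begin

section \<open>Imaginary quadratic fields inside the complex numbers\<close>

definition complex_ring :: "complex set \<Rightarrow> complex ring"
  where "complex_ring S = \<lparr>carrier = S, mult = (*), one = 1, zero = 0, add = (+)\<rparr>"

text \<open>An imaginary quadratic field is given together with a complex embedding, which the
  complex torus \<open>\<complex>/\<O> \<times> \<complex>/\<bb>\<close> presupposes. Complex conjugation on it is \<^const>\<open>cnj\<close>.\<close>

definition imaginary_quadratic_field :: "complex set \<Rightarrow> bool"
  where "imaginary_quadratic_field K \<longleftrightarrow>
    subfield K (complex_ring UNIV) \<and>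
    ring.dimension (complex_ring UNIV) 2 \<rat> K \<and>
    \<not> K \<subseteq> \<real>"

definition max_order :: "complex set \<Rightarrow> complex set"
  where "max_order K = {x \<in> K. algebraic_int x}"

abbreviation order_ring :: "complex set \<Rightarrow> complex ring"
  where "order_ring K \<equiv> complex_ring (max_order K)"

definition nonzero_ideal :: "complex set \<Rightarrow> complex set \<Rightarrow> bool"
  where "nonzero_ideal K I \<longleftrightarrow> ideal I (order_ring K) \<and> I \<noteq> {0}"

text \<open>The norm of a nonzero integral ideal, i.e. its index in the maximal order.\<close>

definition ideal_norm :: "complex set \<Rightarrow> complex set \<Rightarrow> nat"
  where "ideal_norm K I = card (carrier (order_ring K Quot I))"

definition ideal_inverse :: "complex set \<Rightarrow> complex set \<Rightarrow> complex set"
  where "ideal_inverse K I = {x \<in> K. \<forall>y\<in>I. x * y \<in> max_order K}"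


section \<open>The class group\<close>

definition fractional_ideal :: "complex set \<Rightarrow> complex set \<Rightarrow> bool"
  where "fractional_ideal K I \<longleftrightarrow>
    additive_subgroup I (complex_ring K) \<and>
    (\<forall>r\<in>max_order K. \<forall>x\<in>I. r * x \<in> I) \<and>
    I \<noteq> {0} \<and>
    (\<exists>d\<in>max_order K. d \<noteq> 0 \<and> (\<forall>x\<in>I. d * x \<in> max_order K))"

text \<open>The library operation \<^const>\<open>ideal_prod\<close> only forms the set of finite sums of products, so,
  taken in the ring \<open>K\<close>, it is also the product of fractional ideals.\<close>

definition fractional_ideal_group :: "complex set \<Rightarrow> complex set monoid"
  where "fractional_ideal_group K =
    \<lparr>carrier = {I. fractional_ideal K I}, mult = ideal_prod (complex_ring K), one = max_order K\<rparr>"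

definition principal_fractional_ideals :: "complex set \<Rightarrow> complex set set"
  where "principal_fractional_ideals K = {(*) k ` max_order K | k. k \<in> K - {0}}"

definition class_group :: "complex set \<Rightarrow> complex set set monoid"
  where "class_group K = fractional_ideal_group K Mod principal_fractional_ideals K"

definition ideal_class :: "complex set \<Rightarrow> complex set \<Rightarrow> complex set set"
  where "ideal_class K I = principal_fractional_ideals K #>\<^bsub>fractional_ideal_group K\<^esub> I"

definition class_group_2_torsion :: "complex set \<Rightarrow> complex set set set"
  where "class_group_2_torsion K =
    {c \<in> carrier (class_group K). c [^]\<^bsub>class_group K\<^esub> (2::nat) = \<one>\<^bsub>class_group K\<^esub>}"


section \<open>Endomorphisms, automorphisms and the Rosati involution\<close>

definition mat2 :: "complex \<Rightarrow> complex \<Rightarrow> complex \<Rightarrow> complex \<Rightarrow> complex^2^2"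
  where "mat2 a b c d = vector [vector [a, b], vector [c, d]]"

text \<open>Endomorphisms of \<open>A = \<complex>/\<O> \<times> \<complex>/\<bb>\<close> are identified with the matrices of their action on
  column vectors in \<open>\<complex>\<^sup>2\<close>; the ideal \<open>\<bb>\<close> is the argument \<open>B\<close> throughout.\<close>

definition End_A :: "complex set \<Rightarrow> complex set \<Rightarrow> (complex^2^2) set"
  where "End_A K B =
    {mat2 a b c d | a b c d.
      a \<in> max_order K \<and> d \<in> max_order K \<and> b \<in> ideal_inverse K B \<and> c \<in> B}"

definition Aut_A :: "complex set \<Rightarrow> complex set \<Rightarrow> (complex^2^2) set"
  where "Aut_A K B = {P \<in> End_A K B. det P \<in> Units (order_ring K)}"

definition rosati :: "complex set \<Rightarrow> complex set \<Rightarrow> complex^2^2 \<Rightarrow> complex^2^2"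
  where "rosati K B P =
    mat2 (cnj (P$1$1)) (cnj (P$2$1) / of_nat (ideal_norm K B))
         (cnj (P$1$2) * of_nat (ideal_norm K B)) (cnj (P$2$2))"

definition Herm :: "complex set \<Rightarrow> complex set \<Rightarrow> (complex^2^2) set"
  where "Herm K B = {S \<in> End_A K B. rosati K B S = S}"

text \<open>On \<^const>\<open>Herm\<close> both trace and determinant are real, so taking real parts loses nothing.\<close>

definition ample_cone :: "complex set \<Rightarrow> complex set \<Rightarrow> (complex^2^2) set"
  where "ample_cone K B = {S \<in> Herm K B. Re (trace S) > 0 \<and> Re (det S) > 0}"


section \<open>The groups \<open>G\<^sub>A\<close> and \<open>H\<^sub>A\<close>\<close>

definition Herm_group :: "complex set \<Rightarrow> complex set \<Rightarrow> (complex^2^2) monoid"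
  where "Herm_group K B = \<lparr>carrier = Herm K B, mult = (+), one = 0\<rparr>"

text \<open>Maps on \<^const>\<open>Herm\<close> are represented by extensional functions, as in \<^const>\<open>AutoGroup\<close>;
  the group operation is composition \<open>(g \<otimes> f) S = g (f S)\<close>.\<close>

definition G_A :: "complex set \<Rightarrow> complex set \<Rightarrow> (complex^2^2 \<Rightarrow> complex^2^2) monoid"
  where "G_A K B = (AutoGroup (Herm_group K B))
    \<lparr>carrier := {f \<in> auto (Herm_group K B).
       (\<forall>S\<in>Herm K B. det (f S) = det S) \<and> f ` ample_cone K B = ample_cone K B}\<rparr>"

definition h_map ::
    "complex set \<Rightarrow> complex set \<Rightarrow> complex^2^2 \<Rightarrow> (complex^2^2 \<Rightarrow> complex^2^2)"
  where "h_map K B P = (\<lambda>S\<in>Herm K B. rosati K B P ** S ** P)"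

definition H_A :: "complex set \<Rightarrow> complex set \<Rightarrow> (complex^2^2 \<Rightarrow> complex^2^2) set"
  where "H_A K B = h_map K B ` Aut_A K B"


section \<open>The isometries \<open>\<gamma>\<^sub>\<aa>\<close>, \<open>\<gamma>'\<^sub>\<aa>\<close> and \<open>\<tau>\<close>\<close>

definition GL2 :: "complex set \<Rightarrow> (complex^2^2) set"
  where "GL2 K = {M. (\<forall>i j. M$i$j \<in> K) \<and> invertible M}"

definition dsum :: "complex set \<Rightarrow> complex set \<Rightarrow> (complex^2) set"
  where "dsum I J = {v. v$1 \<in> I \<and> v$2 \<in> J}"

text \<open>The matrices of the \<open>\<O>\<close>-module isomorphisms \<open>\<O> \<oplus> \<bb> \<rightarrow> \<aa> \<oplus> \<aa>\<bb>\<close>: every such isomorphism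
  extends uniquely to a \<open>K\<close>-linear automorphism of \<open>K\<^sup>2\<close>. Injectivity is part of \<^const>\<open>GL2\<close>.\<close>

definition module_iso_matrix :: "complex set \<Rightarrow> complex set \<Rightarrow> complex set \<Rightarrow> complex^2^2 \<Rightarrow> bool"
  where "module_iso_matrix K B I M \<longleftrightarrow>
    M \<in> GL2 K \<and>
    (\<lambda>v. M *v v) ` dsum (max_order K) B = dsum I (ideal_prod (order_ring K) I B)"

text \<open>Here \<open>I\<close> is the ideal \<open>\<aa>\<close> and \<open>M\<close> the chosen matrix \<open>M\<^sub>\<aa>\<close>.\<close>

definition gamma ::
    "complex set \<Rightarrow> complex set \<Rightarrow> complex set \<Rightarrow> complex^2^2 \<Rightarrow> (complex^2^2 \<Rightarrow> complex^2^2)"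
  where "gamma K B I M =
    (\<lambda>S\<in>Herm K B. (1 / real (ideal_norm K I)) *\<^sub>R (rosati K B M ** S ** M))"

definition tau :: "complex set \<Rightarrow> complex set \<Rightarrow> (complex^2^2 \<Rightarrow> complex^2^2)"
  where "tau K B = (\<lambda>S\<in>Herm K B. mat2 (S$2$2) (S$1$2) (S$2$1) (S$1$1))"

definition gamma' ::
    "complex set \<Rightarrow> complex set \<Rightarrow> complex set \<Rightarrow> complex^2^2 \<Rightarrow> (complex^2^2 \<Rightarrow> complex^2^2)"
  where "gamma' K B I M = compose (Herm K B) (tau K B) (gamma K B I M)"

end

theory Submission
  imports Defs
begin

text \<open>
  Write \<open>\<O>\<close> for the maximal order, \<open>n = N(B)\<close>, \<open>\<Lambda> = \<O> \<oplus> B\<close>, and \<open>Herm\<close> for the lattice of matrices \<open>S\<close> with rows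
  \<open>(x, b)\<close> and \<open>(n * cnj b, y)\<close>, on which \<open>det S = x * y - n * \<bar>b\<bar>\<^sup>2\<close> has signature \<open>(1, 3)\<close>.

  As for the real Lorentz group, the isometries that preserve the cone and the orientation are the maps
  \<open>S \<mapsto> r * M\<^sup>\<dagger> S M\<close>, and \<open>\<tau>\<close> reverses the orientation. The lemma \<open>isometry_eq_act_or_swap_act\<close> is the rational form of
  this statement: for every \<open>f\<close> in \<open>G\<^sub>A\<close>, one of \<open>f\<close> and \<open>\<tau> \<circ> f\<close> is of this form with \<open>M\<close> over \<open>K\<close>. The rows of \<open>M\<close>
  are read off from the images of the two isotropic diagonal units.

  The heart of the argument is that integrality of such a map makes \<open>M\<close> a similitude of \<open>\<Lambda>\<close> up to an ideal. Let \<open>J\<close> be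
  the smallest ideal with \<open>M \<Lambda> \<subseteq> J \<Lambda>\<close>. If \<open>S \<mapsto> r * M\<^sup>\<dagger> S M\<close> preserves \<open>Herm\<close>, then \<open>r * (x * cnj y)\<close> is integral for all
  \<open>x, y\<close> in \<open>J\<close> (\<open>act_Herm_imp_content\<close>). As the map preserves the determinant, \<open>r * \<bar>det M\<bar> = 1\<close>, and comparing
  \<open>det M\<close> with \<open>J\<^sup>2\<close> yields \<open>M \<Lambda> = J \<Lambda>\<close>, \<open>N(J) = 1 / r\<close> and \<open>J\<^sup>2 = det M \<O>\<close> (\<open>integral_act_similitude\<close>). So the class
  of \<open>J\<close> is 2-torsion, \<open>J = k I\<close> for a representative \<open>I\<close>, and \<open>M = k P M\<^sub>I\<close> with an automorphism \<open>P\<close> of \<open>\<Lambda>\<close>;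
  that is, the map is \<open>\<gamma>\<^sub>I \<circ> h\<^sub>P\<close> (\<open>G_A_factor\<close>).

  The representatives lie in different cosets: a matrix is determined by its action up to a scalar
  (\<open>act_eq_scalar\<close>), so \<open>\<gamma>\<^sub>I = \<gamma>\<^sub>J \<circ> h\<^sub>P\<close> gives \<open>I = k J\<close>; and \<open>\<tau>\<close> is not the action of a matrix
  (\<open>act_not_swap\<close>), which separates the two families.

  The count also requires that a matrix \<open>M\<^sub>I\<close> exists for every \<open>I\<close> with \<open>I\<^sup>2\<close> principal and that the 2-torsion is
  finite. Both, like the invertibility of ideals and the formula \<open>I * cnj I = N(I) \<O>\<close>, come from the normal form
  \<open>I = k (\<int> a + \<int> (b + w))\<close>, with \<open>1, w\<close> an integral basis of \<open>\<O>\<close>, which translates ideals into primitive binary quadratic forms: a primitive form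
  represents an integer prime to any given one (\<open>ex_coprime_element\<close>, \<open>ex_ideal_similitude\<close>), and each class contains
  a reduced form (\<open>finite_class_group_2_torsion\<close>).
\<close>

hide_const (open) Module.smult UnivPoly.coeff UnivPoly.monom

section \<open>Traces and norms in an imaginary quadratic field\<close>

lemma complex_ring_simps [simp]:
  "carrier (complex_ring S) = S" "mult (complex_ring S) = (*)" "one (complex_ring S) = 1"
  "zero (complex_ring S) = 0" "add (complex_ring S) = (+)"
  by (simp_all add: complex_ring_def)

lemma field_complex_ring: "field (complex_ring UNIV)"
proof (rule cring.cring_fieldI)
  show "cring (complex_ring UNIV)"
  proof (rule cringI)
    show "abelian_group (complex_ring UNIV)"
      by (rule abelian_groupI) (auto simp: algebra_simps intro: exI[of _ "- x" for x])
    show "comm_monoid (complex_ring UNIV)"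
      by (rule comm_monoidI) auto
  qed (auto simp: algebra_simps)
  show "Units (complex_ring UNIV) = carrier (complex_ring UNIV) - {\<zero>\<^bsub>complex_ring UNIV\<^esub>}"
  proof (intro equalityI subsetI)
    fix x assume "x \<in> carrier (complex_ring UNIV) - {\<zero>\<^bsub>complex_ring UNIV\<^esub>}"
    then show "x \<in> Units (complex_ring UNIV)"
      by (auto simp: Units_def intro!: exI[of _ "inverse x"])
  qed (auto simp: Units_def)
qed

lemma subfield_complex_closed:
  assumes "subfield K (complex_ring UNIV)"
  shows "0 \<in> K" "1 \<in> K" "\<And>x y. x \<in> K \<Longrightarrow> y \<in> K \<Longrightarrow> x + y \<in> K"
    "\<And>x y. x \<in> K \<Longrightarrow> y \<in> K \<Longrightarrow> x * y \<in> K"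
    "\<And>x. x \<in> K \<Longrightarrow> - x \<in> K" "\<And>x. x \<in> K \<Longrightarrow> inverse x \<in> K"
proof -
  interpret field "complex_ring UNIV" by (rule field_complex_ring)
  have neg: "\<ominus>\<^bsub>complex_ring UNIV\<^esub> x = - x" for x
    by (rule minus_equality) auto
  note sr = subringE[OF subfieldE(1)[OF assms]]
  show "0 \<in> K" "1 \<in> K" using sr by auto
  show "x + y \<in> K" if "x \<in> K" "y \<in> K" for x y using sr(7)[OF that] by simp
  show "x * y \<in> K" if "x \<in> K" "y \<in> K" for x y using sr(6)[OF that] by simp
  show "- x \<in> K" if "x \<in> K" for x using sr(5)[OF that] neg by simp
  show "inverse x \<in> K" if "x \<in> K" for x
  proof (cases "x = 0")
    case False
    then have "inv\<^bsub>complex_ring UNIV\<^esub> x \<in> K - {0}"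
      using subfield_m_inv(1)[OF assms, of x] that by simp
    moreover have "inv\<^bsub>complex_ring UNIV\<^esub> x = inverse x"
      using False by (intro comm_inv_char) auto
    ultimately show ?thesis by simp
  qed (use \<open>0 \<in> K\<close> in simp)
qed

lemma dimension_two_complex:
  assumes "ring.dimension (complex_ring UNIV) 2 F K"
  shows "\<exists>u v. K = {a * u + b * v | a b. a \<in> F \<and> b \<in> F}"
proof -
  interpret field "complex_ring UNIV" by (rule field_complex_ring)
  from assms obtain u E where E: "dimension 1 F E" "K = line_extension F u E"
    by (cases rule: dimension.cases) auto
  from E(1) obtain v E' where E': "dimension 0 F E'" "E = line_extension F v E'"
    by (cases rule: dimension.cases) auto
  have "E' = {0}" using E'(1) by (cases rule: dimension.cases) auto
  then have "E = {b * v | b. b \<in> F}"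
    unfolding E'(2) line_extension_def set_add_def' by (auto simp: r_coset_def)
  then have "K = {a * u + b * v | a b. a \<in> F \<and> b \<in> F}"
    unfolding E(2) line_extension_def set_add_def' by (auto simp: r_coset_def)
  then show ?thesis by blast
qed

lemma Rats_imp_Reals: "x \<in> \<rat> \<Longrightarrow> x \<in> (\<real> :: complex set)"
  by (metis Rats_cases' Reals_divide Reals_of_int)

lemma Rats_complexE:
  assumes "x \<in> (\<rat> :: complex set)"
  obtains r :: real where "r \<in> \<rat>" "x = of_real r"
proof -
  from assms obtain a b :: int where "x = of_int a / of_int b" by (metis Rats_cases')
  then have "x = of_real (of_int a / of_int b)" by simp
  then show thesis by (rule that[rotated]) simp
qed

text \<open>Both \<open>1\<close> and \<open>x\<close> have rational coordinates with respect to any two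
  generators of \<open>K\<close>. Their coordinate determinant does not vanish, since otherwise \<open>x\<close> would be
  rational, so Cramer's rule expresses the generators by \<open>1\<close> and \<open>x\<close>.\<close>

lemma imaginary_quadratic_basis:
  assumes "imaginary_quadratic_field K" "x \<in> K" "x \<notin> \<real>" "k \<in> K"
  shows "\<exists>a\<in>\<rat>. \<exists>b\<in>\<rat>. k = a + b * x"
proof -
  from assms(1) obtain u v where K: "K = {a * u + b * v | a b. a \<in> \<rat> \<and> b \<in> \<rat>}"
    and sf: "subfield K (complex_ring UNIV)"
    unfolding imaginary_quadratic_field_def using dimension_two_complex by blast
  obtain a1 b1 where 1: "1 = a1 * u + b1 * v" "a1 \<in> \<rat>" "b1 \<in> \<rat>"
    using subfield_complex_closed(2)[OF sf] unfolding K by blast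
  obtain a2 b2 where 2: "x = a2 * u + b2 * v" "a2 \<in> \<rat>" "b2 \<in> \<rat>"
    using assms(2) unfolding K by blast
  obtain a b where 3: "k = a * u + b * v" "a \<in> \<rat>" "b \<in> \<rat>"
    using assms(4) unfolding K by blast
  define d where "d = a1 * b2 - a2 * b1"
  have d: "d \<in> \<rat>" unfolding d_def using 1 2 by simp
  have "b2 - b1 * x = b2 * (a1 * u + b1 * v) - b1 * (a2 * u + b2 * v)"
    unfolding 1(1)[symmetric] 2(1)[symmetric] by simp
  then have u: "b2 - b1 * x = d * u" by (simp add: d_def algebra_simps)
  have "a1 * x - a2 = a1 * (a2 * u + b2 * v) - a2 * (a1 * u + b1 * v)"
    unfolding 1(1)[symmetric] 2(1)[symmetric] by simp
  then have v: "a1 * x - a2 = d * v" by (simp add: d_def algebra_simps)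
  have "d \<noteq> 0"
  proof
    assume "d = 0"
    then have "b1 * x = b2" "a1 * x = a2" using u v by auto
    moreover have "a1 \<noteq> 0 \<or> b1 \<noteq> 0" using 1(1) by auto
    ultimately have "x = b2 / b1 \<or> x = a2 / a1" by (auto simp: field_simps)
    then have "x \<in> \<rat>" using 1 2 by auto
    then show False using assms(3) Rats_imp_Reals by auto
  qed
  then have "k = a * ((b2 - b1 * x) / d) + b * ((a1 * x - a2) / d)"
    unfolding 3(1) u v by simp
  also have "\<dots> = (a * b2 - b * a2) / d + ((b * a1 - a * b1) / d) * x"
    using \<open>d \<noteq> 0\<close> by (simp add: field_simps)
  finally show ?thesis
    by (intro bexI[where x = "(a * b2 - b * a2) / d"] bexI[where x = "(b * a1 - a * b1) / d"])
      (use 1(2,3) 2(2,3) 3(2,3) d in simp_all)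
qed


lemma imaginary_quadratic_trace_norm_rat:
  assumes "imaginary_quadratic_field K" "x \<in> K" "x \<notin> \<real>"
  shows "2 * Re x \<in> \<rat>" "(cmod x)\<^sup>2 \<in> \<rat>"
proof -
  have "x * x \<in> K"
    using assms subfield_complex_closed(4) unfolding imaginary_quadratic_field_def by blast
  then obtain a b where "a \<in> \<rat>" "b \<in> \<rat>" and eq: "x * x = a + b * x"
    using imaginary_quadratic_basis[OF assms] by blast
  then obtain a' b' :: real where ab': "a = of_real a'" "b = of_real b'" "a' \<in> \<rat>" "b' \<in> \<rat>"
    by (metis Rats_complexE)
  have "Im x \<noteq> 0" using assms(3) by (simp add: complex_is_Real_iff)
  have "2 * Re x * Im x = b' * Im x"
    using arg_cong[OF eq, of Im] unfolding ab' by simp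
  then have 1: "2 * Re x = b'" using \<open>Im x \<noteq> 0\<close> by simp
  then show "2 * Re x \<in> \<rat>" using ab' by simp
  have "Re x * Re x - Im x * Im x = a' + (2 * Re x) * Re x"
    using arg_cong[OF eq, of Re] unfolding ab' 1 by simp
  then have "(cmod x)\<^sup>2 = - a'"
    unfolding cmod_power2 by (simp add: power2_eq_square algebra_simps)
  then show "(cmod x)\<^sup>2 \<in> \<rat>" using ab' by simp
qed

lemma imaginary_quadratic_real_rat:
  assumes "imaginary_quadratic_field K" "x \<in> K" "x \<in> \<real>"
  shows "x \<in> \<rat>"
proof -
  obtain y where y: "y \<in> K" "y \<notin> \<real>"
    using assms(1) unfolding imaginary_quadratic_field_def by blast
  obtain a b where ab: "a \<in> \<rat>" "b \<in> \<rat>" "x = a + b * y"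
    using imaginary_quadratic_basis[OF assms(1) y assms(2)] by blast
  have "b = 0"
  proof (rule ccontr)
    assume "b \<noteq> 0"
    then have "y = (x - a) / b" using ab by (simp add: field_simps)
    also have "\<dots> \<in> \<real>" using ab assms(3) Rats_imp_Reals by (intro Reals_divide Reals_diff) auto
    finally show False using y by simp
  qed
  then show ?thesis using ab by simp
qed


lemma map_poly_of_int_hom:
  "map_poly of_int (p + q) = (map_poly of_int p + map_poly of_int q :: complex poly)"
  "map_poly of_int (p * q) = (map_poly of_int p * map_poly of_int q :: complex poly)"
  by (rule poly_eqI; simp add: coeff_map_poly coeff_mult)+

text \<open>Gauss's lemma. Let \<open>G\<close> be the primitive integral multiple of the minimal polynomial of \<open>x\<close>
  and \<open>f\<close> a monic integral polynomial vanishing at \<open>x\<close>. Pseudo-division of \<open>f\<close> by \<open>G\<close> leaves no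
  remainder, because a nonzero linear polynomial over the integers has no nonreal root. Comparing
  contents, the quotient of \<open>f\<close> by \<open>G\<close> is integral, so the leading coefficient of \<open>G\<close> is a unit.\<close>

lemma nonreal_quadratic_algebraic_int:
  assumes "algebraic_int x" "x \<notin> \<real>" "2 * Re x \<in> \<rat>" "(cmod x)\<^sup>2 \<in> \<rat>"
  shows "2 * Re x \<in> \<int>" "(cmod x)\<^sup>2 \<in> \<int>"
proof -
  from assms(1) obtain f where f: "poly (map_poly of_int f) x = 0" "lead_coeff f = 1"
    by (auto simp: algebraic_int_altdef_ipoly)
  obtain a1 d1 a2 d2 :: int where d: "d1 > 0" "d2 > 0" "2 * Re x = of_int a1 / of_int d1"
    "(cmod x)\<^sup>2 = of_int a2 / of_int d2"
    using assms(3,4) by (metis Rats_cases')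
  define G0 where "G0 = [:a2 * d1, - a1 * d2, d1 * d2:]"
  define G where "G = primitive_part G0"
  define a where "a = lead_coeff G"
  have "G0 \<noteq> 0" and degG0: "degree G0 = 2" using d by (auto simp: G0_def)
  then have degG: "degree G = 2" "G \<noteq> 0" "content G = 1" by (auto simp: G_def)
  have cc: "x * x = 2 * of_real (Re x) * x - of_real ((cmod x)\<^sup>2)"
    unfolding complex_eq_iff cmod_power2 by (simp add: power2_eq_square algebra_simps)
  have "poly (map_poly of_int G0) x =
      of_int d1 * of_int d2 * (of_real ((cmod x)\<^sup>2) - of_real (2 * Re x) * x + x * x)"
    unfolding d(3,4) G0_def using d(1,2) by (simp add: map_poly_pCons field_simps)
  also have "\<dots> = 0" unfolding cc by simp
  finally have G0x: "poly (map_poly of_int G0) x = 0" .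
  have "map_poly of_int G0 = (map_poly of_int [:content G0:] * map_poly of_int G :: complex poly)"
    unfolding map_poly_of_int_hom(2)[symmetric] G_def by simp
  then have Gx: "poly (map_poly of_int G) x = 0"
    using G0x \<open>G0 \<noteq> 0\<close> by (simp add: map_poly_pCons)
  obtain H r where Hr: "pseudo_divmod f G = (H, r)" by force
  define c where "c = a ^ (Suc (degree f) - degree G)"
  have div: "smult c f = G * H + r" "r = 0 \<or> degree r < 2"
    using pseudo_divmod[OF degG(2) Hr] degG(1) by (auto simp: c_def a_def)
  have "poly (map_poly of_int (smult c f)) x = of_int c * poly (map_poly of_int f) x"
    using map_poly_of_int_hom(2)[of "[:c:]" f] by (simp add: map_poly_pCons)
  then have rx: "poly (map_poly of_int r) x = 0"
    using f Gx unfolding div(1) by (simp add: map_poly_of_int_hom)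
  have "r = 0"
  proof -
    obtain r0 r1 where r: "r = [:r0, r1:]"
    proof (rule that)
      show "r = [:coeff r 0, coeff r 1:]"
        using div(2) by (intro poly_eqI) (auto simp: coeff_pCons coeff_eq_0 split: nat.splits)
    qed
    have eq: "of_int r0 + of_int r1 * x = 0" using rx unfolding r by (simp add: map_poly_pCons mult.commute)
    have "Im x \<noteq> 0" using assms(2) by (simp add: complex_is_Real_iff)
    then have "r1 = 0" using arg_cong[OF eq, of Im] by simp
    then show ?thesis using eq unfolding r by simp
  qed
  have a0: "a \<noteq> 0" unfolding a_def using degG(2) by (simp only: leading_coeff_0_iff not_False_eq_True)
  have "content f dvd 1" using f(2) content_dvd_coeff[of f "degree f"] by simp
  then have "normalize (content f) = 1" by (simp only: is_unit_normalize)
  then have "content f = 1" by (simp only: normalize_content)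
  then have "content (smult c f) = normalize c" by simp
  then have "content H = normalize c" unfolding div(1) \<open>r = 0\<close> by (simp add: content_mult degG)
  then have "c dvd content H" by simp
  then have "\<forall>n. c dvd coeff H n" using content_dvd_coeff dvd_trans by blast
  then have "[:c:] dvd H" by (simp add: const_poly_dvd_iff)
  then obtain H' where H': "H = smult c H'" by (auto simp: dvd_def)
  have "c \<noteq> 0" using a0 by (simp add: c_def)
  moreover have "smult c (f - G * H') = 0"
    unfolding smult_diff_right div(1) \<open>r = 0\<close> H' by simp
  ultimately have "f = G * H'" by (simp only: smult_eq_0_iff) simp
  then have "a * lead_coeff H' = 1" using f(2) by (simp add: lead_coeff_mult a_def)
  then have a1: "a = 1 \<or> a = -1" by (metis zmult_eq_1_iff)
  have G0G: "G0 = smult (content G0) G" by (simp add: G_def)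
  have "coeff G0 2 = content G0 * a" by (subst G0G) (simp add: a_def degG(1))
  then have "d1 * d2 = content G0 * a" by (simp add: G0_def numeral_2_eq_2)
  then have dd: "d1 * d2 dvd content G0" using a1 by (auto simp: dvd_def)
  have "d1 * d2 dvd coeff G0 0" "d1 * d2 dvd coeff G0 1" using dd content_dvd_coeff dvd_trans by blast+
  then have "d2 dvd a2" "d1 dvd a1" using d by (auto simp: G0_def mult.commute)
  then show "2 * Re x \<in> \<int>" "(cmod x)\<^sup>2 \<in> \<int>" unfolding d(3,4) using d(1,2) by auto
qed

section \<open>An integral basis of the maximal order\<close>

lemma max_order_trace_norm_int:
  assumes "imaginary_quadratic_field K" "x \<in> max_order K"
  shows "2 * Re x \<in> \<int>" "(cmod x)\<^sup>2 \<in> \<int>"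
proof -
  have x: "x \<in> K" "algebraic_int x" using assms(2) by (auto simp: max_order_def)
  show "2 * Re x \<in> \<int>" "(cmod x)\<^sup>2 \<in> \<int>"
  proof (atomize (full), cases "x \<in> \<real>")
    case True
    then have "x \<in> \<int>"
      using imaginary_quadratic_real_rat[OF assms(1) x(1)] rational_algebraic_int_is_int[OF x(2)] by simp
    then obtain m where "x = of_int m" by (auto simp: Ints_def)
    then show "2 * Re x \<in> \<int> \<and> (cmod x)\<^sup>2 \<in> \<int>" by (simp add: cmod_power2)
  next
    case False
    then show "2 * Re x \<in> \<int> \<and> (cmod x)\<^sup>2 \<in> \<int>"
      using nonreal_quadratic_algebraic_int[OF x(2) False]
        imaginary_quadratic_trace_norm_rat[OF assms(1) x(1)] by blast
  qed
qed

lemma algebraic_int_if_trace_norm_int: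
  assumes "2 * Re x \<in> \<int>" "(cmod x)\<^sup>2 \<in> \<int>"
  shows "algebraic_int x"
proof -
  define p where "p = [:of_real ((cmod x)\<^sup>2), - of_real (2 * Re x), 1 :: complex:]"
  have "of_real ((cmod x)\<^sup>2) \<in> (\<int> :: complex set)" "of_real (2 * Re x) \<in> (\<int> :: complex set)"
    using assms by (metis Ints_cases Ints_of_int of_real_of_int_eq)+
  then have "\<forall>i. coeff p i \<in> \<int>"
    by (auto simp: p_def coeff_pCons simp del: of_real_mult of_real_power split: nat.splits)
  moreover have "poly p x = 0"
    unfolding p_def complex_eq_iff cmod_power2 by (simp add: power2_eq_square algebra_simps)
  ultimately show ?thesis by (intro algebraic_int.intros[of p]) (auto simp: p_def)
qed

lemma max_order_iff:
  assumes "imaginary_quadratic_field K"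
  shows "x \<in> max_order K \<longleftrightarrow> x \<in> K \<and> 2 * Re x \<in> \<int> \<and> (cmod x)\<^sup>2 \<in> \<int>"
  using max_order_trace_norm_int[OF assms] algebraic_int_if_trace_norm_int
  by (auto simp: max_order_def)

text \<open>The addition in the maximal order rests on this: the norm of \<open>x + y\<close> differs from the sum
  of the two norms by the trace of \<open>x * cnj y\<close>. Twice that trace is \<open>tr x * tr y + m\<close> with
  \<open>m = 4 * Im x * Im y\<close>. Here \<open>m\<close> is rational and its square is the product of the two discriminants, so
  it is an integer, and since discriminants are squares modulo 4 it has the parity of \<open>tr x * tr y\<close>.\<close>

lemma max_order_mixed_trace_int:
  assumes "imaginary_quadratic_field K" "x \<in> max_order K" "y \<in> max_order K"
  shows "2 * Re (x * cnj y) \<in> \<int>"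
proof (cases "x \<in> \<real> \<or> y \<in> \<real>")
  case True
  have I: "z \<in> \<int>" if "z \<in> \<real>" "z \<in> max_order K" for z
    using that imaginary_quadratic_real_rat[OF assms(1)] rational_algebraic_int_is_int
    by (auto simp: max_order_def)
  have "2 * Re (x * cnj y) = 2 * Re x * Re y + Im y * 2 * Im x" by simp
  from True show ?thesis
  proof
    assume "x \<in> \<real>"
    then obtain m where "x = of_int m" using I assms by (auto simp: Ints_def)
    then have "2 * Re (x * cnj y) = of_int m * (2 * Re y)" by simp
    then show ?thesis using max_order_trace_norm_int(1)[OF assms(1,3)] Ints_mult Ints_of_int by metis
  next
    assume "y \<in> \<real>"
    then obtain m where "y = of_int m" using I assms by (auto simp: Ints_def)
    then have "2 * Re (x * cnj y) = of_int m * (2 * Re x)" by simp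
    then show ?thesis using max_order_trace_norm_int(1)[OF assms(1,2)] Ints_mult Ints_of_int by metis
  qed
next
  case False
  have K: "x \<in> K" "y \<in> K" using assms by (auto simp: max_order_def)
  obtain a b where ab: "a \<in> \<rat>" "b \<in> \<rat>" "y = a + b * x"
    using imaginary_quadratic_basis[OF assms(1) K(1) _ K(2)] False by blast
  obtain b' where b': "b' \<in> \<rat>" "b = of_real b'" using ab by (metis Rats_complexE)
  obtain a' where a': "a' \<in> \<rat>" "a = of_real a'" using ab by (metis Rats_complexE)
  obtain tx ty nx ny :: int where
    i: "2 * Re x = of_int tx" "2 * Re y = of_int ty" "(cmod x)\<^sup>2 = of_int nx" "(cmod y)\<^sup>2 = of_int ny"
    using max_order_trace_norm_int[OF assms(1)] assms(2,3) by (metis Ints_cases)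
  have imx: "4 * (Im x)\<^sup>2 = of_int (4 * nx - tx\<^sup>2)" "4 * (Im y)\<^sup>2 = of_int (4 * ny - ty\<^sup>2)"
    unfolding of_int_diff of_int_mult of_int_power i[symmetric] cmod_power2
    by (simp_all add: power_mult_distrib)
  have "4 * Im x * Im y = b' * (4 * (Im x)\<^sup>2)" using ab(3) b' a' by (simp add: power2_eq_square)
  then have rat: "4 * Im x * Im y \<in> \<rat>" unfolding imx(1) using b' by (metis Rats_mult Rats_of_int)
  have sq: "(4 * Im x * Im y)\<^sup>2 = of_int ((4 * nx - tx\<^sup>2) * (4 * ny - ty\<^sup>2))"
    unfolding of_int_mult imx[symmetric] by (simp add: power_mult_distrib)
  have "algebraic_int (4 * Im x * Im y)"
  proof -
    have "poly [:- of_int ((4 * nx - tx\<^sup>2) * (4 * ny - ty\<^sup>2)), 0, 1:] (4 * Im x * Im y) = 0"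
      using sq by (simp add: power2_eq_square)
    moreover have "\<forall>i. coeff [:- of_int ((4 * nx - tx\<^sup>2) * (4 * ny - ty\<^sup>2)), 0, 1 :: real:] i \<in> \<int>"
      by (auto simp: coeff_pCons simp del: of_int_mult of_int_diff split: nat.splits)
    ultimately show ?thesis by (intro algebraic_int.intros[rotated 2]) auto
  qed
  then obtain m where m: "4 * Im x * Im y = of_int m"
    using rational_algebraic_int_is_int[OF _ rat] by (auto simp: Ints_def)
  have "of_int (m\<^sup>2) = (of_int ((4 * nx - tx\<^sup>2) * (4 * ny - ty\<^sup>2)) :: real)"
    using sq unfolding m by simp
  then have "m\<^sup>2 = (4 * nx - tx\<^sup>2) * (4 * ny - ty\<^sup>2)" by (simp only: of_int_eq_iff)
  then have "even (m\<^sup>2) \<longleftrightarrow> even ((tx * ty)\<^sup>2)" by simp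
  then have "even (tx * ty + m)" by simp
  then obtain k where k: "tx * ty + m = 2 * k" by blast
  have "2 * (2 * Re (x * cnj y)) = (2 * Re x) * (2 * Re y) + 4 * Im x * Im y" by simp
  also have "\<dots> = of_int (2 * k)" unfolding i m k[symmetric] by simp
  finally have "2 * Re (x * cnj y) = of_int k" by simp
  then show ?thesis by simp
qed

lemma max_order_closed:
  assumes "imaginary_quadratic_field K"
  shows "\<And>x y. x \<in> max_order K \<Longrightarrow> y \<in> max_order K \<Longrightarrow> x + y \<in> max_order K"
    and "\<And>x m. x \<in> max_order K \<Longrightarrow> of_int m * x \<in> max_order K"
    and "\<And>m. of_int m \<in> max_order K"
proof -
  have sf: "subfield K (complex_ring UNIV)"
    using assms by (simp add: imaginary_quadratic_field_def)
  note Kc = subfield_complex_closed[OF sf]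
  have nat: "of_nat m \<in> K" for m by (induction m) (use Kc in auto)
  have int: "of_int m \<in> K" for m by (cases m rule: int_cases2) (use Kc nat in auto)
  note iff = max_order_iff[OF assms]
  show "x + y \<in> max_order K" if "x \<in> max_order K" "y \<in> max_order K" for x y
  proof -
    have "(cmod (x + y))\<^sup>2 = (cmod x)\<^sup>2 + (cmod y)\<^sup>2 + 2 * Re (x * cnj y)"
      unfolding cmod_power2 by (simp add: power2_eq_square algebra_simps)
    moreover have "2 * Re (x + y) = 2 * Re x + 2 * Re y" by simp
    ultimately show ?thesis
      using that max_order_mixed_trace_int[OF assms that] unfolding iff
      by (simp only: Kc(3) Ints_add simp_thms)
  qed
  show "of_int m * x \<in> max_order K" if "x \<in> max_order K" for x m
  proof -
    have "(cmod (of_int m * x))\<^sup>2 = of_int (m\<^sup>2) * (cmod x)\<^sup>2"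
      by (simp add: norm_mult power_mult_distrib)
    moreover have "2 * Re (of_int m * x) = of_int m * (2 * Re x)" by simp
    ultimately show ?thesis using that unfolding iff
      by (simp only: Kc(4) int Ints_mult Ints_of_int simp_thms)
  qed
  show "of_int m \<in> max_order K" for m
    by (simp add: max_order_def int int_imp_algebraic_int)
qed

text \<open>The parameters \<open>t\<close> and \<open>q\<close> are the trace and the norm of \<open>w\<close>, so the discriminant of the
  maximal order is \<open>t\<^sup>2 - 4 * q = (w - cnj w)\<^sup>2\<close>.\<close>

locale quad_order =
  fixes K :: "complex set" and w :: complex and t q :: int
  assumes iqf: "imaginary_quadratic_field K"
    and max_order_eq: "max_order K = {of_int x + of_int y * w | x y. True}"
    and w_sq: "w * w = of_int t * w - of_int q"
    and Im_w: "Im w > 0"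

text \<open>Since \<open>4 * (Im x)\<^sup>2\<close> is an integer for every \<open>x\<close> in the maximal order, there is an
  element \<open>w\<close> of smallest positive imaginary part. Subtracting a multiple of \<open>w\<close> from an arbitrary element
  leaves an imaginary part in \<open>[0, Im w)\<close>, hence a rational integer.\<close>

lemma ex_quad_order:
  assumes "imaginary_quadratic_field K"
  shows "\<exists>w t q. quad_order K w t q"
proof -
  note cl = max_order_closed[OF assms]
  note iff = max_order_iff[OF assms]
  have sf: "subfield K (complex_ring UNIV)" using assms by (simp add: imaginary_quadratic_field_def)
  note Kc = subfield_complex_closed[OF sf]
  define m where "m = (\<lambda>x :: complex. nat \<lfloor>4 * (Im x)\<^sup>2\<rfloor>)"
  have m: "real (m x) = 4 * (Im x)\<^sup>2" if "x \<in> max_order K" for x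
  proof -
    have "4 * (Im x)\<^sup>2 = 4 * (cmod x)\<^sup>2 - (2 * Re x)\<^sup>2"
      unfolding cmod_power2 by (simp add: power_mult_distrib)
    also have "\<dots> \<in> \<int>"
      using that unfolding iff by (simp only: Ints_diff Ints_mult Ints_power Ints_numeral)
    finally obtain k where "4 * (Im x)\<^sup>2 = of_int k" by (auto simp: Ints_def)
    then show ?thesis unfolding m_def
      by (metis floor_of_int of_nat_nat of_int_of_nat_eq zero_le_floor zero_le_mult_iff zero_le_numeral zero_le_power2)
  qed
  define P where "P = (\<lambda>x. x \<in> max_order K \<and> Im x > 0)"
  have "\<exists>x. P x"
  proof -
    obtain x where x: "x \<in> K" "x \<notin> \<real>" using assms by (auto simp: imaginary_quadratic_field_def)
    obtain a d b e :: int where d: "d > 0" "e > 0" "2 * Re x = of_int a / of_int d"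
      "(cmod x)\<^sup>2 = of_int b / of_int e"
      using imaginary_quadratic_trace_norm_rat[OF assms x] by (metis Rats_cases')
    define y where "y = of_int d * of_int e * x"
    have "2 * Re y = of_int d * of_int e * (2 * Re x)" by (simp add: y_def)
    then have 1: "2 * Re y = of_int (a * e)" unfolding d(3) using d by simp
    have "(cmod y)\<^sup>2 = (of_int d)\<^sup>2 * (of_int e)\<^sup>2 * (cmod x)\<^sup>2"
      by (simp add: y_def norm_mult power_mult_distrib)
    then have 2: "(cmod y)\<^sup>2 = of_int (d\<^sup>2 * e * b)" unfolding d(4) using d by (simp add: power2_eq_square)
    have y: "y \<in> max_order K"
    proof -
      have "y \<in> K" unfolding y_def using x(1) Kc(4) cl(3)[unfolded max_order_def] by auto
      then show ?thesis unfolding iff 1 2 by simp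
    qed
    have "Im y \<noteq> 0" using x(2) d by (simp add: y_def complex_is_Real_iff)
    moreover have "- y \<in> max_order K" using cl(2)[OF y, of "-1"] by simp
    ultimately show ?thesis using y unfolding P_def
      by (cases "Im y > 0") (auto intro: exI[of _ y] exI[of _ "- y"])
  qed
  then obtain w where w: "P w" "\<And>y. P y \<Longrightarrow> m w \<le> m y"
    using ex_has_least_nat[of P _ m] by blast
  have wO: "w \<in> max_order K" "Im w > 0" using w(1) by (auto simp: P_def)
  obtain t q :: int where tq: "2 * Re w = of_int t" "(cmod w)\<^sup>2 = of_int q"
    using wO(1) unfolding iff by (auto simp: Ints_def)
  have "\<exists>x y. z = of_int x + of_int y * w" if "z \<in> max_order K" for z
  proof -
    define k where "k = \<lfloor>Im z / Im w\<rfloor>"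
    define z' where "z' = z + of_int (- k) * w"
    have z': "z' \<in> max_order K" unfolding z'_def using cl that wO by blast
    have "of_int k \<le> Im z / Im w" "Im z / Im w < of_int k + 1" unfolding k_def by linarith+
    then have "0 \<le> Im z'" "Im z' < Im w" using wO(2) by (simp_all add: z'_def field_simps)
    have "Im z' = 0"
    proof (rule ccontr)
      assume "Im z' \<noteq> 0"
      then have "real (m w) \<le> real (m z')" using w(2)[of z'] z' \<open>0 \<le> Im z'\<close> by (simp add: P_def)
      then have "Im w ^ 2 \<le> Im z' ^ 2" using m wO(1) z' by simp
      then show False using \<open>0 \<le> Im z'\<close> \<open>Im z' < Im w\<close>
        by (meson linorder_not_le power_strict_mono zero_less_numeral)
    qed
    then have "z' \<in> \<int>"
      using imaginary_quadratic_real_rat[OF assms, of z'] rational_algebraic_int_is_int z'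
      by (auto simp: max_order_def complex_is_Real_iff)
    then obtain x where "z' = of_int x" by (auto simp: Ints_def)
    then have "z = of_int x + of_int k * w" by (simp add: z'_def algebra_simps)
    then show ?thesis by blast
  qed
  moreover have "of_int x + of_int y * w \<in> max_order K" for x y using cl wO by blast
  ultimately have "max_order K = {of_int x + of_int y * w | x y. True}" by blast
  moreover have "w * w = of_int t * w - of_int q"
  proof -
    have "w * w = of_real (2 * Re w) * w - of_real ((cmod w)\<^sup>2)"
      unfolding complex_eq_iff cmod_power2 by (simp add: power2_eq_square algebra_simps)
    then show ?thesis unfolding tq by simp
  qed
  ultimately have "quad_order K w t q" using assms wO by (simp add: quad_order_def)
  then show ?thesis by blast
qed

section \<open>Products of fractional ideals\<close>

text \<open>The ring record only contributes addition and multiplication to \<^const>\<open>ideal_prod\<close>, so a single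
  operation serves for integral and for fractional ideals.\<close>

abbreviation ideal_mult :: "complex set \<Rightarrow> complex set \<Rightarrow> complex set" (infixl "\<star>" 80)
  where "I \<star> J \<equiv> ideal_prod (complex_ring UNIV) I J"

lemma ideal_prod_complex_ring: "ideal_prod (complex_ring S) I J = I \<star> J"
proof (intro equalityI subsetI)
  fix x assume "x \<in> ideal_prod (complex_ring S) I J"
  then show "x \<in> I \<star> J"
  proof induction
    case (prod i j)
    then show ?case using ideal_prod.prod[of i I j J "complex_ring UNIV"] by simp
  next
    case (sum x y)
    then show ?case using ideal_prod.sum[of x "complex_ring UNIV" I J y] by simp
  qed
next
  fix x assume "x \<in> I \<star> J"
  then show "x \<in> ideal_prod (complex_ring S) I J"
  proof induction
    case (prod i j)
    then show ?case using ideal_prod.prod[of i I j J "complex_ring S"] by simp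
  next
    case (sum x y)
    then show ?case using ideal_prod.sum[of x "complex_ring S" I J y] by simp
  qed
qed

lemma ideal_multI: "i \<in> I \<Longrightarrow> j \<in> J \<Longrightarrow> i * j \<in> I \<star> J"
  using ideal_prod.prod[of i I j J "complex_ring UNIV"] by simp

lemma ideal_mult_add: "x \<in> I \<star> J \<Longrightarrow> y \<in> I \<star> J \<Longrightarrow> x + y \<in> I \<star> J"
  using ideal_prod.sum[of x "complex_ring UNIV" I J y] by simp

lemma ideal_mult_induct [consumes 1, case_names mult add]:
  assumes "x \<in> I \<star> J" "\<And>i j. i \<in> I \<Longrightarrow> j \<in> J \<Longrightarrow> P (i * j)" "\<And>x y. P x \<Longrightarrow> P y \<Longrightarrow> P (x + y)"
  shows "P x"
  using assms(1) by induction (use assms(2,3) in auto)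

lemma ideal_mult_least:
  assumes "\<And>i j. i \<in> I \<Longrightarrow> j \<in> J \<Longrightarrow> i * j \<in> S" "\<And>x y. x \<in> S \<Longrightarrow> y \<in> S \<Longrightarrow> x + y \<in> S"
  shows "I \<star> J \<subseteq> S"
proof
  fix x assume "x \<in> I \<star> J"
  then show "x \<in> S" by (induction rule: ideal_mult_induct) (use assms in auto)
qed

lemma ideal_mult_comm: "I \<star> J = J \<star> I"
proof -
  have "I \<star> J \<subseteq> J \<star> I" for I J :: "complex set"
    by (rule ideal_mult_least) (metis mult.commute ideal_multI, rule ideal_mult_add)
  then show ?thesis by blast
qed

lemma ideal_mult_assoc: "(I \<star> J) \<star> L = I \<star> (J \<star> L)"
proof -
  have *: "(I \<star> J) \<star> L \<subseteq> I \<star> (J \<star> L)" for I J L :: "complex set"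
  proof (rule ideal_mult_least)
    fix x l assume "x \<in> I \<star> J" "l \<in> L"
    then show "x * l \<in> I \<star> (J \<star> L)"
      by (induction rule: ideal_mult_induct)
        (auto simp: mult.assoc distrib_right intro: ideal_multI ideal_mult_add)
  qed (rule ideal_mult_add)
  have "I \<star> (J \<star> L) = (L \<star> J) \<star> I" by (simp add: ideal_mult_comm)
  also have "\<dots> \<subseteq> L \<star> (J \<star> I)" by (rule *)
  also have "\<dots> = (I \<star> J) \<star> L" by (simp add: ideal_mult_comm)
  finally show ?thesis using * by blast
qed

lemma ideal_mult_left_comm: "I \<star> (J \<star> L) = J \<star> (I \<star> L)"
  by (metis ideal_mult_assoc ideal_mult_comm)

lemmas ideal_mult_ac = ideal_mult_assoc ideal_mult_comm ideal_mult_left_comm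

lemma ideal_mult_scale: "((*) k ` I) \<star> J = (*) k ` (I \<star> J)"
proof (intro equalityI)
  show "((*) k ` I) \<star> J \<subseteq> (*) k ` (I \<star> J)"
    by (rule ideal_mult_least)
      (auto simp: mult.assoc intro: ideal_multI, metis distrib_left ideal_mult_add imageI)
  show "(*) k ` (I \<star> J) \<subseteq> ((*) k ` I) \<star> J"
  proof clarify
    fix x assume "x \<in> I \<star> J"
    then show "k * x \<in> ((*) k ` I) \<star> J"
    proof (induction rule: ideal_mult_induct)
      case (mult i j)
      then show ?case using ideal_multI[OF imageI[of i I "(*) k"], of j J] by (simp add: mult.assoc)
    qed (auto simp: distrib_left intro: ideal_mult_add)
  qed
qed

lemma ideal_mult_scale_right: "I \<star> ((*) k ` J) = (*) k ` (I \<star> J)"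
  by (metis ideal_mult_comm ideal_mult_scale)

lemma image_scale_scale: "(*) k ` (*) l ` I = (*) (k * l) ` (I :: complex set)"
  by (auto simp: image_image mult.assoc)

lemma cnj_ideal_mult: "cnj ` (I \<star> J) = (cnj ` I) \<star> (cnj ` J)"
proof (intro equalityI)
  show "cnj ` (I \<star> J) \<subseteq> (cnj ` I) \<star> (cnj ` J)"
  proof clarify
    fix x assume "x \<in> I \<star> J"
    then show "cnj x \<in> (cnj ` I) \<star> (cnj ` J)"
      by (induction rule: ideal_mult_induct) (auto intro: ideal_multI ideal_mult_add)
  qed
  show "(cnj ` I) \<star> (cnj ` J) \<subseteq> cnj ` (I \<star> J)"
    by (rule ideal_mult_least)
      (auto intro: ideal_multI simp flip: complex_cnj_mult, metis complex_cnj_add ideal_mult_add imageI)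
qed

lemma cnj_scale: "cnj ` (*) k ` I = (*) (cnj k) ` cnj ` I"
  by (auto simp: image_image)

lemma cnj_cnj_image [simp]: "cnj ` cnj ` I = I"
  by (simp add: image_image)

context quad_order
begin

abbreviation "\<O> \<equiv> max_order K"
abbreviation "frac_ideal \<equiv> fractional_ideal K"

lemma subf: "subfield K (complex_ring UNIV)"
  using iqf by (simp add: imaginary_quadratic_field_def)

lemmas K_closed [simp] = subfield_complex_closed[OF subf]

lemma K_diff [simp]: "x \<in> K \<Longrightarrow> y \<in> K \<Longrightarrow> x - y \<in> K"
  using K_closed(3)[of x "- y"] by simp

lemma K_divide [simp]: "x \<in> K \<Longrightarrow> y \<in> K \<Longrightarrow> x / y \<in> K"
  by (simp add: divide_inverse)

lemma O_subset_K: "x \<in> \<O> \<Longrightarrow> x \<in> K"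
  by (simp add: max_order_def)

lemma O_of_int [simp]: "of_int m \<in> \<O>"
  using max_order_closed(3)[OF iqf] .

lemma O_zero_one [simp]: "0 \<in> \<O>" "1 \<in> \<O>" "of_nat n \<in> \<O>"
  using O_of_int[of 0] O_of_int[of 1] O_of_int[of "int n"] by simp_all

lemma K_of_int [simp]: "of_int m \<in> K" "of_nat n \<in> K"
  using O_subset_K by auto

lemma O_add [simp]: "x \<in> \<O> \<Longrightarrow> y \<in> \<O> \<Longrightarrow> x + y \<in> \<O>"
  using max_order_closed(1)[OF iqf] .

lemma O_minus [simp]: "x \<in> \<O> \<Longrightarrow> - x \<in> \<O>"
  using max_order_closed(2)[OF iqf, of x "-1"] by simp

lemma O_diff [simp]: "x \<in> \<O> \<Longrightarrow> y \<in> \<O> \<Longrightarrow> x - y \<in> \<O>"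
  using O_add[of x "- y"] by simp

lemma w_in_O [simp]: "w \<in> \<O>"
  unfolding max_order_eq by (force intro: exI[of _ 0] exI[of _ 1])

lemma w_in_K [simp]: "w \<in> K"
  by (rule O_subset_K[OF w_in_O])

lemma OE:
  assumes "x \<in> \<O>" obtains a b where "x = of_int a + of_int b * w"
  using assms unfolding max_order_eq by blast

lemma O_mult [simp]:
  assumes "x \<in> \<O>" "y \<in> \<O>"
  shows "x * y \<in> \<O>"
proof -
  obtain a b where x: "x = of_int a + of_int b * w" using assms(1) by (rule OE)
  obtain c d where y: "y = of_int c + of_int d * w" using assms(2) by (rule OE)
  have "x * y = of_int (a * c) + of_int (a * d + b * c) * w + of_int (b * d) * (w * w)"
    by (simp add: x y algebra_simps)
  also have "\<dots> = of_int (a * c - b * d * q) + of_int (a * d + b * c + b * d * t) * w"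
    unfolding w_sq by (simp add: algebra_simps)
  finally show ?thesis unfolding max_order_eq by blast
qed

lemma cnj_w: "cnj w = of_int t - w"
proof -
  have "w * w = of_int t * w - of_int q" by (rule w_sq)
  then have "2 * Re w * Im w = of_int t * Im w"
    by (drule_tac arg_cong[of _ _ Im]) simp
  then have "2 * Re w = of_int t" using Im_w by simp
  then show ?thesis by (simp add: complex_eq_iff)
qed

lemma w_cnj_w: "w * cnj w = of_int q" "cnj w * w = of_int q"
  unfolding cnj_w using w_sq by (simp_all add: algebra_simps)

lemma O_cnj [simp]: "x \<in> \<O> \<Longrightarrow> cnj x \<in> \<O>"
  by (elim OE) (simp add: cnj_w)

lemma cnj_O [simp]: "cnj ` \<O> = \<O>"
  by (auto intro: image_eqI[of _ cnj "cnj x" for x])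

lemma K_cnj [simp]:
  assumes "x \<in> K"
  shows "cnj x \<in> K"
proof -
  have "w \<notin> \<real>" using Im_w by (simp add: complex_is_Real_iff)
  then obtain a b where "a \<in> \<rat>" "b \<in> \<rat>" and x: "x = a + b * w"
    using imaginary_quadratic_basis[OF iqf w_in_K _ assms] by blast
  then have "cnj a = a" "cnj b = b" by (metis Rats_complexE complex_cnj_complex_of_real)+
  moreover have "a \<in> K" "b \<in> K"
    using \<open>a \<in> \<rat>\<close> \<open>b \<in> \<rat>\<close> by (metis Rats_cases' K_divide K_of_int(1))+
  ultimately show ?thesis by (auto simp: x cnj_w)
qed

lemma O_real_int:
  assumes "of_real r \<in> \<O>"
  shows "\<exists>m. r = of_int m"
proof -
  have "of_real r \<in> (\<rat> :: complex set)"
    by (rule imaginary_quadratic_real_rat[OF iqf O_subset_K[OF assms] Reals_of_real])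
  then have "of_real r \<in> (\<int> :: complex set)"
    using rational_algebraic_int_is_int assms by (auto simp: max_order_def)
  then obtain m where "complex_of_real r = of_int m" by (auto simp: Ints_def)
  then have "complex_of_real r = complex_of_real (of_int m)" by simp
  then show ?thesis using of_real_eq_iff by blast
qed

lemma K_denominator:
  assumes "x \<in> K"
  shows "\<exists>d::int. d > 0 \<and> of_int d * x \<in> \<O>"
proof -
  have "w \<notin> \<real>" using Im_w by (simp add: complex_is_Real_iff)
  then obtain a b where "a \<in> \<rat>" "b \<in> \<rat>" and x: "x = a + b * w"
    using imaginary_quadratic_basis[OF iqf w_in_K _ assms] by blast
  then obtain a1 a2 b1 b2 :: int where *: "a = of_int a1 / of_int a2" "b = of_int b1 / of_int b2" "a2 > 0" "b2 > 0"
    by (metis Rats_cases')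
  have "of_int (a2 * b2) * x = of_int b2 * (of_int a2 * a) + of_int a2 * (of_int b2 * b) * w"
    by (simp add: x algebra_simps)
  moreover have "of_int a2 * a = of_int a1" "of_int b2 * b = of_int b1" using * by simp_all
  ultimately have "of_int (a2 * b2) * x = of_int (b2 * a1) + of_int (a2 * b1) * w" by simp
  then have "of_int (a2 * b2) * x \<in> \<O>" by simp
  then show ?thesis using * by (metis zero_less_mult_iff)
qed

lemma trace_norm_in_O:
  assumes "x \<in> K" "x + cnj x \<in> \<O>" "x * cnj x \<in> \<O>"
  shows "x \<in> \<O>"
proof -
  have "of_real (2 * Re x) \<in> \<O>" using assms(2) by (simp add: complex_add_cnj)
  then have "2 * Re x \<in> \<int>" using O_real_int by (metis Ints_of_int)
  moreover have "of_real ((cmod x)\<^sup>2) \<in> \<O>" using assms(3) unfolding complex_norm_square .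
  then have "(cmod x)\<^sup>2 \<in> \<int>" using O_real_int by (metis Ints_of_int)
  ultimately show ?thesis using assms(1) max_order_iff[OF iqf] by blast
qed

lemma O_unique: "of_int a + of_int b * w = of_int c + of_int d * w \<longleftrightarrow> a = c \<and> b = d"
proof
  assume eq: "of_int a + of_int b * w = of_int c + of_int d * w"
  have "Im (of_int a + of_int b * w) = Im (of_int c + of_int d * w)" by (rule arg_cong[OF eq])
  then have "b = d" using Im_w by simp
  then show "a = c \<and> b = d" using eq by simp
qed simp

section \<open>Fractional ideals of the maximal order\<close>

lemma inv_add_monoid_K: "x \<in> K \<Longrightarrow> inv\<^bsub>add_monoid (complex_ring K)\<^esub> x = - x"
  unfolding m_inv_def by (rule the_equality) (auto simp: eq_neg_iff_add_eq_0 add.commute)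

lemma frac_iff: "frac_ideal I \<longleftrightarrow> I \<subseteq> K \<and> 0 \<in> I \<and> (\<forall>x\<in>I. \<forall>y\<in>I. x + y \<in> I) \<and> (\<forall>r\<in>\<O>. \<forall>x\<in>I. r * x \<in> I)
    \<and> I \<noteq> {0} \<and> (\<exists>d\<in>\<O>. d \<noteq> 0 \<and> (\<forall>x\<in>I. d * x \<in> \<O>))"
proof -
  have "additive_subgroup I (complex_ring K) \<longleftrightarrow> I \<subseteq> K \<and> 0 \<in> I \<and> (\<forall>x\<in>I. \<forall>y\<in>I. x + y \<in> I)"
    if *: "\<forall>r\<in>\<O>. \<forall>x\<in>I. r * x \<in> I"
  proof -
    have "- x \<in> I" if "x \<in> I" for x using *[rule_format, of "-1" x] that by simp
    then show ?thesis
      unfolding additive_subgroup_def subgroup_def by (auto simp: inv_add_monoid_K[simplified] subset_iff)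
  qed
  then show ?thesis unfolding fractional_ideal_def by blast
qed

lemma fracD:
  assumes "frac_ideal I"
  shows "x \<in> I \<Longrightarrow> x \<in> K" "0 \<in> I" "x \<in> I \<Longrightarrow> y \<in> I \<Longrightarrow> x + y \<in> I" "r \<in> \<O> \<Longrightarrow> x \<in> I \<Longrightarrow> r * x \<in> I"
    "x \<in> I \<Longrightarrow> - x \<in> I" "\<exists>x\<in>I. x \<noteq> 0"
proof -
  note * = assms[unfolded frac_iff]
  show "x \<in> K" if "x \<in> I" using * that by blast
  show "0 \<in> I" using * by blast
  show "x + y \<in> I" if "x \<in> I" "y \<in> I" using * that by blast
  show **: "r * x \<in> I" if "r \<in> \<O>" "x \<in> I" for r x using * that by blast
  show "- x \<in> I" if "x \<in> I" using **[of "-1" x] that by simp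
  show "\<exists>x\<in>I. x \<noteq> 0" using * by blast
qed

lemma frac_sum_scale:
  "frac_ideal I \<Longrightarrow> x \<in> I \<Longrightarrow> y \<in> I \<Longrightarrow> of_int m * x + of_int n * y \<in> I"
  by (intro fracD(3,4)) auto

lemma frac_idealI:
  assumes "\<And>x. x \<in> I \<Longrightarrow> x \<in> K" "\<And>x y. x \<in> I \<Longrightarrow> y \<in> I \<Longrightarrow> x + y \<in> I"
    "\<And>r x. r \<in> \<O> \<Longrightarrow> x \<in> I \<Longrightarrow> r * x \<in> I" "x \<in> I" "x \<noteq> 0"
    "d \<in> \<O>" "d \<noteq> 0" "\<And>x. x \<in> I \<Longrightarrow> d * x \<in> \<O>"
  shows "frac_ideal I"
proof -
  have "0 \<in> I" using assms(3)[of 0 x] assms(4) by simp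
  moreover have "I \<noteq> {0}" using assms(4,5) by blast
  ultimately show ?thesis
    unfolding frac_iff using assms(1-3) assms(6-8) by (intro conjI ballI bexI[of _ d] subsetI)
qed

lemma frac_O: "frac_ideal \<O>"
  by (rule frac_idealI[of _ 1 1]) (simp_all add: O_subset_K)

lemma nonzero_idealD:
  assumes "nonzero_ideal K I"
  shows "frac_ideal I" "I \<subseteq> \<O>"
proof -
  interpret ideal I "order_ring K" using assms by (simp add: nonzero_ideal_def)
  show 1: "I \<subseteq> \<O>" using a_subset by simp
  have "0 \<in> I" using additive_subgroup.zero_closed[OF is_additive_subgroup] by simp
  then obtain x where x: "x \<in> I" "x \<noteq> 0" using assms by (auto simp: nonzero_ideal_def)
  show "frac_ideal I"
  proof (rule frac_idealI[OF _ _ _ x, of 1])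
    show "x + y \<in> I" if "x \<in> I" "y \<in> I" for x y using additive_subgroup.a_closed[OF is_additive_subgroup that] by simp
    show "r * x \<in> I" if "r \<in> \<O>" "x \<in> I" for r x using I_l_closed[of x r] that by simp
  qed (use 1 O_subset_K in auto)
qed

lemma frac_scale:
  assumes "frac_ideal I" "k \<in> K" "k \<noteq> 0"
  shows "frac_ideal ((*) k ` I)"
proof -
  obtain d where d: "d \<in> \<O>" "d \<noteq> 0" "\<forall>x\<in>I. d * x \<in> \<O>" using assms(1) unfolding frac_iff by blast
  obtain e :: int where e: "e > 0" "of_int e * k \<in> \<O>" using K_denominator[OF assms(2)] by blast
  have "of_int e * d \<in> \<O>" "of_int e * d \<noteq> 0" using e d by auto
  moreover have "(of_int e * d) * (k * x) \<in> \<O>" if "x \<in> I" for x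
    using O_mult[OF e(2), of "d * x"] d(3) that by (simp add: mult_ac)
  ultimately have de: "of_int e * d \<in> \<O>" "of_int e * d \<noteq> 0"
    "\<And>x. x \<in> I \<Longrightarrow> (of_int e * d) * (k * x) \<in> \<O>" by blast+
  obtain x where x: "x \<in> I" "x \<noteq> 0" using fracD(6)[OF assms(1)] by blast
  show ?thesis
  proof (rule frac_idealI[of _ "k * x" "of_int e * d"])
    show "r * y \<in> (*) k ` I" if r: "r \<in> \<O>" and y: "y \<in> (*) k ` I" for r y
    proof -
      obtain z where "z \<in> I" "y = k * z" using y by blast
      then show ?thesis
        using fracD(4)[OF assms(1) r] by (intro image_eqI[of _ _ "r * z"]) (simp_all add: mult.left_commute)
    qed
    show "y + z \<in> (*) k ` I" if "y \<in> (*) k ` I" "z \<in> (*) k ` I" for y z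
      using that by (auto simp flip: distrib_left intro!: imageI fracD(3)[OF assms(1)])
  qed (use de x assms(2,3) fracD(1)[OF assms(1)] in auto)
qed

lemma frac_cnj:
  assumes "frac_ideal I"
  shows "frac_ideal (cnj ` I)"
proof -
  obtain d where d: "d \<in> \<O>" "d \<noteq> 0" "\<forall>x\<in>I. d * x \<in> \<O>" using assms(1) unfolding frac_iff by blast
  obtain x where x: "x \<in> I" "x \<noteq> 0" using fracD(6)[OF assms] by blast
  show ?thesis
  proof (rule frac_idealI[of _ "cnj x" "cnj d"])
    show "r * y \<in> cnj ` I" if r: "r \<in> \<O>" and y: "y \<in> cnj ` I" for r y
    proof -
      obtain z where "z \<in> I" "y = cnj z" using y by blast
      then show ?thesis
        using fracD(4)[OF assms O_cnj[OF r]] by (intro image_eqI[of _ _ "cnj r * z"]) simp_all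
    qed
    show "y + z \<in> cnj ` I" if "y \<in> cnj ` I" "z \<in> cnj ` I" for y z
      using that by (auto simp flip: complex_cnj_add intro!: imageI fracD(3)[OF assms])
    show "cnj d * y \<in> \<O>" if "y \<in> cnj ` I" for y
      using that d(3) by (auto simp flip: complex_cnj_mult intro!: O_cnj)
  qed (use x d fracD(1)[OF assms] in auto)
qed

lemma frac_mult:
  assumes "frac_ideal I" "frac_ideal J"
  shows "frac_ideal (I \<star> J)"
proof -
  obtain d where d: "d \<in> \<O>" "d \<noteq> 0" "\<forall>x\<in>I. d * x \<in> \<O>" using assms(1) unfolding frac_iff by blast
  obtain e where e: "e \<in> \<O>" "e \<noteq> 0" "\<forall>x\<in>J. e * x \<in> \<O>" using assms(2) unfolding frac_iff by blast
  have 1: "I \<star> J \<subseteq> K" by (rule ideal_mult_least) (use fracD(1) assms in auto)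
  have 2: "r * x \<in> I \<star> J" if "r \<in> \<O>" "x \<in> I \<star> J" for r x
    using that(2)
  proof (induction rule: ideal_mult_induct)
    case (mult i j)
    then show ?case using ideal_multI[of "r * i" I j J] fracD(4)[OF assms(1) that(1)] by (simp add: mult.assoc)
  qed (auto simp: distrib_left ideal_mult_add)
  have 3: "d * e * x \<in> \<O>" if "x \<in> I \<star> J" for x
    using that
  proof (induction rule: ideal_mult_induct)
    case (mult i j)
    then show ?case using O_mult[of "d * i" "e * j"] d(3) e(3) by (simp add: mult_ac)
  qed (auto simp: distrib_left)
  obtain i j where "i \<in> I" "i \<noteq> 0" "j \<in> J" "j \<noteq> 0" using assms fracD(6) by meson
  then have "i * j \<in> I \<star> J" "i * j \<noteq> 0" by (auto intro: ideal_multI)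
  then have "I \<star> J \<noteq> {0}" by blast
  moreover have "0 \<in> I \<star> J" using ideal_multI[OF fracD(2)[OF assms(1)] fracD(2)[OF assms(2)]] by simp
  moreover have "d * e \<in> \<O>" "d * e \<noteq> 0" using d e by auto
  ultimately show ?thesis unfolding frac_iff using 1 2 3 ideal_mult_add by blast
qed

lemma O_ideal_mult [simp]:
  assumes "frac_ideal I"
  shows "\<O> \<star> I = I" "I \<star> \<O> = I"
proof -
  show "\<O> \<star> I = I"
  proof (intro equalityI subsetI)
    fix x assume "x \<in> I"
    then show "x \<in> \<O> \<star> I" using ideal_multI[of 1 \<O> x I] by simp
  next
    show "x \<in> I" if "x \<in> \<O> \<star> I" for x
      using ideal_mult_least[of \<O> I I] fracD(3,4)[OF assms] that by blast
  qed
  then show "I \<star> \<O> = I" by (simp add: ideal_mult_comm)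
qed

section \<open>Normal form, norm and inverse of an ideal\<close>

text \<open>When \<open>a\<close> divides the norm \<open>b\<^sup>2 + b * t + q\<close> of \<open>b + w\<close>, this is the ideal attached to the binary
  quadratic form \<open>a X\<^sup>2 + (2 b + t) X Y + e Y\<^sup>2\<close> with \<open>b\<^sup>2 + b * t + q = a * e\<close>; every fractional ideal is a
  multiple of such a lattice.\<close>

definition std_lattice :: "int \<Rightarrow> int \<Rightarrow> complex set"
  where "std_lattice a b = {of_int (x * a) + of_int y * (of_int b + w) | x y. True}"

lemma std_latticeI: "of_int (x * a) + of_int y * (of_int b + w) \<in> std_lattice a b"
  by (auto simp: std_lattice_def)

lemma norm_b_w: "(of_int b + w) * (of_int b + cnj w) = of_int (b\<^sup>2 + b * t + q)"
proof -
  have "(of_int b + w) * (of_int b + cnj w) = of_int b * of_int b + of_int b * (w + cnj w) + w * cnj w"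
    by (simp add: algebra_simps)
  also have "w + cnj w = of_int t" by (simp add: cnj_w)
  finally show ?thesis by (simp add: w_cnj_w power2_eq_square)
qed

text \<open>Hermite normal form. Let \<open>A\<close> be the least positive integer in \<open>I\<close> and \<open>C\<close> the least positive
  \<open>w\<close>-coordinate of an element \<open>B + C * w\<close> of \<open>I\<close>; these two elements generate \<open>I\<close> as an abelian group.
  Multiplying them by \<open>w\<close> shows that \<open>C\<close> divides \<open>A\<close> and \<open>B\<close>.\<close>

lemma integral_ideal_std_lattice:
  assumes I: "frac_ideal I" "I \<subseteq> \<O>"
  shows "\<exists>c a b. c > 0 \<and> a > 0 \<and> a dvd b\<^sup>2 + b * t + q \<and> I = (*) (of_int c) ` std_lattice a b"
proof -
  note D = fracD[OF I(1)]
  define P where "P = (\<lambda>n. n > 0 \<and> of_int (int n) \<in> I)"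
  obtain x where x: "x \<in> I" "x \<noteq> 0" using D(6) by blast
  have "cnj x * x \<in> I" using D(4)[of "cnj x" x] x I(2) by auto
  then have xx: "of_real ((cmod x)\<^sup>2) \<in> I" unfolding complex_norm_square by (simp add: mult.commute)
  then obtain n where n: "(cmod x)\<^sup>2 = of_int n" using O_real_int I(2) by blast
  have "n > 0" using x n by (metis of_int_0_less_iff zero_less_norm_iff zero_less_power)
  moreover have "of_int n \<in> I" using xx unfolding n by simp
  ultimately have "P (nat n)" by (simp add: P_def)
  define A where "A = (LEAST n. P n)"
  have PA: "P A" unfolding A_def using \<open>P (nat n)\<close> by (rule LeastI)
  have Amin: "A \<le> k" if "P k" for k unfolding A_def using that by (rule Least_le)
  have int_dvd: "int A dvd m" if m: "of_int m \<in> I" for m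
  proof -
    have "of_int 1 * of_int m + of_int (- (m div int A)) * of_int (int A) \<in> I"
      by (rule frac_sum_scale[OF I(1) m]) (use PA in \<open>simp add: P_def\<close>)
    moreover have "of_int 1 * of_int m + of_int (- (m div int A)) * of_int (int A) = (of_int (m mod int A) :: complex)"
      unfolding minus_mult_div_eq_mod[symmetric] by simp
    ultimately have "of_int (m mod int A) \<in> I" by simp
    moreover have "0 \<le> m mod int A" "m mod int A < int A" using PA by (auto simp: P_def)
    ultimately have "\<not> m mod int A > 0"
      using Amin[of "nat (m mod int A)"] unfolding P_def by (cases "m mod int A > 0") (simp, linarith)
    then show ?thesis using \<open>0 \<le> m mod int A\<close> by auto
  qed
  define Q where "Q = (\<lambda>n. n > 0 \<and> (\<exists>x. of_int x + of_int (int n) * w \<in> I))"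
  have "w * of_int (int A) \<in> I" using PA by (intro D(4)) (auto simp: P_def)
  then have "Q A" using PA unfolding Q_def P_def by (intro conjI exI[of _ 0]) (simp_all add: mult.commute)
  define C where "C = (LEAST n. Q n)"
  have QC: "Q C" unfolding C_def using \<open>Q A\<close> by (rule LeastI)
  have Cmin: "C \<le> k" if "Q k" for k unfolding C_def using that by (rule Least_le)
  obtain B where B: "of_int B + of_int (int C) * w \<in> I" using QC unfolding Q_def by blast
  have div: "int C dvd y \<and> int A dvd x - (y div int C) * B" if z: "of_int x + of_int y * w \<in> I" for x y
  proof -
    let ?k = "y div int C"
    have "of_int 1 * (of_int x + of_int y * w) + of_int (- ?k) * (of_int B + of_int (int C) * w) \<in> I"
      by (rule frac_sum_scale[OF I(1) z B])
    also have "of_int 1 * (of_int x + of_int y * w) + of_int (- ?k) * (of_int B + of_int (int C) * w)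
      = of_int (x - ?k * B) + of_int (y - int C * ?k) * w"
      by (simp add: algebra_simps)
    finally have *: "of_int (x - ?k * B) + of_int (y mod int C) * w \<in> I" by (simp add: minus_mult_div_eq_mod)
    have "0 \<le> y mod int C" "y mod int C < int C" using QC by (auto simp: Q_def)
    have "y mod int C = 0"
    proof (rule ccontr)
      assume "y mod int C \<noteq> 0"
      then have "Q (nat (y mod int C))" unfolding Q_def
        using * \<open>0 \<le> y mod int C\<close> by (intro conjI exI[of _ "x - ?k * B"]) simp_all
      then have "C \<le> nat (y mod int C)" by (rule Cmin)
      then show False using \<open>y mod int C < int C\<close> \<open>0 \<le> y mod int C\<close> by linarith
    qed
    then show ?thesis using * int_dvd[of "x - ?k * B"] by auto
  qed
  have "int C dvd int A"
    using div[of 0 "int A"] \<open>w * of_int (int A) \<in> I\<close> by (simp add: mult.commute)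
  then obtain a where a: "int A = int C * a" by blast
  have "w * (of_int B + of_int (int C) * w) = of_int B * w + of_int (int C) * (w * w)"
    by (simp add: algebra_simps)
  also have "\<dots> = of_int (- int C * q) + of_int (B + int C * t) * w"
    unfolding w_sq by (simp add: algebra_simps)
  finally have "of_int (- int C * q) + of_int (B + int C * t) * w \<in> I"
    using D(4)[OF w_in_O B] by simp
  then have "int C dvd B + int C * t" using div by blast
  then have "int C dvd B" by (simp add: dvd_add_left_iff)
  then obtain b where b: "B = int C * b" by blast
  have C0: "int C > 0" using QC by (simp add: Q_def)
  have "int C * a > 0" unfolding a[symmetric] using PA by (simp add: P_def)
  then have "a > 0" using C0 by (metis zero_less_mult_pos)
  note pos = C0 this
  have "(of_int b + cnj w) * (of_int B + of_int (int C) * w) = of_int (int C) * ((of_int b + w) * (of_int b + cnj w))"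
    unfolding b by (simp add: algebra_simps)
  also have "\<dots> = of_int (int C * (b\<^sup>2 + b * t + q))" unfolding norm_b_w by simp
  finally have "of_int (int C * (b\<^sup>2 + b * t + q)) \<in> I" using D(4)[OF _ B, of "of_int b + cnj w"] by simp
  then have "int C * a dvd int C * (b\<^sup>2 + b * t + q)" using int_dvd a by metis
  then have "a dvd b\<^sup>2 + b * t + q" using pos by simp
  moreover have "I = (*) (of_int (int C)) ` std_lattice a b"
  proof (intro equalityI subsetI)
    fix z assume z: "z \<in> I"
    then obtain x y where xy: "z = of_int x + of_int y * w" using I(2) OE by blast
    obtain y' where y': "y = int C * y'" using div z xy by blast
    obtain x' where x': "x - y' * B = int A * x'" using div[of x y] z xy y' pos by auto
    have "x = int C * a * x' + y' * (int C * b)" using x' unfolding a b by (simp add: algebra_simps)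
    then have "z = of_int (int C) * (of_int (x' * a) + of_int y' * (of_int b + w))"
      unfolding xy y' by (simp add: algebra_simps)
    then show "z \<in> (*) (of_int (int C)) ` std_lattice a b" using std_latticeI by blast
  next
    fix z assume "z \<in> (*) (of_int (int C)) ` std_lattice a b"
    then obtain x y where "z = of_int (int C) * (of_int (x * a) + of_int y * (of_int b + w))"
      by (auto simp: std_lattice_def)
    also have "\<dots> = of_int x * of_int (int A) + of_int y * (of_int B + of_int (int C) * w)"
      unfolding a b by (simp add: algebra_simps)
    also have "\<dots> \<in> I" using PA by (intro frac_sum_scale[OF I(1) _ B]) (simp add: P_def)
    finally show "z \<in> I" .
  qed
  ultimately show ?thesis using pos by blast
qed

lemma frac_ideal_std_lattice:
  assumes "frac_ideal I"
  shows "\<exists>k a b. k \<in> K \<and> k \<noteq> 0 \<and> a > 0 \<and> a dvd b\<^sup>2 + b * t + q \<and> I = (*) k ` std_lattice a b"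
proof -
  obtain d where d: "d \<in> \<O>" "d \<noteq> 0" "\<forall>x\<in>I. d * x \<in> \<O>" using assms unfolding frac_iff by blast
  have "frac_ideal ((*) d ` I)" "(*) d ` I \<subseteq> \<O>" using assms d O_subset_K by (auto intro: frac_scale)
  from integral_ideal_std_lattice[OF this] obtain c a b where *: "c > 0" "a > 0" "a dvd b\<^sup>2 + b * t + q"
    "(*) d ` I = (*) (of_int c) ` std_lattice a b" by blast
  have "I = (*) (inverse d) ` (*) d ` I" using d unfolding image_scale_scale by simp
  also have "\<dots> = (*) (inverse d * of_int c) ` std_lattice a b" unfolding * image_scale_scale ..
  finally show ?thesis using * d O_subset_K by (intro exI[of _ "inverse d * of_int c"]) auto
qed

text \<open>The form of the ideal is primitive because the order is maximal: if \<open>h\<close> divides all three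
  coefficients, then \<open>(b + w) / h\<close> has integral trace and norm, so it lies in the order.\<close>

lemma std_lattice_primitive:
  assumes "a > 0" "b\<^sup>2 + b * t + q = a * e" "h dvd a" "h dvd 2 * b + t" "h dvd e"
  shows "h dvd 1"
proof -
  obtain a' m e' where *: "a = h * a'" "2 * b + t = h * m" "e = h * e'" using assms by (auto elim!: dvdE)
  have h: "h \<noteq> 0" using assms * by auto
  define x where "x = (of_int b + w) / of_int h"
  have "x + cnj x = of_int (2 * b + t) / of_int h" by (simp add: x_def cnj_w add_divide_distrib diff_divide_distrib)
  then have "x + cnj x = of_int m" unfolding * using h by simp
  moreover have "x * cnj x = (of_int b + w) * (of_int b + cnj w) / (of_int h * of_int h)" by (simp add: x_def)
  then have "x * cnj x = of_int (a' * e')" unfolding norm_b_w assms * using h by simp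
  moreover have "x \<in> K" by (simp add: x_def)
  ultimately have "x \<in> \<O>" using trace_norm_in_O[of x] by (simp only: O_of_int simp_thms)
  then obtain u v where uv: "x = of_int u + of_int v * w" by (rule OE)
  have "of_int b + of_int 1 * w = of_int (h * u) + of_int (h * v) * w"
    using uv h by (simp add: x_def field_simps)
  then have "1 = h * v" unfolding O_unique by simp
  then show ?thesis by (rule dvdI)
qed

lemma std_lattice_frac:
  assumes "a > 0" "a dvd b\<^sup>2 + b * t + q"
  shows "frac_ideal (std_lattice a b)"
proof (rule frac_idealI[of _ "of_int a" 1])
  obtain e where e: "b\<^sup>2 + b * t + q = a * e" using assms by blast
  have sub: "z \<in> \<O>" if "z \<in> std_lattice a b" for z using that by (auto simp: std_lattice_def)
  show "z \<in> K" if "z \<in> std_lattice a b" for z using sub[OF that] O_subset_K by simp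
  show "1 * z \<in> \<O>" if "z \<in> std_lattice a b" for z using sub[OF that] by simp
  show "of_int a \<in> std_lattice a b" using std_latticeI[of 1 a 0 b] by simp
  show "y + z \<in> std_lattice a b" if yz: "y \<in> std_lattice a b" "z \<in> std_lattice a b" for y z
  proof -
    obtain x1 y1 x2 y2 where "y = of_int (x1 * a) + of_int y1 * (of_int b + w)"
      "z = of_int (x2 * a) + of_int y2 * (of_int b + w)" using yz by (auto simp: std_lattice_def)
    then have "y + z = of_int ((x1 + x2) * a) + of_int (y1 + y2) * (of_int b + w)" by (simp add: algebra_simps)
    then show ?thesis using std_latticeI by metis
  qed
  show "r * z \<in> std_lattice a b" if r: "r \<in> \<O>" and z: "z \<in> std_lattice a b" for r z
  proof -
    obtain m n where mn: "r = of_int m + of_int n * w" using r by (rule OE)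
    obtain x y where xy: "z = of_int (x * a) + of_int y * (of_int b + w)" using z by (auto simp: std_lattice_def)
    have ww: "w * (of_int b + w) = of_int (b + t) * (of_int b + w) - of_int (a * e)"
      unfolding distrib_left w_sq e[symmetric] by (simp add: algebra_simps power2_eq_square)
    have "r * z = of_int (m * x * a - n * x * a * b) + of_int (n * x * a + m * y) * (of_int b + w)
        + of_int (n * y) * (w * (of_int b + w))"
      unfolding mn xy by (simp add: algebra_simps)
    also have "\<dots> = of_int ((m * x - n * x * b - n * y * e) * a)
        + of_int (n * x * a + m * y + n * y * (b + t)) * (of_int b + w)"
      unfolding ww by (simp add: algebra_simps)
    finally show ?thesis using std_latticeI by metis
  qed
qed (use assms in simp_all)

text \<open>The product is \<open>a\<close> times the ideal generated by \<open>a\<close>, \<open>b + w\<close>, \<open>b + cnj w\<close> and \<open>e\<close>, where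
  \<open>a * e\<close> is the norm of \<open>b + w\<close>. That ideal contains \<open>a\<close>, \<open>2 * b + t\<close> and \<open>e\<close>, which are coprime by
  primitivity, so it is the unit ideal.\<close>

lemma std_lattice_norm:
  assumes "a > 0" "a dvd b\<^sup>2 + b * t + q"
  shows "std_lattice a b \<star> cnj ` std_lattice a b = (*) (of_int a) ` \<O>"
proof
  obtain e where e: "b\<^sup>2 + b * t + q = a * e" using assms by blast
  let ?I = "std_lattice a b"
  show "?I \<star> cnj ` ?I \<subseteq> (*) (of_int a) ` \<O>"
  proof (rule ideal_mult_least)
    fix i j assume "i \<in> ?I" "j \<in> cnj ` ?I"
    then obtain x y u v where ij: "i = of_int (x * a) + of_int y * (of_int b + w)"
      "j = cnj (of_int (u * a) + of_int v * (of_int b + w))" by (auto simp: std_lattice_def)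
    have "i * j = of_int a * (of_int (x * u * a) + of_int (x * v) * (of_int b + cnj w)
        + of_int (y * u) * (of_int b + w)) + of_int (y * v) * ((of_int b + w) * (of_int b + cnj w))"
      unfolding ij by (simp add: algebra_simps)
    also have "\<dots> = of_int a * (of_int (x * u * a) + of_int (x * v) * (of_int b + cnj w)
        + of_int (y * u) * (of_int b + w) + of_int (y * v * e))"
      unfolding norm_b_w e by (simp add: algebra_simps)
    finally show "i * j \<in> (*) (of_int a) ` \<O>" by (auto intro!: imageI)
  next
    show "x + y \<in> (*) (of_int a) ` \<O>" if "x \<in> (*) (of_int a) ` \<O>" "y \<in> (*) (of_int a) ` \<O>" for x y
      using that by (auto simp flip: distrib_left)
  qed
  have fr: "frac_ideal (?I \<star> cnj ` ?I)" using std_lattice_frac[OF assms] frac_cnj frac_mult by blast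
  have in1: "of_int a \<in> ?I" "of_int b + w \<in> ?I"
    using std_latticeI[of 1 a 0 b] std_latticeI[of 0 a 1 b] by simp_all
  have in2: "of_int a \<in> cnj ` ?I" "of_int b + cnj w \<in> cnj ` ?I"
    using imageI[OF in1(1), of cnj] imageI[OF in1(2), of cnj] by simp_all
  define u where "u = gcd (gcd a (2 * b + t)) e"
  have "u dvd 1" by (rule std_lattice_primitive[OF assms(1) e]) (auto simp: u_def intro: dvd_trans)
  then have u1: "gcd (gcd a (2 * b + t)) e = 1" by (simp add: u_def)
  obtain r s where rs: "r * a + s * (2 * b + t) = gcd a (2 * b + t)" using bezout_int by blast
  obtain r' s' where rs': "r' * gcd a (2 * b + t) + s' * e = 1" using bezout_int u1 by metis
  have one: "r' * r * a + r' * s * (2 * b + t) + s' * e = 1"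
    using rs' unfolding rs[symmetric] by (simp add: algebra_simps)
  note m = ideal_multI[OF in1(1) in2(1)] ideal_multI[OF in1(1) in2(2)] ideal_multI[OF in1(2) in2(1)]
    ideal_multI[OF in1(2) in2(2)]
  have "of_int 1 * (of_int (r' * r) * (of_int a * of_int a) + of_int (r' * s) * (of_int a * (of_int b + cnj w)))
     + of_int 1 * (of_int (r' * s) * ((of_int b + w) * of_int a) + of_int s' * ((of_int b + w) * (of_int b + cnj w)))
     \<in> ?I \<star> cnj ` ?I"
    by (intro frac_sum_scale[OF fr] m)
  also have "of_int 1 * (of_int (r' * r) * (of_int a * of_int a) + of_int (r' * s) * (of_int a * (of_int b + cnj w)))
     + of_int 1 * (of_int (r' * s) * ((of_int b + w) * of_int a) + of_int s' * ((of_int b + w) * (of_int b + cnj w)))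
     = of_int a * of_int (r' * r * a + r' * s * (2 * b + t) + s' * e)"
    unfolding norm_b_w e by (simp add: cnj_w algebra_simps)
  finally have "of_int a \<in> ?I \<star> cnj ` ?I" unfolding one by simp
  then show "(*) (of_int a) ` \<O> \<subseteq> ?I \<star> cnj ` ?I"
    using fracD(4)[OF fr] by (auto simp: mult.commute)
qed

lemma ex_ideal_norm:
  assumes "frac_ideal I"
  shows "\<exists>r>0. of_real r \<in> K \<and> I \<star> cnj ` I = (*) (of_real r) ` \<O>"
proof -
  obtain k a b where *: "k \<in> K" "k \<noteq> 0" "a > 0" "a dvd b\<^sup>2 + b * t + q" "I = (*) k ` std_lattice a b"
    using frac_ideal_std_lattice[OF assms] by blast
  have kk: "of_real ((cmod k)\<^sup>2 * of_int a) = k * cnj k * of_int a" by (simp add: complex_norm_square[symmetric])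
  have "I \<star> cnj ` I = (*) (k * cnj k) ` (std_lattice a b \<star> cnj ` std_lattice a b)"
    unfolding * cnj_scale ideal_mult_scale ideal_mult_scale_right image_scale_scale by (simp only: mult.commute)
  also have "\<dots> = (*) (of_real ((cmod k)\<^sup>2 * of_int a)) ` \<O>"
    unfolding std_lattice_norm[OF *(3,4)] image_scale_scale kk ..
  finally have "I \<star> cnj ` I = (*) (of_real ((cmod k)\<^sup>2 * of_int a)) ` \<O>" .
  moreover have "of_real ((cmod k)\<^sup>2 * of_int a) \<in> K" unfolding kk using * by simp
  moreover have "(cmod k)\<^sup>2 * of_int a > 0" using * by simp
  ultimately show ?thesis by blast
qed

lemma scaled_O_unique:
  assumes "r > 0" "s > 0" "(*) (of_real r) ` \<O> = (*) (of_real s) ` \<O>"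
  shows "r = s"
proof -
  have "\<exists>m::int. r = m * s" if "r > 0" "s > 0" "(*) (of_real r) ` \<O> = (*) (of_real s) ` \<O>" for r s :: real
  proof -
    note rs = that
    have "of_real r \<in> (*) (of_real r) ` \<O>" by (rule image_eqI[of _ _ 1]) simp_all
    then obtain x where x: "x \<in> \<O>" "of_real r = of_real s * x" using rs(3) by auto
    then have "x = of_real (r / s)" using rs by simp
    then obtain m :: int where "r / s = m" using O_real_int x(1) by blast
    then show ?thesis using rs by (auto simp: field_simps)
  qed
  from this[OF assms] this[OF assms(2,1) assms(3)[symmetric]] obtain m n :: int
    where mn: "r = m * s" "s = n * r" by blast
  then have "real_of_int (m * n) = 1" using assms by auto
  then have "m * n = 1" by linarith
  moreover have "m > 0" using mn(1) assms by (metis of_int_0_less_iff zero_less_mult_pos2)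
  ultimately have "m = 1" using zmult_eq_1_iff by auto
  then show ?thesis using mn by simp
qed

text \<open>The numbers \<open>x + y * w\<close> with \<open>0 \<le> x < c * a\<close> and \<open>0 \<le> y < c\<close> represent the residue classes.\<close>

lemma card_quotient_std_lattice:
  assumes "c > 0" "a > 0"
  shows "ideal_norm K ((*) (of_int c) ` std_lattice a b) = nat (c * c * a)"
proof -
  let ?I = "(*) (of_int c) ` std_lattice a b"
  define cs where "cs = (\<lambda>z. {i + z | i. i \<in> ?I})"
  have I: "z \<in> ?I \<longleftrightarrow> (\<exists>x y. z = of_int (c * a * x + c * b * y) + of_int (c * y) * w)" for z
  proof
    assume "z \<in> ?I"
    then obtain x y where "z = of_int c * (of_int (x * a) + of_int y * (of_int b + w))" by (auto simp: std_lattice_def)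
    then have "z = of_int (c * a * x + c * b * y) + of_int (c * y) * w" by (simp add: algebra_simps)
    then show "\<exists>x y. z = of_int (c * a * x + c * b * y) + of_int (c * y) * w" by blast
  next
    assume "\<exists>x y. z = of_int (c * a * x + c * b * y) + of_int (c * y) * w"
    then obtain x y where "z = of_int c * (of_int (x * a) + of_int y * (of_int b + w))"
      by (auto simp: algebra_simps)
    then show "z \<in> ?I" using std_latticeI by blast
  qed
  have I_diff: "u - v \<in> ?I" if "u \<in> ?I" "v \<in> ?I" for u v
  proof -
    obtain x y x' y' where "u = of_int (c * a * x + c * b * y) + of_int (c * y) * w"
      "v = of_int (c * a * x' + c * b * y') + of_int (c * y') * w" using \<open>u \<in> ?I\<close> \<open>v \<in> ?I\<close> unfolding I by blast
    then have "u - v = of_int (c * a * (x - x') + c * b * (y - y')) + of_int (c * (y - y')) * w"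
      by (simp add: algebra_simps)
    then show ?thesis unfolding I by blast
  qed
  have I0: "0 \<in> ?I" unfolding I by (rule exI[of _ 0], rule exI[of _ 0]) simp
  have cs_eq: "cs z = cs z' \<longleftrightarrow> z - z' \<in> ?I" for z z'
  proof
    assume "cs z = cs z'"
    moreover have "z \<in> cs z" using I0 unfolding cs_def by (metis (mono_tags, lifting) add_0 mem_Collect_eq)
    ultimately obtain i where "z = i + z'" "i \<in> ?I" unfolding cs_def by blast
    then show "z - z' \<in> ?I" by simp
  next
    assume d: "z - z' \<in> ?I"
    have sub: "cs u \<subseteq> cs v" if d: "u - v \<in> ?I" for u v
    proof
      fix s assume "s \<in> cs u"
      then obtain i where i: "i \<in> ?I" "s = i + u" unfolding cs_def by blast
      have "i - (0 - (u - v)) \<in> ?I" using I_diff I0 i d by blast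
      moreover have "s = (i - (0 - (u - v))) + v" using i by simp
      ultimately show "s \<in> cs v" unfolding cs_def by blast
    qed
    have "0 - (z - z') \<in> ?I" using I_diff I0 d by blast
    then have "z' - z \<in> ?I" by simp
    then show "cs z = cs z'" using sub d by blast
  qed
  define f where "f = (\<lambda>(x, y). cs (of_int x + of_int y * w))"
  let ?D = "{0..<c * a} \<times> {0..<c}"
  have "carrier (order_ring K Quot ?I) = cs ` \<O>"
    unfolding FactRing_def A_RCOSETS_def RCOSETS_def r_coset_def cs_def by auto
  also have "\<dots> = f ` ?D"
  proof (intro equalityI subsetI)
    fix s assume "s \<in> cs ` \<O>"
    then obtain m n where s: "s = cs (of_int m + of_int n * w)" by (auto elim: OE)
    define y where "y = n div c"
    define x where "x = (m - c * b * y) div (c * a)"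
    define u where "u = (m - c * b * y) mod (c * a)"
    have n: "n = c * y + n mod c" by (simp add: y_def)
    have m: "m = c * a * x + c * b * y + u"
      unfolding x_def u_def using mult_div_mod_eq[of "c * a" "m - c * b * y"] by linarith
    have "of_int m + of_int n * w - (of_int u + of_int (n mod c) * w)
      = of_int (c * a * x + c * b * y) + of_int (c * y) * w"
      by (subst m, subst n) (simp add: algebra_simps)
    then have "cs (of_int m + of_int n * w) = cs (of_int u + of_int (n mod c) * w)"
      unfolding cs_eq I by blast
    moreover have "(u, n mod c) \<in> ?D" using assms by (auto simp: u_def)
    ultimately show "s \<in> f ` ?D" unfolding s f_def by (intro image_eqI[of _ _ "(u, n mod c)"]) simp_all
  qed (auto simp: f_def)
  finally have car: "carrier (order_ring K Quot ?I) = f ` ?D" .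
  have "inj_on f ?D"
  proof (rule inj_onI, clarify)
    fix x y x' y'
    assume D: "x \<in> {0..<c * a}" "y \<in> {0..<c}" "x' \<in> {0..<c * a}" "y' \<in> {0..<c}" and "f (x, y) = f (x', y')"
    then have "(of_int x + of_int y * w) - (of_int x' + of_int y' * w) \<in> ?I" by (simp only: f_def case_prod_conv cs_eq)
    then obtain u v where "(of_int x + of_int y * w) - (of_int x' + of_int y' * w)
      = of_int (c * a * u + c * b * v) + of_int (c * v) * w" unfolding I by blast
    moreover have "(of_int x + of_int y * w) - (of_int x' + of_int y' * w) = of_int (x - x') + of_int (y - y') * w"
      by (simp add: algebra_simps)
    ultimately have "of_int (x - x') + of_int (y - y') * w = of_int (c * a * u + c * b * v) + of_int (c * v) * w"
      by (simp only:)
    then have *: "x - x' = c * a * u + c * b * v" "y - y' = c * v" unfolding O_unique by blast+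
    have "\<bar>c * v\<bar> < c" unfolding *(2)[symmetric] using D by auto
    then have "c * \<bar>v\<bar> < c * 1" using assms by (simp add: abs_mult)
    then have "v = 0" unfolding mult_less_cancel_left_pos[OF assms(1)] by simp
    moreover have "\<bar>x - x'\<bar> < c * a" using D by auto
    ultimately have "\<bar>c * a * u\<bar> < c * a" using * by simp
    then have "c * a * \<bar>u\<bar> < c * a * 1" using assms by (simp add: abs_mult)
    moreover have "c * a > 0" using assms by simp
    ultimately have "\<bar>u\<bar> < 1" by (simp only: mult_less_cancel_left_pos)
    then have "u = 0" by simp
    then show "x = x' \<and> y = y'" using * \<open>v = 0\<close> by simp
  qed
  then have "card (f ` ?D) = card ?D" by (rule card_image)
  also have "\<dots> = nat (c * c * a)" using assms by (simp add: card_cartesian_product nat_mult_distrib mult_ac)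
  finally show ?thesis unfolding ideal_norm_def car .
qed

text \<open>The index of an integral ideal is the generator of \<open>I \<star> cnj ` I\<close>: both equal \<open>c\<^sup>2 * a\<close> on the normal
  form. All later norm computations use the ideal product, where they are multiplicative by associativity.\<close>

lemma ideal_norm_eq:
  assumes "frac_ideal I" "I \<subseteq> \<O>"
  shows "I \<star> cnj ` I = (*) (of_real (real (ideal_norm K I))) ` \<O>" "ideal_norm K I > 0"
proof -
  obtain c a b where *: "c > 0" "a > 0" "a dvd b\<^sup>2 + b * t + q" "I = (*) (of_int c) ` std_lattice a b"
    using integral_ideal_std_lattice[OF assms] by blast
  have n: "ideal_norm K I = nat (c * c * a)" unfolding * using * by (intro card_quotient_std_lattice)
  have "I \<star> cnj ` I = (*) (of_int c * of_int c) ` (std_lattice a b \<star> cnj ` std_lattice a b)"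
    unfolding * cnj_scale ideal_mult_scale ideal_mult_scale_right image_scale_scale by simp
  also have "\<dots> = (*) (of_int (c * c * a)) ` \<O>"
    unfolding std_lattice_norm[OF *(2,3)] image_scale_scale by simp
  also have "of_int (c * c * a) = complex_of_real (real (ideal_norm K I))" using * n by simp
  finally show "I \<star> cnj ` I = (*) (of_real (real (ideal_norm K I))) ` \<O>" .
  show "ideal_norm K I > 0" using * n by simp
qed

text \<open>From \<open>I \<star> cnj ` I = r \<O>\<close> the conjugate ideal divided by \<open>r\<close> is an inverse.\<close>

lemma ideal_inverse:
  assumes "frac_ideal I"
  shows "frac_ideal (ideal_inverse K I)" "I \<star> ideal_inverse K I = \<O>"
    "r > 0 \<Longrightarrow> I \<star> cnj ` I = (*) (of_real r) ` \<O> \<Longrightarrow> (*) (of_real r) ` ideal_inverse K I = cnj ` I"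
proof -
  obtain s where s: "s > 0" "of_real s \<in> K" "I \<star> cnj ` I = (*) (of_real s) ` \<O>" using ex_ideal_norm[OF assms] by blast
  have s': "inverse (of_real s) * of_real s = (1::complex)" using s by simp
  have fr: "frac_ideal ((*) (inverse (of_real s)) ` cnj ` I)"
    using s by (intro frac_scale frac_cnj assms) auto
  have 1: "I \<star> ((*) (inverse (of_real s)) ` cnj ` I) = \<O>"
    unfolding ideal_mult_scale_right s image_scale_scale s' by simp
  have eq: "ideal_inverse K I = (*) (inverse (of_real s)) ` cnj ` I"
  proof (intro equalityI subsetI)
    fix x assume "x \<in> ideal_inverse K I"
    then have x: "x \<in> K" "\<And>y. y \<in> I \<Longrightarrow> x * y \<in> \<O>" by (auto simp: ideal_inverse_def)
    let ?J = "(*) (inverse (of_real s)) ` cnj ` I"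
    have "I \<star> ?J \<subseteq> {z. x * z \<in> ?J}"
    proof (rule ideal_mult_least)
      show "i * j \<in> {z. x * z \<in> ?J}" if "i \<in> I" "j \<in> ?J" for i j
        using fracD(4)[OF fr x(2)[OF that(1)] that(2)] by (simp add: mult.assoc)
    qed (use fracD(3)[OF fr] in \<open>simp add: distrib_left\<close>)
    then have "1 \<in> {z. x * z \<in> ?J}" unfolding 1 using O_zero_one(2) by blast
    then show "x \<in> ?J" by simp
  next
    fix x assume x: "x \<in> (*) (inverse (of_real s)) ` cnj ` I"
    then have "x * y \<in> \<O>" if "y \<in> I" for y
      using ideal_multI[OF that x] unfolding 1 by (simp add: mult.commute)
    then show "x \<in> ideal_inverse K I" using fracD(1)[OF fr x] by (simp add: ideal_inverse_def)
  qed
  show "frac_ideal (ideal_inverse K I)" "I \<star> ideal_inverse K I = \<O>" unfolding eq by (fact fr, fact 1)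
  assume r: "r > 0" "I \<star> cnj ` I = (*) (of_real r) ` \<O>"
  have "r = s" using scaled_O_unique r s by metis
  then show "(*) (of_real r) ` ideal_inverse K I = cnj ` I"
    unfolding eq image_scale_scale using s by simp
qed

end

section \<open>Values of primitive forms\<close>

text \<open>Every prime divisor \<open>p\<close> of \<open>N\<close> fails to divide one of \<open>a\<close>, \<open>e\<close> and, if it divides both, \<open>T\<close>.
  The products \<open>x\<close> and \<open>y\<close> of prime divisors of \<open>N\<close> below are chosen so that modulo \<open>p\<close> only the corresponding term
  \<open>a * x * x\<close>, \<open>e * y * y\<close> or \<open>T * x * y\<close> survives.\<close>

lemma primitive_form_represents_coprime:
  fixes a T e N :: int
  assumes prim: "\<And>h. h dvd a \<Longrightarrow> h dvd T \<Longrightarrow> h dvd e \<Longrightarrow> h dvd 1" and "N \<noteq> 0"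
  shows "\<exists>x y. gcd (a * x * x + T * x * y + e * y * y) N = 1"
proof -
  define X where "X = {p \<in> prime_factors N. p dvd a \<and> \<not> p dvd e}"
  define Y where "Y = {p \<in> prime_factors N. \<not> p dvd a}"
  have fin: "finite X" "finite Y" by (auto simp: X_def Y_def)
  have iff: "p dvd \<Prod>Z \<longleftrightarrow> p \<in> Z" if pZ: "prime p" "finite Z" "Z \<subseteq> prime_factors N" for p Z
  proof
    assume "p dvd \<Prod>Z"
    then obtain r where "r \<in> Z" "p dvd r" using prime_dvd_prod_iff[OF pZ(2,1), of "\<lambda>x. x"] by auto
    moreover have "prime r" using \<open>r \<in> Z\<close> pZ(3) by auto
    ultimately show "p \<in> Z" using primes_dvd_imp_eq[OF pZ(1)] by blast
  qed (use pZ(2) in \<open>auto intro: dvd_prodI\<close>)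
  define x y where "x = \<Prod>X" and "y = \<Prod>Y"
  have x: "p dvd x \<longleftrightarrow> p \<in> X" if "prime p" for p
    unfolding x_def by (rule iff[OF that fin(1)]) (auto simp: X_def)
  have y: "p dvd y \<longleftrightarrow> p \<in> Y" if "prime p" for p
    unfolding y_def by (rule iff[OF that fin(2)]) (auto simp: Y_def)
  let ?f = "a * x * x + T * x * y + e * y * y"
  have "gcd ?f N = 1"
  proof (rule ccontr)
    assume "gcd ?f N \<noteq> 1"
    then have "\<not> is_unit (gcd ?f N)" by simp
    moreover have "gcd ?f N \<noteq> 0" using assms(2) by simp
    ultimately obtain p where p: "prime p" "p dvd gcd ?f N" using prime_divisor_exists by blast
    then have pf: "p dvd ?f" and pN: "p \<in> prime_factors N" using assms(2) by (auto simp: in_prime_factors_iff)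
    note md = prime_dvd_mult_iff[OF p(1)]
    consider "\<not> p dvd a" | "p dvd a" "\<not> p dvd e" | "p dvd a" "p dvd e" by blast
    then show False
    proof cases
      case 1
      then have "p dvd y" "\<not> p dvd x" using x y p(1) pN by (auto simp: X_def Y_def)
      then have "p dvd a * x * x" using pf by (simp add: dvd_add_left_iff)
      then show False using 1 \<open>\<not> p dvd x\<close> by (simp add: md)
    next
      case 2
      then have "p dvd x" "\<not> p dvd y" using x y p(1) pN by (auto simp: X_def Y_def)
      then have "p dvd e * y * y" using pf by (simp add: dvd_add_right_iff)
      then show False using 2 \<open>\<not> p dvd y\<close> by (simp add: md)
    next
      case 3
      then have "\<not> p dvd x" "\<not> p dvd y" using x y p(1) by (auto simp: X_def Y_def)
      moreover have "\<not> p dvd T" using prim[of p] 3 p(1) not_prime_unit by blast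
      moreover have "p dvd T * x * y" using pf 3 by (simp add: dvd_add_left_iff dvd_add_right_iff)
      ultimately show False by (simp add: md)
    qed
  qed
  then show ?thesis by (intro exI)
qed

context quad_order
begin

text \<open>The norm form of \<open>F\<close>, divided by the norm of \<open>F\<close>, is a primitive binary form. If it takes at
  \<open>m\<close> a value \<open>s\<close> prime to \<open>N\<close>, then \<open>s\<close> is the norm of the integral ideal \<open>m F\<^bsup>-1\<^esup>\<close> and lies in it, so
  this ideal is prime to \<open>N\<close>.\<close>

lemma ex_coprime_element:
  assumes F: "frac_ideal F" and "N \<noteq> 0"
  shows "\<exists>m\<in>F. \<exists>s::int. gcd s N = 1 \<and> of_int s \<in> (*) m ` ideal_inverse K F"
proof -
  obtain k a b where *: "k \<in> K" "k \<noteq> 0" "a > 0" "a dvd b\<^sup>2 + b * t + q" "F = (*) k ` std_lattice a b"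
    using frac_ideal_std_lattice[OF F] by blast
  obtain e where e: "b\<^sup>2 + b * t + q = a * e" using *(4) by blast
  have "\<exists>x y. gcd (a * x * x + (2 * b + t) * x * y + e * y * y) N = 1"
    by (rule primitive_form_represents_coprime[OF std_lattice_primitive[OF *(3) e] assms(2)])
  then obtain x y where xy: "gcd (a * x * x + (2 * b + t) * x * y + e * y * y) N = 1" by (elim exE)
  define z where "z = of_int (x * a) + of_int y * (of_int b + w)"
  have z: "z \<in> std_lattice a b" unfolding z_def by (rule std_latticeI)
  have "z * cnj z = of_int a * (of_int (x * x * a) + of_int (x * y) * ((of_int b + cnj w) + (of_int b + w)))
     + of_int (y * y) * ((of_int b + w) * (of_int b + cnj w))"
    by (simp add: z_def algebra_simps)
  also have "\<dots> = of_int a * of_int (a * x * x + (2 * b + t) * x * y + e * y * y)"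
    unfolding norm_b_w e by (simp add: cnj_w algebra_simps)
  finally have zz: "z * cnj z = of_int a * of_int (a * x * x + (2 * b + t) * x * y + e * y * y)" .
  have kk: "of_real ((cmod k)\<^sup>2 * of_int a) = k * cnj k * of_int a" by (simp add: complex_norm_square[symmetric])
  have "F \<star> cnj ` F = (*) (k * cnj k) ` (std_lattice a b \<star> cnj ` std_lattice a b)"
    unfolding *(5) cnj_scale ideal_mult_scale ideal_mult_scale_right image_scale_scale by (simp only: mult.commute)
  also have "\<dots> = (*) (of_real ((cmod k)\<^sup>2 * of_int a)) ` \<O>"
    unfolding std_lattice_norm[OF *(3,4)] image_scale_scale kk ..
  finally have r: "F \<star> cnj ` F = (*) (of_real ((cmod k)\<^sup>2 * of_int a)) ` \<O>" .
  have "(cmod k)\<^sup>2 * of_int a > 0" using * by simp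
  from ideal_inverse(3)[OF F this r]
  have inv: "(*) (k * cnj k * of_int a) ` ideal_inverse K F = cnj ` F" unfolding kk .
  have "cnj (k * z) \<in> cnj ` F" using z unfolding *(5) by blast
  then obtain u where u: "u \<in> ideal_inverse K F" "cnj (k * z) = k * cnj k * of_int a * u"
    unfolding inv[symmetric] by blast
  have "(k * cnj k * of_int a) * (k * z * u) = (k * z) * cnj (k * z)" unfolding u(2) by (simp add: algebra_simps)
  also have "\<dots> = (k * cnj k) * (z * cnj z)" by (simp add: algebra_simps)
  also have "\<dots> = (k * cnj k * of_int a) * of_int (a * x * x + (2 * b + t) * x * y + e * y * y)"
    unfolding zz by (simp add: algebra_simps)
  finally have "k * z * u = of_int (a * x * x + (2 * b + t) * x * y + e * y * y)"
    using * by (simp del: of_int_add of_int_mult)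
  then have "of_int (a * x * x + (2 * b + t) * x * y + e * y * y) \<in> (*) (k * z) ` ideal_inverse K F"
    using u(1) by (metis imageI)
  moreover have "k * z \<in> F" unfolding *(5) using z by blast
  ultimately show ?thesis using xy by (intro bexI[of _ "k * z"] exI conjI)
qed

section \<open>Ideal classes of order two\<close>

lemma ideal_class_eq:
  assumes "frac_ideal I"
  shows "ideal_class K I = {(*) k ` I | k. k \<in> K - {0}}"
proof -
  have "ideal_class K I = (\<Union>h\<in>principal_fractional_ideals K. {h \<star> I})"
    by (simp add: ideal_class_def r_coset_def fractional_ideal_group_def ideal_prod_complex_ring[of K])
  also have "\<dots> = {((*) k ` \<O>) \<star> I | k. k \<in> K - {0}}" by (auto simp: principal_fractional_ideals_def)
  finally show ?thesis unfolding ideal_mult_scale O_ideal_mult(1)[OF assms] .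
qed

lemma ideal_class_eq_iff:
  assumes "frac_ideal I" "frac_ideal J"
  shows "ideal_class K I = ideal_class K J \<longleftrightarrow> (\<exists>k\<in>K - {0}. I = (*) k ` J)"
proof
  assume "ideal_class K I = ideal_class K J"
  moreover have "I \<in> ideal_class K I" unfolding ideal_class_eq[OF assms(1)]
    by (rule CollectI, rule exI[of _ 1]) simp
  ultimately show "\<exists>k\<in>K - {0}. I = (*) k ` J" unfolding ideal_class_eq[OF assms(2)] by blast
next
  assume "\<exists>k\<in>K - {0}. I = (*) k ` J"
  then obtain k where k: "k \<in> K" "k \<noteq> 0" "I = (*) k ` J" by blast
  have "(\<exists>l\<in>K - {0}. X = (*) l ` I) \<longleftrightarrow> (\<exists>l\<in>K - {0}. X = (*) l ` J)" for X
  proof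
    assume "\<exists>l\<in>K - {0}. X = (*) l ` I"
    then obtain l where "l \<in> K" "l \<noteq> 0" "X = (*) (l * k) ` J" unfolding k(3) image_scale_scale by blast
    then show "\<exists>l\<in>K - {0}. X = (*) l ` J" using k by (intro bexI[of _ "l * k"]) auto
  next
    assume "\<exists>l\<in>K - {0}. X = (*) l ` J"
    then obtain l where l: "l \<in> K" "l \<noteq> 0" "X = (*) l ` J" by blast
    then have "X = (*) (l / k) ` I" unfolding k(3) image_scale_scale using k by simp
    then show "\<exists>l\<in>K - {0}. X = (*) l ` I" using k l by (intro bexI[of _ "l / k"]) auto
  qed
  then have "(\<exists>l. X = (*) l ` I \<and> l \<in> K - {0}) \<longleftrightarrow> (\<exists>l. X = (*) l ` J \<and> l \<in> K - {0})" for X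
    unfolding Bex_def by (simp only: conj_commute)
  then show "ideal_class K I = ideal_class K J"
    unfolding ideal_class_eq[OF assms(1)] ideal_class_eq[OF assms(2)] by (intro Collect_cong)
qed

lemma class_group_2_torsion_eq:
  "class_group_2_torsion K =
    {ideal_class K I | I. frac_ideal I \<and> (\<exists>k\<in>K - {0}. I \<star> I = (*) k ` \<O>)}"
proof -
  let ?P = "{(*) k ` \<O> | k. k \<in> K - {0}}"
  have carr: "carrier (class_group K) = {ideal_class K I | I. frac_ideal I}"
    unfolding class_group_def FactGroup_def RCOSETS_def ideal_class_def
    by (auto simp: fractional_ideal_group_def)
  have one: "\<one>\<^bsub>class_group K\<^esub> = ?P"
    by (simp add: class_group_def FactGroup_def principal_fractional_ideals_def)
  have mult: "c \<otimes>\<^bsub>class_group K\<^esub> d = {x \<star> y | x y. x \<in> c \<and> y \<in> d}" for c d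
    by (auto simp: class_group_def FactGroup_def set_mult_def fractional_ideal_group_def ideal_prod_complex_ring[of K])
  have sq: "ideal_class K I [^]\<^bsub>class_group K\<^esub> (2::nat) = {(*) k ` (I \<star> I) | k. k \<in> K - {0}}"
    if I: "frac_ideal I" for I
  proof -
    have m: "{x \<star> y | x y. x \<in> {(*) k ` X | k. k \<in> K - {0}} \<and> y \<in> {(*) k ` Y | k. k \<in> K - {0}}}
      = {(*) k ` (X \<star> Y) | k. k \<in> K - {0}}" (is "?L = ?R") for X Y
    proof (intro equalityI subsetI)
      fix z assume "z \<in> ?L"
      then obtain k l where "k \<in> K - {0}" "l \<in> K - {0}" "z = ((*) k ` X) \<star> ((*) l ` Y)" by blast
      then have "l * k \<in> K - {0}" "z = (*) (l * k) ` (X \<star> Y)"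
        by (simp_all add: ideal_mult_scale ideal_mult_scale_right image_scale_scale)
      then show "z \<in> ?R" by blast
    next
      fix z assume "z \<in> ?R"
      then obtain k where k: "k \<in> K - {0}" "z = (*) k ` (X \<star> Y)" by blast
      then have "z = ((*) k ` X) \<star> ((*) 1 ` Y)" by (simp add: ideal_mult_scale)
      moreover have "1 \<in> K - {0}" by simp
      ultimately show "z \<in> ?L" using k by blast
    qed
    have "ideal_class K I [^]\<^bsub>class_group K\<^esub> (2::nat)
      = (\<one>\<^bsub>class_group K\<^esub> \<otimes>\<^bsub>class_group K\<^esub> ideal_class K I) \<otimes>\<^bsub>class_group K\<^esub> ideal_class K I"
      by (simp add: nat_pow_def numeral_2_eq_2)
    then show ?thesis unfolding one mult ideal_class_eq[OF I] m O_ideal_mult(1)[OF I] .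
  qed
  have iff: "{(*) k ` (I \<star> I) | k. k \<in> K - {0}} = ?P \<longleftrightarrow> (\<exists>k\<in>K - {0}. I \<star> I = (*) k ` \<O>)"
    if I: "frac_ideal I" for I
    using ideal_class_eq_iff[OF frac_mult[OF I I] frac_O] ideal_class_eq[OF frac_mult[OF I I]]
      ideal_class_eq[OF frac_O] by simp
  have sqP: "ideal_class K I [^]\<^bsub>class_group K\<^esub> (2::nat) = ?P \<longleftrightarrow> (\<exists>k\<in>K - {0}. I \<star> I = (*) k ` \<O>)"
    if "frac_ideal I" for I
    by (simp only: sq[OF that] iff[OF that])
  show ?thesis
  proof (intro equalityI subsetI)
    fix c assume "c \<in> class_group_2_torsion K"
    then obtain I where I: "frac_ideal I" "c = ideal_class K I" "c [^]\<^bsub>class_group K\<^esub> (2::nat) = ?P"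
      unfolding class_group_2_torsion_def carr one by blast
    have "\<exists>k\<in>K - {0}. I \<star> I = (*) k ` \<O>" using I(3) unfolding I(2) sqP[OF I(1)] .
    then show "c \<in> {ideal_class K I | I. frac_ideal I \<and> (\<exists>k\<in>K - {0}. I \<star> I = (*) k ` \<O>)}"
      using I(1,2) by blast
  next
    fix c assume "c \<in> {ideal_class K I | I. frac_ideal I \<and> (\<exists>k\<in>K - {0}. I \<star> I = (*) k ` \<O>)}"
    then obtain I where I: "frac_ideal I" "c = ideal_class K I" and ex: "\<exists>k\<in>K - {0}. I \<star> I = (*) k ` \<O>"
      by blast
    have "c [^]\<^bsub>class_group K\<^esub> (2::nat) = ?P" unfolding I(2) sqP[OF I(1)] by (rule ex)
    then show "c \<in> class_group_2_torsion K" unfolding class_group_2_torsion_def carr one using I by blast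
  qed
qed

lemma ideal_class_2_torsion_iff:
  assumes "frac_ideal I"
  shows "ideal_class K I \<in> class_group_2_torsion K \<longleftrightarrow> (\<exists>k\<in>K - {0}. I \<star> I = (*) k ` \<O>)"
proof
  assume "ideal_class K I \<in> class_group_2_torsion K"
  then obtain J k where J: "frac_ideal J" "k \<in> K - {0}" "J \<star> J = (*) k ` \<O>" "ideal_class K I = ideal_class K J"
    unfolding class_group_2_torsion_eq by blast
  then obtain l where "l \<in> K - {0}" "I = (*) l ` J" using ideal_class_eq_iff[OF assms J(1)] by blast
  then have "I \<star> I = (*) (l * (l * k)) ` \<O>" "l * (l * k) \<in> K - {0}"
    using J by (simp_all add: ideal_mult_scale ideal_mult_scale_right image_scale_scale)
  then show "\<exists>k\<in>K - {0}. I \<star> I = (*) k ` \<O>" by blast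
qed (use assms in \<open>auto simp: class_group_2_torsion_eq\<close>)

lemma std_lattice_shift: "std_lattice a (b + a * m) = std_lattice a b"
proof -
  have sub: "std_lattice a (b + a * m) \<subseteq> std_lattice a b" for b m
  proof
    fix z assume "z \<in> std_lattice a (b + a * m)"
    then obtain x y where "z = of_int (x * a) + of_int y * (of_int (b + a * m) + w)" by (auto simp: std_lattice_def)
    then have "z = of_int ((x + y * m) * a) + of_int y * (of_int b + w)" by (simp add: algebra_simps)
    then show "z \<in> std_lattice a b" using std_latticeI by metis
  qed
  show ?thesis using sub[of b m] sub[of "b + a * m" "- m"] by simp
qed

text \<open>The lattices of the forms with coefficients \<open>(a, 2 b + t, e)\<close> and \<open>(e, - (2 b + t), a)\<close> are in
  the same class; with the shift of \<open>b\<close> by multiples of \<open>a\<close> this gives the reduction of binary forms.\<close>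

lemma std_lattice_reflect:
  assumes "a > 0" "b\<^sup>2 + b * t + q = a * e"
  shows "(*) (of_int b + cnj w) ` std_lattice a b = (*) (of_int a) ` std_lattice e (- (b + t))"
proof -
  have *: "(of_int b + cnj w) * (of_int (x * a) + of_int y * (of_int b + w))
      = of_int a * (of_int (y * e) + of_int (- x) * (of_int (- (b + t)) + w))" for x y
  proof -
    have "(of_int b + cnj w) * (of_int (x * a) + of_int y * (of_int b + w))
      = of_int (x * a) * (of_int b + cnj w) + of_int y * ((of_int b + w) * (of_int b + cnj w))"
      by (simp add: algebra_simps)
    also have "\<dots> = of_int a * (of_int (y * e) + of_int (- x) * (of_int (- (b + t)) + w))"
      unfolding norm_b_w assms(2) by (simp add: cnj_w algebra_simps)
    finally show ?thesis .
  qed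
  show ?thesis
  proof (intro equalityI subsetI)
    fix z assume "z \<in> (*) (of_int b + cnj w) ` std_lattice a b"
    then obtain x y where "z = (of_int b + cnj w) * (of_int (x * a) + of_int y * (of_int b + w))"
      by (auto simp: std_lattice_def)
    then show "z \<in> (*) (of_int a) ` std_lattice e (- (b + t))" unfolding * using std_latticeI by blast
  next
    fix z assume "z \<in> (*) (of_int a) ` std_lattice e (- (b + t))"
    then obtain x y where "z = of_int a * (of_int (y * e) + of_int (- (- x)) * (of_int (- (b + t)) + w))"
      unfolding minus_minus by (auto simp: std_lattice_def)
    then show "z \<in> (*) (of_int b + cnj w) ` std_lattice a b" unfolding *[symmetric] using std_latticeI by blast
  qed
qed

text \<open>Reduction theory: in the class take a form with \<open>a\<close> minimal and shift so that
  \<open>\<bar>2 * b + t\<bar> \<le> a\<close>. Reflection gives \<open>a \<le> e\<close>, so \<open>4 * a\<^sup>2 \<le> 4 * a * e = (2 * b + t)\<^sup>2 + D \<le> a\<^sup>2 + D\<close>, which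
  bounds \<open>a\<close> and \<open>b\<close>.\<close>

lemma finite_class_group_2_torsion: "finite (class_group_2_torsion K)"
proof -
  define D where "D = 4 * q - t\<^sup>2"
  define c where "c = (\<lambda>(a, b). ideal_class K (std_lattice a b))"
  have "class_group_2_torsion K \<subseteq> c ` ({0..D} \<times> {- D - \<bar>t\<bar>..D + \<bar>t\<bar>})"
  proof
    fix cl assume "cl \<in> class_group_2_torsion K"
    then obtain I where I: "frac_ideal I" and cl: "cl = ideal_class K I" unfolding class_group_2_torsion_eq by blast
    define S where "S = (\<lambda>a::nat. a > 0 \<and> (\<exists>k b. k \<in> K \<and> k \<noteq> 0 \<and> int a dvd b\<^sup>2 + b * t + q \<and> I = (*) k ` std_lattice (int a) b))"
    obtain k0 a0 b0 where *: "k0 \<in> K" "k0 \<noteq> 0" "a0 > 0" "a0 dvd b0\<^sup>2 + b0 * t + q" "I = (*) k0 ` std_lattice a0 b0"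
      using frac_ideal_std_lattice[OF I] by blast
    have "S (nat a0)" unfolding S_def using * by (intro conjI exI[of _ k0] exI[of _ b0]) simp_all
    then obtain A where A: "S A" "\<And>y. S y \<Longrightarrow> A \<le> y" using ex_has_least_nat[of S "nat a0" "\<lambda>x. x"] by blast
    define a where "a = int A"
    obtain k b1 where k: "k \<in> K" "k \<noteq> 0" "a dvd b1\<^sup>2 + b1 * t + q" "I = (*) k ` std_lattice a b1" and a: "a > 0"
      using A(1) unfolding S_def a_def by auto
    define m where "m = (2 * b1 + t + a) div (2 * a)"
    define b where "b = b1 + a * (- m)"
    have "2 * b1 + t + a = 2 * a * m + (2 * b1 + t + a) mod (2 * a)" by (simp add: m_def)
    moreover have "0 \<le> (2 * b1 + t + a) mod (2 * a)" "(2 * b1 + t + a) mod (2 * a) < 2 * a" using a by simp_all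
    ultimately have red: "\<bar>2 * b + t\<bar> \<le> a" unfolding b_def by (simp add: algebra_simps abs_le_iff)
    have Ib: "I = (*) k ` std_lattice a b" unfolding b_def std_lattice_shift by (rule k(4))
    have "b\<^sup>2 + b * t + q = (b1\<^sup>2 + b1 * t + q) + a * (a * m * m - 2 * b1 * m - m * t)"
      unfolding b_def by (simp add: algebra_simps power2_eq_square)
    then have "a dvd b\<^sup>2 + b * t + q" using dvd_add[OF k(3) dvd_triv_left[of a]] by (simp only:)
    then obtain e where e: "b\<^sup>2 + b * t + q = a * e" by blast
    have "of_int (a * e) = (of_int b + w) * cnj (of_int b + w)" unfolding e[symmetric] norm_b_w[symmetric] by simp
    then have "complex_of_real (real_of_int (a * e)) = complex_of_real ((cmod (of_int b + w))\<^sup>2)"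
      by (simp only: complex_norm_square of_real_of_int_eq)
    then have "real_of_int (a * e) = (cmod (of_int b + w))\<^sup>2" using of_real_eq_iff by blast
    moreover have "of_int b + w \<noteq> 0" using Im_w by (auto simp: complex_eq_iff)
    ultimately have "real_of_int (a * e) > 0" by simp
    then have "a * e > 0" by linarith
    then have e0: "e > 0" using a zero_less_mult_pos by blast
    let ?z = "of_int b + cnj w"
    have z0: "?z \<noteq> 0" using Im_w by (auto simp: complex_eq_iff)
    have "(*) k ` std_lattice a b = (*) (k / ?z) ` (*) ?z ` std_lattice a b"
      unfolding image_scale_scale using z0 by simp
    also have "\<dots> = (*) (k / ?z * of_int a) ` std_lattice e (- (b + t))"
      unfolding std_lattice_reflect[OF a e] image_scale_scale ..
    finally have "I = (*) (k / ?z * of_int a) ` std_lattice e (- (b + t))" unfolding Ib .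
    moreover have "k / ?z * of_int a \<in> K" "k / ?z * of_int a \<noteq> 0" using k a z0 by simp_all
    moreover have "(- (b + t))\<^sup>2 + - (b + t) * t + q = e * a" unfolding mult.commute[of e] e[symmetric]
      by (simp add: algebra_simps power2_eq_square)
    then have "e dvd (- (b + t))\<^sup>2 + - (b + t) * t + q" by simp
    ultimately have "S (nat e)" unfolding S_def using e0
      by (intro conjI exI[of _ "k / ?z * of_int a"] exI[of _ "- (b + t)"]) simp_all
    then have "a \<le> e" using A(2) e0 unfolding a_def by fastforce
    then have "a * a \<le> a * e" using a by simp
    moreover have "4 * (a * e) = (2 * b + t)\<^sup>2 + D" unfolding e[symmetric] D_def
      by (simp add: algebra_simps power2_eq_square)
    moreover have "(2 * b + t)\<^sup>2 \<le> a\<^sup>2" using red a by (simp add: abs_le_square_iff[symmetric])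
    ultimately have "3 * (a * a) \<le> D" by (simp add: power2_eq_square)
    moreover have "a \<le> a * a" using a by (simp add: pos_int_cases mult_le_cancel_left1)
    ultimately have aD: "a \<le> D" using a by linarith
    have "b \<in> {- D - \<bar>t\<bar>..D + \<bar>t\<bar>}" using red aD by auto
    moreover have "cl = c (a, b)"
    proof -
      have "frac_ideal (std_lattice a b)" using std_lattice_frac[OF a] e by simp
      then show ?thesis unfolding cl c_def case_prod_conv
        using ideal_class_eq_iff[OF I, of "std_lattice a b"] Ib k by blast
    qed
    ultimately show "cl \<in> c ` ({0..D} \<times> {- D - \<bar>t\<bar>..D + \<bar>t\<bar>})" using a aD by auto
  qed
  then show ?thesis by (rule finite_subset) simp
qed

end

section \<open>Matrices over the field and their twisted action\<close>

lemma mat2_sel [simp]: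
  "mat2 a b c d $ 1 $ 1 = a" "mat2 a b c d $ 1 $ 2 = b" "mat2 a b c d $ 2 $ 1 = c" "mat2 a b c d $ 2 $ 2 = d"
  by (simp_all add: mat2_def vector_def)

lemma mat2_eqI:
  assumes "M $ 1 $ 1 = N $ 1 $ 1" "M $ 1 $ 2 = N $ 1 $ 2" "M $ 2 $ 1 = N $ 2 $ 1" "M $ 2 $ 2 = N $ 2 $ 2"
  shows "M = (N :: complex^2^2)"
  using assms by (simp add: vec_eq_iff forall_2)

lemma mat2_eta: "mat2 (M $ 1 $ 1) (M $ 1 $ 2) (M $ 2 $ 1) (M $ 2 $ 2) = M"
  by (rule mat2_eqI) simp_all

lemma mult_sel:
  "(M ** N) $ i $ j = M $ i $ 1 * N $ 1 $ j + M $ i $ 2 * N $ 2 $ j" for M N :: "complex^2^2"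
  by (simp add: matrix_matrix_mult_def sum_2)

lemma mat_sel [simp]: "(mat k :: complex^2^2) $ 1 $ 1 = k" "(mat k :: complex^2^2) $ 1 $ 2 = 0"
  "(mat k :: complex^2^2) $ 2 $ 1 = 0" "(mat k :: complex^2^2) $ 2 $ 2 = k"
  by (simp_all add: mat_def)

lemma scaleR_complex [simp]: "r *\<^sub>R z = of_real r * z" for z :: complex
  by (rule scaleR_conv_of_real)

lemma mat_mult_left_commute: "M ** (mat k ** N) = mat k ** (M ** N)" for M N :: "complex^2^2"
  by (rule mat2_eqI) (simp_all add: mult_sel algebra_simps)

definition adj2 :: "complex^2^2 \<Rightarrow> complex^2^2"
  where "adj2 M = mat2 (M $ 2 $ 2) (- M $ 1 $ 2) (- M $ 2 $ 1) (M $ 1 $ 1)"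

definition inv2 :: "complex^2^2 \<Rightarrow> complex^2^2"
  where "inv2 M = mat (inverse (det M)) ** adj2 M"

lemma adj2_mult: "M ** adj2 M = mat (det M)" "adj2 M ** M = mat (det M)"
  by (rule mat2_eqI; simp add: mult_sel adj2_def det_2 algebra_simps)+

lemma mat_mat_mult: "mat k ** mat l = (mat (k * l) :: complex^2^2)"
  by (rule mat2_eqI) (simp_all add: mult_sel)

lemma inv2_mult:
  assumes "det M \<noteq> 0"
  shows "inv2 M ** M = mat 1" "M ** inv2 M = mat 1"
proof -
  show "inv2 M ** M = mat 1"
    unfolding inv2_def matrix_mul_assoc[symmetric] adj2_mult mat_mat_mult using assms by simp
  show "M ** inv2 M = mat 1"
    unfolding inv2_def mat_mult_left_commute adj2_mult mat_mat_mult using assms by simp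
qed

lemma det_mat [simp]: "det (mat k :: complex^2^2) = k * k"
  by (simp add: det_2)

lemma det_scaleR_2: "det (r *\<^sub>R M) = of_real (r\<^sup>2) * det M" for M :: "complex^2^2"
  by (simp add: det_2 power2_eq_square algebra_simps)

locale quad_torus = quad_order +
  fixes B :: "complex set"
  assumes B_ideal: "nonzero_ideal K B"
begin

lemmas frac_B = nonzero_idealD(1)[OF B_ideal]
lemmas B_subset = nonzero_idealD(2)[OF B_ideal]

abbreviation "Binv \<equiv> ideal_inverse K B"
abbreviation "NB \<equiv> of_nat (ideal_norm K B) :: complex"
abbreviation "dag \<equiv> rosati K B"

lemmas frac_Binv = ideal_inverse(1)[OF frac_B]
lemmas B_Binv = ideal_inverse(2)[OF frac_B]

lemma NB_nonzero [simp]: "NB \<noteq> 0" "ideal_norm K B > 0" "ideal_norm K B \<noteq> 0"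
  using ideal_norm_eq(2)[OF frac_B B_subset] by simp_all

lemma NB_Binv: "(*) NB ` Binv = cnj ` B"
  using ideal_inverse(3)[OF frac_B _ ideal_norm_eq(1)[OF frac_B B_subset]] by simp

lemma NB_cnj_Binv: "(*) NB ` cnj ` Binv = B"
proof -
  have "cnj ` (*) NB ` Binv = B" unfolding NB_Binv by simp
  then show ?thesis unfolding cnj_scale by simp
qed

lemma one_in_Binv: "x \<in> \<O> \<Longrightarrow> x \<in> Binv"
  using B_subset O_subset_K unfolding ideal_inverse_def by auto

text \<open>With \<open>\<Lambda> = \<O> \<oplus> B\<close>, these are the matrices \<open>M\<close> with \<open>M \<Lambda> \<subseteq> J \<Lambda>\<close>. They multiply like the ideals \<open>J\<close>
  do, and the Rosati involution conjugates \<open>J\<close>; this replaces computations with single entries.\<close>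

definition ideal_mats :: "complex set \<Rightarrow> (complex^2^2) set"
  where "ideal_mats J = {M. M $ 1 $ 1 \<in> J \<and> M $ 2 $ 2 \<in> J \<and> M $ 1 $ 2 \<in> J \<star> Binv \<and> M $ 2 $ 1 \<in> J \<star> B}"

lemma End_A_eq: "End_A K B = ideal_mats \<O>"
proof (intro equalityI subsetI)
  fix M assume "M \<in> End_A K B"
  then show "M \<in> ideal_mats \<O>" by (auto simp: End_A_def ideal_mats_def frac_B frac_Binv)
next
  fix M assume "M \<in> ideal_mats \<O>"
  then show "M \<in> End_A K B" unfolding End_A_def
    by (intro CollectI exI[of _ "M $ 1 $ 1"] exI[of _ "M $ 1 $ 2"] exI[of _ "M $ 2 $ 1"] exI[of _ "M $ 2 $ 2"])
      (simp add: ideal_mats_def frac_B frac_Binv mat2_eta)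
qed

lemma Binv_B_cancel:
  assumes "frac_ideal I" "frac_ideal J"
  shows "x \<in> I \<star> Binv \<Longrightarrow> y \<in> J \<star> B \<Longrightarrow> x * y \<in> I \<star> J"
    "x \<in> I \<star> B \<Longrightarrow> y \<in> J \<star> Binv \<Longrightarrow> x * y \<in> I \<star> J"
proof -
  have "(I \<star> Binv) \<star> (J \<star> B) = (I \<star> J) \<star> (B \<star> Binv)" by (simp only: ideal_mult_ac)
  then have 1: "(I \<star> Binv) \<star> (J \<star> B) = I \<star> J" using O_ideal_mult(2)[OF frac_mult[OF assms]] B_Binv by simp
  show "x * y \<in> I \<star> J" if "x \<in> I \<star> Binv" "y \<in> J \<star> B" using ideal_multI[OF that] unfolding 1 .
  have 2: "(I \<star> B) \<star> (J \<star> Binv) = (I \<star> Binv) \<star> (J \<star> B)" by (simp only: ideal_mult_ac)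
  show "x * y \<in> I \<star> J" if "x \<in> I \<star> B" "y \<in> J \<star> Binv" using ideal_multI[OF that] unfolding 2 1 .
qed

lemma ideal_mats_mult:
  assumes I: "frac_ideal I" and J: "frac_ideal J" and M: "M \<in> ideal_mats I" and N: "N \<in> ideal_mats J"
  shows "M ** N \<in> ideal_mats (I \<star> J)"
proof -
  have M': "M $ 1 $ 1 \<in> I" "M $ 2 $ 2 \<in> I" "M $ 1 $ 2 \<in> I \<star> Binv" "M $ 2 $ 1 \<in> I \<star> B"
    using M by (auto simp: ideal_mats_def)
  have N': "N $ 1 $ 1 \<in> J" "N $ 2 $ 2 \<in> J" "N $ 1 $ 2 \<in> J \<star> Binv" "N $ 2 $ 1 \<in> J \<star> B"
    using N by (auto simp: ideal_mats_def)
  note c = Binv_B_cancel[OF I J]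
  have a: "I \<star> (J \<star> X) = I \<star> J \<star> X" "I \<star> X \<star> J = I \<star> J \<star> X" for X by (simp_all only: ideal_mult_ac)
  show ?thesis unfolding ideal_mats_def mem_Collect_eq mult_sel
    using ideal_multI[OF M'(1) N'(1)] c(1)[OF M'(3) N'(4)] c(2)[OF M'(4) N'(3)] ideal_multI[OF M'(2) N'(2)]
      ideal_multI[OF M'(1) N'(3), unfolded a] ideal_multI[OF M'(3) N'(2), unfolded a]
      ideal_multI[OF M'(4) N'(1), unfolded a] ideal_multI[OF M'(2) N'(4), unfolded a]
    by (simp add: ideal_mult_add)
qed

lemma ideal_mats_dag:
  assumes "M \<in> ideal_mats J"
  shows "dag M \<in> ideal_mats (cnj ` J)"
proof -
  have M: "M $ 1 $ 1 \<in> J" "M $ 2 $ 2 \<in> J" "M $ 1 $ 2 \<in> J \<star> Binv" "M $ 2 $ 1 \<in> J \<star> B"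
    using assms by (auto simp: ideal_mats_def)
  have "cnj (M $ 2 $ 1) \<in> cnj ` J \<star> cnj ` B" using imageI[OF M(4), of cnj] unfolding cnj_ideal_mult .
  then have "cnj (M $ 2 $ 1) \<in> (*) NB ` (cnj ` J \<star> Binv)" unfolding NB_Binv[symmetric] ideal_mult_scale_right .
  then have 1: "cnj (M $ 2 $ 1) / NB \<in> cnj ` J \<star> Binv" by auto
  have "cnj (M $ 1 $ 2) \<in> cnj ` J \<star> cnj ` Binv" using imageI[OF M(3), of cnj] unfolding cnj_ideal_mult .
  then have "NB * cnj (M $ 1 $ 2) \<in> (*) NB ` (cnj ` J \<star> cnj ` Binv)" by (rule imageI)
  then have 2: "cnj (M $ 1 $ 2) * NB \<in> cnj ` J \<star> B"
    unfolding ideal_mult_scale_right[symmetric] NB_cnj_Binv by (simp only: mult.commute)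
  show ?thesis using 1 2 M by (simp add: ideal_mats_def rosati_def)
qed

lemma ideal_mats_det:
  assumes J: "frac_ideal J" and M: "M \<in> ideal_mats J"
  shows "det M \<in> J \<star> J"
proof -
  have "M $ 1 $ 1 * M $ 2 $ 2 \<in> J \<star> J" "M $ 1 $ 2 * M $ 2 $ 1 \<in> J \<star> J"
    using M by (auto simp: ideal_mats_def intro: ideal_multI Binv_B_cancel[OF J J])
  then show ?thesis unfolding det_2
    using fracD(3)[OF frac_mult[OF J J] _ fracD(5)[OF frac_mult[OF J J]]] by fastforce
qed

lemma ideal_mats_adj:
  assumes J: "frac_ideal J" and M: "M \<in> ideal_mats J"
  shows "adj2 M \<in> ideal_mats J"
  using M fracD(5)[OF frac_mult[OF J frac_B]] fracD(5)[OF frac_mult[OF J frac_Binv]]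
  by (simp add: ideal_mats_def adj2_def)

lemma ideal_mats_scale:
  assumes "M \<in> ideal_mats J"
  shows "mat k ** M \<in> ideal_mats ((*) k ` J)"
  using assms by (auto simp: ideal_mats_def mult_sel ideal_mult_scale)

lemma dag_mult: "dag (M ** N) = dag N ** dag M"
  by (rule mat2_eqI) (simp_all add: mult_sel rosati_def field_simps)

lemma dag_dag [simp]: "dag (dag M) = M"
  by (rule mat2_eqI) (simp_all add: rosati_def)

lemma dag_scaleR: "dag (r *\<^sub>R M) = r *\<^sub>R dag M"
  by (rule mat2_eqI) (simp_all add: rosati_def)

lemma dag_mat [simp]: "dag (mat k) = mat (cnj k)"
  by (rule mat2_eqI) (simp_all add: rosati_def)

lemma det_dag: "det (dag M) = cnj (det M)"
  by (simp add: det_2 rosati_def)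

text \<open>The maps \<open>h\<^sub>P\<close> and \<open>\<gamma>\<^sub>\<aa>\<close> are the cases \<open>r = 1\<close> and \<open>r = 1 / N(\<aa>)\<close>. Composition reverses the order of
  the matrices.\<close>

definition act :: "real \<Rightarrow> complex^2^2 \<Rightarrow> complex^2^2 \<Rightarrow> complex^2^2"
  where "act r M S = r *\<^sub>R (dag M ** S ** M)"

lemma scaleR_mult: "(r *\<^sub>R M) ** N = r *\<^sub>R (M ** N)" "M ** (r *\<^sub>R N) = r *\<^sub>R (M ** N)"
  for M N :: "complex^2^2"
  by (rule mat2_eqI; simp add: mult_sel algebra_simps)+

lemma act_act: "act r M (act s N S) = act (r * s) (N ** M) S"
  by (simp add: act_def dag_mult scaleR_mult matrix_mul_assoc)

lemma act_one [simp]: "act 1 (mat 1) S = S"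
  by (simp add: act_def)

lemma act_scale: "act r (mat k ** M) S = act (r * (cmod k)\<^sup>2) M S"
proof -
  have e: "complex_of_real (r * (cmod k)\<^sup>2) = of_real r * (k * cnj k)"
    by (simp only: of_real_mult complex_norm_square)
  show ?thesis unfolding act_def
    by (rule mat2_eqI; simp only: vector_scaleR_component scaleR_complex e mult_sel rosati_def mat2_sel mat_sel;
      simp add: field_simps)
qed

lemma act_add: "act r M (S + T) = act r M S + act r M T"
  by (rule mat2_eqI) (simp_all add: act_def mult_sel algebra_simps)

lemma det_act: "det (act r M S) = of_real ((r * cmod (det M))\<^sup>2) * det S"
proof -
  have "det (act r M S) = of_real (r\<^sup>2) * (det M * cnj (det M)) * det S"
    by (simp add: act_def det_scaleR_2 det_mul det_dag mult_ac)
  then show ?thesis by (simp add: complex_norm_square[symmetric] power_mult_distrib)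
qed

lemma HermD:
  assumes "S \<in> Herm K B"
  shows "S \<in> ideal_mats \<O>" "dag S = S" "S $ 1 $ 1 \<in> \<O>" "S $ 2 $ 2 \<in> \<O>" "S $ 1 $ 2 \<in> Binv"
    "cnj (S $ 1 $ 1) = S $ 1 $ 1" "cnj (S $ 2 $ 2) = S $ 2 $ 2" "S $ 2 $ 1 = cnj (S $ 1 $ 2) * NB"
proof -
  show 1: "S \<in> ideal_mats \<O>" "dag S = S" using assms by (auto simp: Herm_def End_A_eq)
  show "S $ 1 $ 1 \<in> \<O>" "S $ 2 $ 2 \<in> \<O>" "S $ 1 $ 2 \<in> Binv" using 1 by (auto simp: ideal_mats_def frac_Binv)
  show "cnj (S $ 1 $ 1) = S $ 1 $ 1" "cnj (S $ 2 $ 2) = S $ 2 $ 2" "S $ 2 $ 1 = cnj (S $ 1 $ 2) * NB"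
    using arg_cong[OF 1(2), of "\<lambda>M. M $ 1 $ 1"] arg_cong[OF 1(2), of "\<lambda>M. M $ 2 $ 2"]
      arg_cong[OF 1(2), of "\<lambda>M. M $ 2 $ 1"] by (simp_all add: rosati_def)
qed

lemma HermI:
  assumes "x \<in> \<O>" "y \<in> \<O>" "b \<in> Binv" "cnj x = x" "cnj y = y"
  shows "mat2 x b (cnj b * NB) y \<in> Herm K B"
proof -
  have "cnj b * NB \<in> B" using imageI[OF imageI[OF assms(3), of cnj], of "(*) NB"]
    unfolding NB_cnj_Binv by (simp add: mult.commute)
  then have "mat2 x b (cnj b * NB) y \<in> ideal_mats \<O>" using assms by (simp add: ideal_mats_def frac_B frac_Binv)
  moreover have "dag (mat2 x b (cnj b * NB) y) = mat2 x b (cnj b * NB) y"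
    by (rule mat2_eqI) (simp_all add: rosati_def assms)
  ultimately show ?thesis by (simp add: Herm_def End_A_eq)
qed

lemma Herm_eta:
  assumes "S \<in> Herm K B"
  shows "S = mat2 (S $ 1 $ 1) (S $ 1 $ 2) (cnj (S $ 1 $ 2) * NB) (S $ 2 $ 2)"
  by (rule mat2_eqI) (simp_all add: HermD[OF assms])

lemma Herm_add: "S \<in> Herm K B \<Longrightarrow> T \<in> Herm K B \<Longrightarrow> S + T \<in> Herm K B"
proof -
  assume S: "S \<in> Herm K B" and T: "T \<in> Herm K B"
  have "S + T = mat2 (S $ 1 $ 1 + T $ 1 $ 1) (S $ 1 $ 2 + T $ 1 $ 2) (cnj (S $ 1 $ 2 + T $ 1 $ 2) * NB) (S $ 2 $ 2 + T $ 2 $ 2)"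
    by (rule mat2_eqI) (simp_all add: HermD[OF S] HermD[OF T] algebra_simps)
  moreover have "\<dots> \<in> Herm K B"
    by (rule HermI) (simp_all add: HermD[OF S] HermD[OF T] fracD(3)[OF frac_Binv])
  ultimately show ?thesis by simp
qed

lemma act_Herm:
  assumes J: "frac_ideal J" and r: "r > 0" "J \<star> cnj ` J = (*) (of_real r) ` \<O>"
    and M: "M \<in> ideal_mats J" and S: "S \<in> Herm K B"
  shows "act (1 / r) M S \<in> Herm K B"
proof -
  have "dag M ** S ** M \<in> ideal_mats (cnj ` J \<star> \<O> \<star> J)"
    by (intro ideal_mats_mult frac_mult frac_cnj frac_O ideal_mats_dag J M HermD(1)[OF S])
  also have "cnj ` J \<star> \<O> \<star> J = (*) (of_real r) ` \<O>"
    using r(2) by (simp add: frac_cnj J ideal_mult_comm)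
  finally have "mat (inverse (of_real r)) ** (dag M ** S ** M) \<in> ideal_mats ((*) (inverse (of_real r)) ` (*) (of_real r) ` \<O>)"
    by (rule ideal_mats_scale)
  also have "mat (inverse (of_real r)) ** (dag M ** S ** M) = act (1 / r) M S"
    unfolding act_def by (rule mat2_eqI) (simp_all add: mult_sel divide_inverse)
  finally have "act (1 / r) M S \<in> ideal_mats \<O>" using r unfolding image_scale_scale by simp
  moreover have "dag (act (1 / r) M S) = act (1 / r) M S"
    by (simp add: act_def dag_scaleR dag_mult HermD[OF S] matrix_mul_assoc)
  ultimately show ?thesis by (simp add: Herm_def End_A_eq)
qed

section \<open>Matrices carrying the lattice to an ideal multiple of itself\<close>

text \<open>For \<open>M\<close> in \<^const>\<open>ideal_mats\<close>, the condition on the determinant says that \<open>M \<Lambda>\<close> is all of \<open>J \<Lambda>\<close>,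
  since both have the same determinant ideal. In particular \<open>J\<close> has order at most two in the class group.\<close>

definition ideal_similitude :: "complex set \<Rightarrow> complex^2^2 \<Rightarrow> bool"
  where "ideal_similitude J M \<longleftrightarrow> frac_ideal J \<and> M \<in> ideal_mats J \<and> det M \<noteq> 0 \<and> J \<star> J = (*) (det M) ` \<O>"

lemma scale_O_mult: "((*) a ` \<O>) \<star> ((*) b ` \<O>) = (*) (a * b) ` \<O>"
  unfolding ideal_mult_scale ideal_mult_scale_right image_scale_scale O_ideal_mult(1)[OF frac_O]
  by (simp only: mult.commute)

text \<open>Multiply \<open>J \<star> J = det M \<O>\<close> by its conjugate.\<close>

lemma ideal_similitude_norm:
  assumes "ideal_similitude J M" "r > 0" "J \<star> cnj ` J = (*) (of_real r) ` \<O>"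
  shows "cmod (det M) = r"
proof -
  have "(J \<star> J) \<star> cnj ` (J \<star> J) = (J \<star> cnj ` J) \<star> (J \<star> cnj ` J)"
    unfolding cnj_ideal_mult by (simp only: ideal_mult_ac)
  then have "(*) (det M * cnj (det M)) ` \<O> = (*) (of_real r * of_real r) ` \<O>"
    using assms(1) unfolding assms(3) ideal_similitude_def
    by (simp add: cnj_scale scale_O_mult)
  then have "(*) (of_real ((cmod (det M))\<^sup>2)) ` \<O> = (*) (of_real (r * r)) ` \<O>"
    unfolding complex_norm_square of_real_mult .
  moreover have "(cmod (det M))\<^sup>2 > 0" "r * r > 0" using assms by (auto simp: ideal_similitude_def)
  ultimately have "(cmod (det M))\<^sup>2 = r * r" using scaled_O_unique by blast
  then show ?thesis using assms(2) by (simp add: power2_eq_square[symmetric])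
qed

lemma ideal_similitude_mult:
  assumes "ideal_similitude I M" "ideal_similitude J N"
  shows "ideal_similitude (I \<star> J) (M ** N)"
proof -
  have "(I \<star> J) \<star> (I \<star> J) = (I \<star> I) \<star> (J \<star> J)" by (simp only: ideal_mult_ac)
  also have "\<dots> = (*) (det (M ** N)) ` \<O>"
    using assms unfolding ideal_similitude_def
    by (simp add: scale_O_mult det_mul)
  finally show ?thesis
    using assms unfolding ideal_similitude_def by (simp add: frac_mult ideal_mats_mult det_mul)
qed

lemma ideal_similitude_scale:
  assumes "ideal_similitude J M" "k \<in> K" "k \<noteq> 0"
  shows "ideal_similitude ((*) k ` J) (mat k ** M)"
proof -
  have "J \<star> J = (*) (det M) ` \<O>" using assms by (simp add: ideal_similitude_def)
  then have "((*) k ` J) \<star> ((*) k ` J) = (*) (k * k * det M) ` \<O>"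
    by (simp only: ideal_mult_scale ideal_mult_scale_right image_scale_scale mult.assoc)
  then show ?thesis
    using assms unfolding ideal_similitude_def by (simp add: frac_scale ideal_mats_scale det_mul)
qed

text \<open>The inverse is the adjugate, which lies in the same \<^const>\<open>ideal_mats\<close> as \<open>M\<close>, divided by the
  determinant; and \<open>J\<close> divided by the determinant is the inverse of \<open>J\<close>.\<close>

lemma ideal_similitude_inv:
  assumes "ideal_similitude J M"
  shows "ideal_similitude (ideal_inverse K J) (inv2 M)"
proof -
  have J: "frac_ideal J" "M \<in> ideal_mats J" "det M \<noteq> 0" "J \<star> J = (*) (det M) ` \<O>"
    using assms by (auto simp: ideal_similitude_def)
  have inv: "frac_ideal (ideal_inverse K J)" "J \<star> ideal_inverse K J = \<O>"
    using ideal_inverse[OF J(1)] by auto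
  have "J = (J \<star> J) \<star> ideal_inverse K J" unfolding ideal_mult_assoc inv(2) using J(1) by simp
  also have "\<dots> = (*) (det M) ` ideal_inverse K J" unfolding J(4) ideal_mult_scale using inv(1) by simp
  finally have "(*) (inverse (det M)) ` J = (*) (inverse (det M)) ` (*) (det M) ` ideal_inverse K J" by (rule arg_cong)
  then have e: "(*) (inverse (det M)) ` J = ideal_inverse K J" unfolding image_scale_scale using J(3) by simp
  have "det M \<in> K" using ideal_mats_det[OF J(1,2)] fracD(1)[OF frac_mult[OF J(1) J(1)]] by blast
  moreover have "ideal_similitude J (adj2 M)"
    using J ideal_mats_adj[OF J(1,2)] by (simp add: ideal_similitude_def det_2 adj2_def mult.commute)
  ultimately show ?thesis unfolding e[symmetric] inv2_def using J(3) by (intro ideal_similitude_scale) auto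
qed

lemma ideal_inverse_norm:
  assumes "frac_ideal J" "r > 0" "J \<star> cnj ` J = (*) (of_real r) ` \<O>"
  shows "ideal_inverse K J \<star> cnj ` ideal_inverse K J = (*) (of_real (1 / r)) ` \<O>"
proof -
  have inv: "frac_ideal (ideal_inverse K J)" "J \<star> ideal_inverse K J = \<O>"
    using ideal_inverse[OF assms(1)] by auto
  let ?J = "ideal_inverse K J"
  have f: "frac_ideal (?J \<star> cnj ` ?J)" using inv frac_mult frac_cnj by blast
  have "(J \<star> cnj ` J) \<star> (?J \<star> cnj ` ?J) = (J \<star> ?J) \<star> cnj ` (J \<star> ?J)"
    unfolding cnj_ideal_mult by (simp only: ideal_mult_ac)
  then have "(*) (of_real r) ` (?J \<star> cnj ` ?J) = \<O>"
    unfolding assms(3) ideal_mult_scale O_ideal_mult(1)[OF f] inv(2) by (simp add: frac_O)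
  then have "(*) (of_real (1 / r)) ` (*) (of_real r) ` (?J \<star> cnj ` ?J) = (*) (of_real (1 / r)) ` \<O>" by simp
  then show ?thesis unfolding image_scale_scale using assms(2) by simp
qed


section \<open>The group of isometries\<close>

lemma group_Herm: "group (Herm_group K B)"
proof (rule groupI)
  have "0 = mat2 0 0 (cnj 0 * NB) 0" by (rule mat2_eqI) simp_all
  also have "\<dots> \<in> Herm K B" by (rule HermI) (simp_all add: fracD(2)[OF frac_Binv])
  finally have 0: "0 \<in> Herm K B" .
  then show "\<one>\<^bsub>Herm_group K B\<^esub> \<in> carrier (Herm_group K B)" by (simp add: Herm_group_def)
  fix S assume "S \<in> carrier (Herm_group K B)"
  then have S: "S \<in> Herm K B" by (simp add: Herm_group_def)
  have "- S = mat2 (- S $ 1 $ 1) (- S $ 1 $ 2) (cnj (- S $ 1 $ 2) * NB) (- S $ 2 $ 2)"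
    by (rule mat2_eqI) (simp_all add: HermD[OF S])
  also have "\<dots> \<in> Herm K B" by (rule HermI) (simp_all add: HermD[OF S] fracD(5)[OF frac_Binv])
  finally show "\<exists>y\<in>carrier (Herm_group K B). y \<otimes>\<^bsub>Herm_group K B\<^esub> S = \<one>\<^bsub>Herm_group K B\<^esub>"
    by (intro bexI[of _ "- S"]) (simp_all add: Herm_group_def)
qed (simp_all add: Herm_group_def Herm_add add.assoc)

lemma G_A_iff: "f \<in> carrier (G_A K B) \<longleftrightarrow> f \<in> auto (Herm_group K B) \<and>
    (\<forall>S\<in>Herm K B. det (f S) = det S) \<and> f ` ample_cone K B = ample_cone K B"
  by (simp add: G_A_def)

lemma G_A_Bij: "f \<in> carrier (G_A K B) \<Longrightarrow> f \<in> Bij (Herm K B)"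
  by (simp add: G_A_iff auto_def Herm_group_def)

lemma G_A_mult:
  assumes "f \<in> carrier (G_A K B)" "g \<in> carrier (G_A K B)"
  shows "f \<otimes>\<^bsub>G_A K B\<^esub> g = compose (Herm K B) f g"
  using G_A_Bij[OF assms(1)] G_A_Bij[OF assms(2)]
  by (simp add: G_A_def AutoGroup_def BijGroup_def Herm_group_def)

lemma G_A_one: "\<one>\<^bsub>G_A K B\<^esub> = (\<lambda>S\<in>Herm K B. S)"
  by (simp add: G_A_def AutoGroup_def BijGroup_def Herm_group_def)

lemma ample_Herm: "S \<in> ample_cone K B \<Longrightarrow> S \<in> Herm K B"
  by (simp add: ample_cone_def)

lemma G_A_D:
  assumes "f \<in> carrier (G_A K B)"
  shows "S \<in> Herm K B \<Longrightarrow> f S \<in> Herm K B" "S \<in> Herm K B \<Longrightarrow> det (f S) = det S"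
    "S \<in> Herm K B \<Longrightarrow> T \<in> Herm K B \<Longrightarrow> f (S + T) = f S + f T"
    "S \<in> ample_cone K B \<Longrightarrow> f S \<in> ample_cone K B"
    "f \<in> extensional (Herm K B)" "inj_on f (Herm K B)"
proof -
  have f: "f \<in> hom (Herm_group K B) (Herm_group K B)" "f \<in> Bij (Herm K B)"
    "\<forall>S\<in>Herm K B. det (f S) = det S" "f ` ample_cone K B = ample_cone K B"
    using assms G_A_Bij by (auto simp: G_A_iff auto_def)
  show "f S \<in> Herm K B" if "S \<in> Herm K B" using Bij_imp_funcset[OF f(2)] that by auto
  show "det (f S) = det S" if "S \<in> Herm K B" using f(3) that by blast
  show "f (S + T) = f S + f T" if "S \<in> Herm K B" "T \<in> Herm K B"
    using f(1) that by (simp add: hom_def Herm_group_def)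
  show "f S \<in> ample_cone K B" if "S \<in> ample_cone K B" using f(4) that by blast
  show "f \<in> extensional (Herm K B)" "inj_on f (Herm K B)" using f(2) by (auto simp: Bij_def bij_betw_def)
qed

lemma G_A_I:
  assumes F: "\<And>S. S \<in> Herm K B \<Longrightarrow> F S \<in> Herm K B" "\<And>S. S \<in> Herm K B \<Longrightarrow> F' S \<in> Herm K B"
    "\<And>S. S \<in> Herm K B \<Longrightarrow> F' (F S) = S" "\<And>S. S \<in> Herm K B \<Longrightarrow> F (F' S) = S"
    and add: "\<And>S T. S \<in> Herm K B \<Longrightarrow> T \<in> Herm K B \<Longrightarrow> F (S + T) = F S + F T"
    and det: "\<And>S. S \<in> Herm K B \<Longrightarrow> det (F S) = det S"
    and cone: "\<And>S. S \<in> ample_cone K B \<Longrightarrow> F S \<in> ample_cone K B" "\<And>S. S \<in> ample_cone K B \<Longrightarrow> F' S \<in> ample_cone K B"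
  shows "restrict F (Herm K B) \<in> carrier (G_A K B)"
proof -
  let ?f = "restrict F (Herm K B)"
  have "bij_betw F (Herm K B) (Herm K B)" by (rule bij_betwI[of _ _ _ F']) (use F in auto)
  then have "bij_betw ?f (Herm K B) (Herm K B)" by (simp add: bij_betw_cong[of "Herm K B" ?f F])
  then have "?f \<in> auto (Herm_group K B)"
    by (simp add: auto_def Bij_def hom_def Herm_group_def Herm_add add F(1))
  moreover have "?f ` ample_cone K B = ample_cone K B"
  proof (intro equalityI subsetI)
    fix S assume "S \<in> ?f ` ample_cone K B"
    then show "S \<in> ample_cone K B" using cone(1) ample_Herm by auto
  next
    fix S assume S: "S \<in> ample_cone K B"
    then have "?f (F' S) = S" using F ample_Herm by simp
    then show "S \<in> ?f ` ample_cone K B" using cone(2)[OF S] by (metis imageI)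
  qed
  ultimately show ?thesis by (simp add: G_A_iff det)
qed

lemma group_G_A: "group (G_A K B)"
proof -
  interpret A: group "AutoGroup (Herm_group K B)" by (rule group.AutoGroup[OF group_Herm])
  have carr: "carrier (AutoGroup (Herm_group K B)) = auto (Herm_group K B)" by (simp add: AutoGroup_def)
  have mult: "f \<otimes>\<^bsub>G_A K B\<^esub> g = f \<otimes>\<^bsub>AutoGroup (Herm_group K B)\<^esub> g" for f g by (simp add: G_A_def)
  have one: "\<one>\<^bsub>G_A K B\<^esub> = \<one>\<^bsub>AutoGroup (Herm_group K B)\<^esub>" by (simp add: G_A_def)
  have sub: "f \<in> carrier (G_A K B) \<Longrightarrow> f \<in> carrier (AutoGroup (Herm_group K B))" for f
    by (simp add: G_A_iff carr)
  show ?thesis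
  proof (rule groupI)
    fix f g assume f: "f \<in> carrier (G_A K B)" and g: "g \<in> carrier (G_A K B)"
    have "f \<otimes>\<^bsub>G_A K B\<^esub> g \<in> auto (Herm_group K B)"
      using A.m_closed[OF sub[OF f] sub[OF g]] unfolding mult carr .
    moreover have "compose (Herm K B) f g ` ample_cone K B = f ` g ` ample_cone K B"
      unfolding image_image by (rule image_cong) (simp_all add: compose_eq ample_Herm)
    moreover have "g ` ample_cone K B = ample_cone K B" "f ` ample_cone K B = ample_cone K B"
      using f g by (simp_all add: G_A_iff)
    ultimately show "f \<otimes>\<^bsub>G_A K B\<^esub> g \<in> carrier (G_A K B)"
      unfolding G_A_iff G_A_mult[OF f g]
      by (simp add: compose_eq G_A_D(1,2)[OF f] G_A_D(1,2)[OF g])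
  next
    show "\<one>\<^bsub>G_A K B\<^esub> \<in> carrier (G_A K B)" unfolding G_A_one by (rule G_A_I[of _ "\<lambda>S. S"]) simp_all
  next
    fix f g h assume "f \<in> carrier (G_A K B)" "g \<in> carrier (G_A K B)" "h \<in> carrier (G_A K B)"
    then show "f \<otimes>\<^bsub>G_A K B\<^esub> g \<otimes>\<^bsub>G_A K B\<^esub> h = f \<otimes>\<^bsub>G_A K B\<^esub> (g \<otimes>\<^bsub>G_A K B\<^esub> h)"
      unfolding mult using A.m_assoc sub by blast
  next
    fix f assume "f \<in> carrier (G_A K B)"
    then show "\<one>\<^bsub>G_A K B\<^esub> \<otimes>\<^bsub>G_A K B\<^esub> f = f" unfolding mult one using sub by simp
  next
    fix f assume f: "f \<in> carrier (G_A K B)"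
    define F' where "F' = inv_into (Herm K B) f"
    have bij: "bij_betw f (Herm K B) (Herm K B)" using G_A_Bij[OF f] by (simp add: Bij_def)
    have F': "F' S \<in> Herm K B" "f (F' S) = S" "F' (f S) = S" if "S \<in> Herm K B" for S
      unfolding F'_def using that bij
      by (auto simp: bij_betw_def inv_into_into f_inv_into_f)
    have im: "f ` ample_cone K B = ample_cone K B" using f by (simp add: G_A_iff)
    have g: "restrict F' (Herm K B) \<in> carrier (G_A K B)"
    proof (rule G_A_I[of _ f])
      show "F' (S + T) = F' S + F' T" if "S \<in> Herm K B" "T \<in> Herm K B" for S T
      proof (rule inj_onD[OF G_A_D(6)[OF f]])
        show "f (F' (S + T)) = f (F' S + F' T)"
          using that by (simp add: F' Herm_add G_A_D(3)[OF f])
      qed (use that F' Herm_add in auto)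
      show "det (F' S) = det S" if "S \<in> Herm K B" for S
        using G_A_D(2)[OF f F'(1)[OF that]] F'(2)[OF that] by simp
      show "F' S \<in> ample_cone K B" if "S \<in> ample_cone K B" for S
      proof -
        have "S \<in> f ` ample_cone K B" unfolding im by (rule that)
        then obtain T where T: "T \<in> ample_cone K B" "S = f T" by (elim imageE)
        show ?thesis unfolding T(2) F'(3)[OF ample_Herm[OF T(1)]] by (rule T(1))
      qed
    qed (use F' G_A_D[OF f] in auto)
    moreover have "restrict F' (Herm K B) \<otimes>\<^bsub>G_A K B\<^esub> f = \<one>\<^bsub>G_A K B\<^esub>"
      unfolding G_A_mult[OF g f] G_A_one compose_def
      by (intro restrict_ext) (simp add: G_A_D(1)[OF f] F')
    ultimately show "\<exists>g\<in>carrier (G_A K B). g \<otimes>\<^bsub>G_A K B\<^esub> f = \<one>\<^bsub>G_A K B\<^esub>" by blast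
  qed
qed

lemma Herm_coords:
  assumes "S \<in> Herm K B"
  obtains x y :: real and b where "S = mat2 (of_real x) b (cnj b * NB) (of_real y)"
    "b \<in> Binv" "of_real x \<in> \<O>" "of_real y \<in> \<O>"
proof -
  have "S $ 1 $ 1 = of_real (Re (S $ 1 $ 1))" "S $ 2 $ 2 = of_real (Re (S $ 2 $ 2))"
    using HermD(6,7)[OF assms] by (metis Reals_cnj_iff complex_is_Real_iff of_real_Re)+
  then show thesis using that[of "Re (S $ 1 $ 1)" "S $ 1 $ 2" "Re (S $ 2 $ 2)"] Herm_eta[OF assms] HermD[OF assms]
    by simp
qed

lemma det_Herm: "det (mat2 (of_real x) b (cnj b * NB) (of_real y))
    = of_real (x * y - real (ideal_norm K B) * (cmod b)\<^sup>2)"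
  by (simp add: det_2 complex_norm_square mult_ac del: of_real_power)

text \<open>A positive determinant forces the two diagonal entries to have the same sign, so the sign of
  the trace can be read off from the upper left entry.\<close>

lemma ample_iff: "S \<in> ample_cone K B \<longleftrightarrow> S \<in> Herm K B \<and> Re (S $ 1 $ 1) > 0 \<and> Re (det S) > 0"
proof (cases "S \<in> Herm K B")
  case True
  then obtain x y b where S: "S = mat2 (of_real x) b (cnj b * NB) (of_real y)" by (rule Herm_coords)
  have tr: "Re (trace S) = x + y" unfolding S by (simp add: trace_def sum_2)
  have "x + y > 0 \<longleftrightarrow> x > 0" if "Re (det S) > 0"
  proof -
    have "x * y > real (ideal_norm K B) * (cmod b)\<^sup>2" using that unfolding S det_Herm by simp
    moreover have "real (ideal_norm K B) * (cmod b)\<^sup>2 \<ge> 0" by simp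
    ultimately have "x * y > 0" by linarith
    then show ?thesis by (auto simp: zero_less_mult_iff)
  qed
  then show ?thesis unfolding ample_cone_def using True tr by (auto simp: S)
qed (simp add: ample_cone_def)

text \<open>Only the sign of the upper left entry \<open>x'\<close> of the image is at stake. Completing the square,
  \<open>x * x'\<close> is \<open>r\<close> times a sum of a norm and a nonnegative multiple of \<open>det S\<close>, so \<open>x' \<ge> 0\<close>; and \<open>x' = 0\<close>
  contradicts the positive determinant of the image.\<close>

lemma act_ample:
  assumes S: "S \<in> ample_cone K B" and r: "r > 0" and M: "det M \<noteq> 0" and H: "act r M S \<in> Herm K B"
  shows "act r M S \<in> ample_cone K B"
proof -
  obtain x y b where S': "S = mat2 (of_real x) b (cnj b * NB) (of_real y)"
    using Herm_coords ample_Herm[OF S] by metis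
  obtain x' y' b' where T: "act r M S = mat2 (of_real x') b' (cnj b' * NB) (of_real y')"
    using Herm_coords H by metis
  define n where "n = real (ideal_norm K B)"
  have n: "n > 0" by (simp add: n_def)
  have x: "x > 0" and d: "Re (det S) > 0" using S unfolding ample_iff by (simp_all add: S')
  have "Re (det (act r M S)) = (r * cmod (det M))\<^sup>2 * Re (det S)" unfolding det_act by simp
  then have d': "Re (det (act r M S)) > 0" using d r M by simp
  have "complex_of_real (x * x') = of_real r * ((of_real x * M $ 1 $ 1 + b * M $ 2 $ 1) * cnj (of_real x * M $ 1 $ 1 + b * M $ 2 $ 1)
      + det S * (M $ 2 $ 1 * cnj (M $ 2 $ 1)) / of_real n)"
  proof -
    have "of_real x' = (act r M S) $ 1 $ 1" unfolding T by simp
    also have "\<dots> = of_real r * (cnj (M $ 1 $ 1) * (of_real x * M $ 1 $ 1 + b * M $ 2 $ 1)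
      + cnj (M $ 2 $ 1) / of_real n * (cnj b * of_real n * M $ 1 $ 1 + of_real y * M $ 2 $ 1))"
      unfolding act_def S' by (simp add: mult_sel rosati_def n_def algebra_simps)
    finally have "of_real x * of_real x' = of_real x * (of_real r * (cnj (M $ 1 $ 1) * (of_real x * M $ 1 $ 1 + b * M $ 2 $ 1)
      + cnj (M $ 2 $ 1) / of_real n * (cnj b * of_real n * M $ 1 $ 1 + of_real y * M $ 2 $ 1)))" by simp
    note eq = this
    have "det S = of_real x * of_real y - b * cnj b * of_real n" unfolding S' by (simp add: det_2 n_def)
    note d = this
    show ?thesis unfolding of_real_mult eq d using n by (simp add: field_simps)
  qed
  also have "\<dots> = of_real (r * ((cmod (of_real x * M $ 1 $ 1 + b * M $ 2 $ 1))\<^sup>2 + Re (det S) * (cmod (M $ 2 $ 1))\<^sup>2 / n))"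
    unfolding complex_norm_square[symmetric] unfolding S' det_Herm by simp
  finally have "x * x' = r * ((cmod (of_real x * M $ 1 $ 1 + b * M $ 2 $ 1))\<^sup>2 + Re (det S) * (cmod (M $ 2 $ 1))\<^sup>2 / n)"
    using of_real_eq_iff by blast
  also have "\<dots> \<ge> 0" using r d n by simp
  finally have "x' \<ge> 0" using x by (simp add: zero_le_mult_iff)
  moreover have "x' \<noteq> 0"
  proof
    assume "x' = 0"
    then have "Re (det (act r M S)) \<le> 0" unfolding T det_Herm by simp
    then show False using d' by simp
  qed
  ultimately have "Re (act r M S $ 1 $ 1) > 0" unfolding T by simp
  then show ?thesis unfolding ample_iff using H d' by simp
qed

lemma similitude_in_G_A:
  assumes M: "ideal_similitude J M" and r: "r > 0" "J \<star> cnj ` J = (*) (of_real r) ` \<O>"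
  shows "restrict (act (1 / r) M) (Herm K B) \<in> carrier (G_A K B)"
proof -
  have J: "frac_ideal J" "M \<in> ideal_mats J" "det M \<noteq> 0" using M by (auto simp: ideal_similitude_def)
  have M': "ideal_similitude (ideal_inverse K J) (inv2 M)" by (rule ideal_similitude_inv[OF M])
  have J': "frac_ideal (ideal_inverse K J)" "inv2 M \<in> ideal_mats (ideal_inverse K J)" "det (inv2 M) \<noteq> 0"
    using M' by (auto simp: ideal_similitude_def)
  have r': "1 / r > 0" "ideal_inverse K J \<star> cnj ` ideal_inverse K J = (*) (of_real (1 / r)) ` \<O>"
    using r ideal_inverse_norm[OF J(1) r] by simp_all
  have H: "act (1 / r) M S \<in> Herm K B" "act r (inv2 M) S \<in> Herm K B" if "S \<in> Herm K B" for S
    using act_Herm[OF J(1) r J(2) that] act_Herm[OF J'(1) r' J'(2) that] by simp_all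
  have det: "cmod (det M) = r" by (rule ideal_similitude_norm[OF M r])
  show ?thesis
  proof (rule G_A_I[of _ "act r (inv2 M)"])
    show "act r (inv2 M) (act (1 / r) M S) = S" "act (1 / r) M (act r (inv2 M) S) = S" for S
      unfolding act_act inv2_mult[OF J(3)] using r by simp_all
    show "det (act (1 / r) M S) = det S" for S unfolding det_act det using r by simp
  qed (use H act_add act_ample ample_Herm J(3) J'(3) r(1) r'(1) in auto)
qed

definition swap :: "complex^2^2 \<Rightarrow> complex^2^2"
  where "swap S = mat2 (S $ 2 $ 2) (S $ 1 $ 2) (S $ 2 $ 1) (S $ 1 $ 1)"

lemma tau_eq: "tau K B = restrict swap (Herm K B)"
  unfolding tau_def by (rule restrict_ext) (simp add: swap_def)

lemma swap_swap [simp]: "swap (swap S) = S"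
  by (rule mat2_eqI) (simp_all add: swap_def)

lemma swap_Herm: "S \<in> Herm K B \<Longrightarrow> swap S \<in> Herm K B"
  unfolding swap_def by (simp add: HermD(8)) (rule HermI; simp add: HermD)

lemma tau_in_G_A: "tau K B \<in> carrier (G_A K B)"
proof -
  have det: "det (swap S) = det S" for S by (simp add: swap_def det_2)
  have "trace (swap S) = trace S" for S by (simp add: swap_def trace_def sum_2)
  then have "swap S \<in> ample_cone K B" if "S \<in> ample_cone K B" for S
    using that by (simp add: ample_cone_def det swap_Herm)
  moreover have "swap (S + T) = swap S + swap T" for S T by (rule mat2_eqI) (simp_all add: swap_def)
  ultimately show ?thesis unfolding tau_eq by (intro G_A_I[of _ swap]) (simp_all add: det swap_Herm)
qed

section \<open>Matrices determined by their action\<close>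

text \<open>The images of the two diagonal units make \<open>X\<close> diagonal, and the image of the off-diagonal
  element with \<open>b = 1\<close> makes the two entries equal.\<close>

lemma act_identity_scalar:
  assumes "\<And>S. S \<in> Herm K B \<Longrightarrow> act r X S = S" "r > 0"
  shows "\<exists>k. X = mat k"
proof -
  have E: "mat2 1 0 (cnj 0 * NB) 0 \<in> Herm K B" "mat2 0 0 (cnj 0 * NB) 1 \<in> Herm K B" "mat2 0 1 (cnj 1 * NB) 0 \<in> Herm K B"
    by (rule HermI; simp add: one_in_Binv)+
  have "X $ 1 $ 2 = 0" using arg_cong[OF assms(1)[OF E(1)], of "\<lambda>M. M $ 2 $ 2"] assms(2)
    by (simp add: act_def mult_sel rosati_def)
  moreover have "X $ 2 $ 1 = 0" using arg_cong[OF assms(1)[OF E(2)], of "\<lambda>M. M $ 1 $ 1"] assms(2)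
    by (simp add: act_def mult_sel rosati_def)
  moreover have "X $ 1 $ 1 = X $ 2 $ 2"
  proof -
    have 1: "of_real r * (cnj (X $ 1 $ 1) * X $ 1 $ 1) = 1"
      using arg_cong[OF assms(1)[OF E(1)], of "\<lambda>M. M $ 1 $ 1"] by (simp add: act_def mult_sel rosati_def)
    have 2: "of_real r * (cnj (X $ 1 $ 1) * X $ 2 $ 2) = 1"
      using arg_cong[OF assms(1)[OF E(3)], of "\<lambda>M. M $ 1 $ 2"] calculation by (simp add: act_def mult_sel rosati_def)
    have "of_real r * (cnj (X $ 1 $ 1) * X $ 1 $ 1) = of_real r * (cnj (X $ 1 $ 1) * X $ 2 $ 2)" unfolding 1 2 ..
    moreover have "X $ 1 $ 1 \<noteq> 0" using 1 by auto
    ultimately show ?thesis using assms(2) by simp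
  qed
  ultimately have "X = mat (X $ 1 $ 1)" by (intro mat2_eqI) simp_all
  then show ?thesis by blast
qed

lemma act_eq_scalar:
  assumes "\<And>S. S \<in> Herm K B \<Longrightarrow> act r M S = act s N S" "r > 0" "s > 0" "det N \<noteq> 0"
  shows "\<exists>k. M = mat k ** N"
proof -
  have "act (r / s) (M ** inv2 N) S = S" if "S \<in> Herm K B" for S
  proof -
    have "act (1 / s) (inv2 N) (act r M S) = act (1 / s) (inv2 N) (act s N S)" using assms(1)[OF that] by simp
    then show ?thesis unfolding act_act inv2_mult[OF assms(4)] using assms(3) by simp
  qed
  then obtain k where "M ** inv2 N = mat k" using act_identity_scalar assms(2,3) by (metis divide_pos_pos)
  then have "(M ** inv2 N) ** N = mat k ** N" by simp
  then show ?thesis unfolding matrix_mul_assoc[symmetric] inv2_mult[OF assms(4)] by auto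
qed

text \<open>If the action exchanged the diagonal entries, \<open>X\<close> would be antidiagonal and would send the
  off-diagonal entry \<open>b\<close> to a fixed multiple of \<open>cnj b\<close>. But \<open>swap\<close> fixes \<open>b = 1\<close> and \<open>b = w\<close>.\<close>

lemma act_not_swap:
  assumes "\<And>S. S \<in> Herm K B \<Longrightarrow> act r X S = swap S" "r > 0"
  shows False
proof -
  have E: "mat2 1 0 (cnj 0 * NB) 0 \<in> Herm K B" "mat2 0 0 (cnj 0 * NB) 1 \<in> Herm K B"
    "mat2 0 1 (cnj 1 * NB) 0 \<in> Herm K B" "mat2 0 w (cnj w * NB) 0 \<in> Herm K B"
    by (rule HermI; simp add: one_in_Binv)+
  have 1: "X $ 1 $ 1 = 0" using arg_cong[OF assms(1)[OF E(1)], of "\<lambda>M. M $ 1 $ 1"] assms(2)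
    by (simp add: act_def mult_sel rosati_def swap_def)
  have 2: "X $ 2 $ 2 = 0" using arg_cong[OF assms(1)[OF E(2)], of "\<lambda>M. M $ 2 $ 2"] assms(2)
    by (simp add: act_def mult_sel rosati_def swap_def)
  have 3: "of_real r * (cnj (X $ 2 $ 1) * X $ 1 $ 2) = 1"
    using arg_cong[OF assms(1)[OF E(3)], of "\<lambda>M. M $ 1 $ 2"] 1 2 by (simp add: act_def mult_sel rosati_def swap_def)
  have 4: "cnj w * (of_real r * (cnj (X $ 2 $ 1) * X $ 1 $ 2)) = w"
    using arg_cong[OF assms(1)[OF E(4)], of "\<lambda>M. M $ 1 $ 2"] 1 2
    by (simp add: act_def mult_sel rosati_def swap_def mult_ac)
  have "cnj w = w" using 4 unfolding 3 by simp
  then show False using Im_w by (simp add: complex_eq_iff)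
qed

section \<open>Isomorphisms of lattices\<close>

lemma ideal_mats_dsum:
  assumes I: "frac_ideal I" and J: "frac_ideal J" and M: "M \<in> ideal_mats I" and v: "v \<in> dsum J (J \<star> B)"
  shows "M *v v \<in> dsum (I \<star> J) (I \<star> J \<star> B)"
proof -
  have M': "M $ 1 $ 1 \<in> I" "M $ 2 $ 2 \<in> I" "M $ 1 $ 2 \<in> I \<star> Binv" "M $ 2 $ 1 \<in> I \<star> B"
    using M by (auto simp: ideal_mats_def)
  have v': "v $ 1 \<in> J" "v $ 2 \<in> J \<star> B" using v by (auto simp: dsum_def)
  have a: "I \<star> B \<star> J = I \<star> J \<star> B" "I \<star> (J \<star> B) = I \<star> J \<star> B" by (simp_all only: ideal_mult_ac)
  show ?thesis unfolding dsum_def mem_Collect_eq matrix_vector_mult_def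
    using ideal_multI[OF M'(1) v'(1)] Binv_B_cancel(1)[OF I J M'(3) v'(2)]
      ideal_multI[OF M'(4) v'(1), unfolded a] ideal_multI[OF M'(2) v'(2), unfolded a]
    by (simp add: sum_2 ideal_mult_add)
qed

lemma ideal_quotient_memI:
  assumes "frac_ideal I" "P \<star> Q = \<O>" "\<And>y. y \<in> P \<Longrightarrow> x * y \<in> I"
  shows "x \<in> I \<star> Q"
proof -
  have "P \<star> Q \<subseteq> {z. x * z \<in> I \<star> Q}"
    by (rule ideal_mult_least)
      (use ideal_multI[OF assms(3)] in \<open>auto simp: distrib_left mult.assoc[symmetric] intro: ideal_mult_add\<close>)
  then have "1 \<in> {z. x * z \<in> I \<star> Q}" unfolding assms(2) using O_zero_one(2) by blast
  then show ?thesis by simp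
qed

lemma ideal_mats_if_dsum:
  assumes I: "frac_ideal I" and J: "frac_ideal J"
    and M: "\<And>v. v \<in> dsum J (J \<star> B) \<Longrightarrow> M *v v \<in> dsum I (I \<star> B)"
  shows "M \<in> ideal_mats (I \<star> ideal_inverse K J)"
proof -
  have J': "frac_ideal (ideal_inverse K J)" "J \<star> ideal_inverse K J = \<O>" using ideal_inverse[OF J] by auto
  have IB: "frac_ideal (I \<star> B)" by (rule frac_mult[OF I frac_B])
  have 1: "M $ 1 $ 1 * y \<in> I" "M $ 2 $ 1 * y \<in> I \<star> B" if "y \<in> J" for y
    using M[of "vector [y, 0]"] that fracD(2)[OF frac_mult[OF J frac_B]]
    by (auto simp: dsum_def matrix_vector_mult_def sum_2)
  have 2: "M $ 1 $ 2 * y \<in> I" "M $ 2 $ 2 * y \<in> I \<star> B" if "y \<in> J \<star> B" for y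
    using M[of "vector [0, y]"] that fracD(2)[OF J]
    by (auto simp: dsum_def matrix_vector_mult_def sum_2)
  have "(J \<star> B) \<star> (ideal_inverse K J \<star> Binv) = (J \<star> ideal_inverse K J) \<star> (B \<star> Binv)" by (simp only: ideal_mult_ac)
  then have JB: "(J \<star> B) \<star> (ideal_inverse K J \<star> Binv) = \<O>" using J' B_Binv frac_O by simp
  have "M $ 1 $ 1 \<in> I \<star> ideal_inverse K J" by (rule ideal_quotient_memI[OF I J'(2) 1(1)])
  moreover have "M $ 2 $ 1 \<in> I \<star> ideal_inverse K J \<star> B"
    using ideal_quotient_memI[OF IB J'(2) 1(2)] by (simp only: ideal_mult_ac)
  moreover have "M $ 1 $ 2 \<in> I \<star> ideal_inverse K J \<star> Binv"
    using ideal_quotient_memI[OF I JB 2(1)] by (simp only: ideal_mult_ac)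
  moreover have "M $ 2 $ 2 \<in> I \<star> ideal_inverse K J"
  proof -
    have "M $ 2 $ 2 \<in> (I \<star> B) \<star> (ideal_inverse K J \<star> Binv)" by (rule ideal_quotient_memI[OF IB JB 2(2)])
    also have "\<dots> = (I \<star> ideal_inverse K J) \<star> (B \<star> Binv)" by (simp only: ideal_mult_ac)
    also have "\<dots> = I \<star> ideal_inverse K J" unfolding B_Binv using O_ideal_mult(2)[OF frac_mult[OF I J'(1)]] .
    finally show ?thesis .
  qed
  ultimately show ?thesis by (simp add: ideal_mats_def)
qed

lemma ideal_mats_in_K:
  assumes "frac_ideal J" "M \<in> ideal_mats J"
  shows "M $ i $ j \<in> K"
  using assms fracD(1)[OF assms(1)] fracD(1)[OF frac_mult[OF assms(1) frac_B]] fracD(1)[OF frac_mult[OF assms(1) frac_Binv]]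
  using exhaust_2[of i] exhaust_2[of j] by (auto simp: ideal_mats_def)

text \<open>If \<open>M\<close> maps \<open>\<Lambda>\<close> onto \<open>I \<Lambda>\<close>, then \<open>M\<close> lies in the matrices of \<open>I\<close> and its inverse in those of the
  inverse ideal. So \<open>det M\<close> lies in \<open>I \<star> I\<close> and its inverse in the inverse of \<open>I \<star> I\<close>, which makes it a
  generator.\<close>

lemma module_iso_iff:
  assumes "nonzero_ideal K I"
  shows "module_iso_matrix K B I M \<longleftrightarrow> ideal_similitude I M"
proof
  have I: "frac_ideal I" using nonzero_idealD(1)[OF assms] .
  have I': "frac_ideal (ideal_inverse K I)" "I \<star> ideal_inverse K I = \<O>" using ideal_inverse[OF I] by auto
  assume "module_iso_matrix K B I M"
  then have inv: "invertible M" and img: "(\<lambda>v. M *v v) ` dsum \<O> (\<O> \<star> B) = dsum I (I \<star> B)"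
    by (auto simp: module_iso_matrix_def GL2_def ideal_prod_complex_ring[of "max_order K"] frac_B)
  have det: "det M \<noteq> 0" using inv invertible_det_nz by blast
  have "M \<in> ideal_mats (I \<star> ideal_inverse K \<O>)"
    by (rule ideal_mats_if_dsum[OF I frac_O]) (use img in blast)
  moreover have "ideal_inverse K \<O> = \<O>" using ideal_inverse(1,2)[OF frac_O] by simp
  ultimately have M: "M \<in> ideal_mats I" using I by simp
  have "inv2 M \<in> ideal_mats (\<O> \<star> ideal_inverse K I)"
  proof (rule ideal_mats_if_dsum[OF frac_O I])
    fix v assume "v \<in> dsum I (I \<star> B)"
    then obtain u where "u \<in> dsum \<O> (\<O> \<star> B)" "v = M *v u" using img by blast
    then show "inv2 M *v v \<in> dsum \<O> (\<O> \<star> B)"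
      by (simp add: matrix_vector_mul_assoc inv2_mult[OF det])
  qed
  then have N: "inv2 M \<in> ideal_mats (ideal_inverse K I)" using I' by simp
  have detM: "det M \<in> I \<star> I" by (rule ideal_mats_det[OF I M])
  have detN: "det (inv2 M) \<in> ideal_inverse K I \<star> ideal_inverse K I" by (rule ideal_mats_det[OF I'(1) N])
  have "det (inv2 M) * det M = 1" unfolding det_mul[symmetric] inv2_mult[OF det] by simp
  then have dd: "det M * (x * det (inv2 M)) = x" for x by (simp add: mult_ac)
  have "I \<star> I \<star> (ideal_inverse K I \<star> ideal_inverse K I) = (I \<star> ideal_inverse K I) \<star> (I \<star> ideal_inverse K I)"
    by (simp only: ideal_mult_ac)
  then have OO: "I \<star> I \<star> (ideal_inverse K I \<star> ideal_inverse K I) = \<O>" using I'(2) frac_O by simp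
  have "I \<star> I = (*) (det M) ` \<O>"
  proof (intro equalityI subsetI)
    fix x assume "x \<in> I \<star> I"
    then have "x * det (inv2 M) \<in> \<O>" using ideal_multI[OF _ detN] OO by blast
    then show "x \<in> (*) (det M) ` \<O>" using dd by (metis imageI)
  next
    fix x assume "x \<in> (*) (det M) ` \<O>"
    then show "x \<in> I \<star> I" using fracD(4)[OF frac_mult[OF I I] _ detM] by (auto simp: mult.commute)
  qed
  then show "ideal_similitude I M" using I M det by (simp add: ideal_similitude_def)
next
  have I: "frac_ideal I" using nonzero_idealD(1)[OF assms] .
  have I': "frac_ideal (ideal_inverse K I)" "I \<star> ideal_inverse K I = \<O>" using ideal_inverse[OF I] by auto
  assume M: "ideal_similitude I M"
  then have M': "M \<in> ideal_mats I" "det M \<noteq> 0" by (auto simp: ideal_similitude_def)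
  have N: "inv2 M \<in> ideal_mats (ideal_inverse K I)"
    using ideal_similitude_inv[OF M] by (auto simp: ideal_similitude_def)
  have "(\<lambda>v. M *v v) ` dsum \<O> (\<O> \<star> B) = dsum I (I \<star> B)"
  proof (intro equalityI subsetI)
    fix v assume "v \<in> (\<lambda>v. M *v v) ` dsum \<O> (\<O> \<star> B)"
    then show "v \<in> dsum I (I \<star> B)" using ideal_mats_dsum[OF I frac_O M'(1)] I by auto
  next
    fix v assume "v \<in> dsum I (I \<star> B)"
    then have "inv2 M *v v \<in> dsum \<O> (\<O> \<star> B)"
      using ideal_mats_dsum[OF I'(1) I N] I'(2) by (simp add: ideal_mult_comm[of "ideal_inverse K I"])
    moreover have "v = M *v (inv2 M *v v)" by (simp add: matrix_vector_mul_assoc inv2_mult[OF M'(2)])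
    ultimately show "v \<in> (\<lambda>v. M *v v) ` dsum \<O> (\<O> \<star> B)" by blast
  qed
  then show "module_iso_matrix K B I M"
    using M' ideal_mats_in_K[OF I M'(1)] invertible_det_nz[of M]
    by (simp add: module_iso_matrix_def GL2_def ideal_prod_complex_ring[of "max_order K"] frac_B)
qed


section \<open>Isometries come from matrices over the field\<close>

definition det_pairing :: "complex^2^2 \<Rightarrow> complex^2^2 \<Rightarrow> complex"
  where "det_pairing S T = det (S + T) - det S - det T"

lemma det_pairing_eq:
  "det_pairing S T = S $ 1 $ 1 * T $ 2 $ 2 + S $ 2 $ 2 * T $ 1 $ 1 - S $ 1 $ 2 * T $ 2 $ 1 - S $ 2 $ 1 * T $ 1 $ 2"
  by (simp add: det_pairing_def det_2 algebra_simps)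

lemma det_pairing_act:
  "det_pairing (act r M S) (act r M T) = of_real ((r * cmod (det M))\<^sup>2) * det_pairing S T"
  unfolding det_pairing_def act_add[symmetric] det_act by (simp add: algebra_simps)

definition herm :: "complex \<Rightarrow> complex \<Rightarrow> complex \<Rightarrow> complex^2^2"
  where "herm x b y = mat2 x b (cnj b * NB) y"

lemma herm_sel [simp]: "herm x b y $ 1 $ 1 = x" "herm x b y $ 1 $ 2 = b" "herm x b y $ 2 $ 1 = cnj b * NB" "herm x b y $ 2 $ 2 = y"
  by (simp_all add: herm_def)

lemma herm_Herm: "x \<in> \<O> \<Longrightarrow> cnj x = x \<Longrightarrow> y \<in> \<O> \<Longrightarrow> cnj y = y \<Longrightarrow> b \<in> Binv \<Longrightarrow> herm x b y \<in> Herm K B"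
  unfolding herm_def by (rule HermI)

lemma basis_Herm: "herm 1 0 0 \<in> Herm K B" "herm 0 0 1 \<in> Herm K B" "herm 0 1 0 \<in> Herm K B" "herm 0 w 0 \<in> Herm K B"
  by (rule herm_Herm; simp add: one_in_Binv)+

lemma dag_eq_iff: "dag S = S \<longleftrightarrow> cnj (S $ 1 $ 1) = S $ 1 $ 1 \<and> cnj (S $ 2 $ 2) = S $ 2 $ 2 \<and> S $ 2 $ 1 = cnj (S $ 1 $ 2) * NB"
proof
  assume e: "dag S = S"
  show "cnj (S $ 1 $ 1) = S $ 1 $ 1 \<and> cnj (S $ 2 $ 2) = S $ 2 $ 2 \<and> S $ 2 $ 1 = cnj (S $ 1 $ 2) * NB"
    using arg_cong[OF e, of "\<lambda>M. M $ 1 $ 1"] arg_cong[OF e, of "\<lambda>M. M $ 2 $ 2"]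
      arg_cong[OF e, of "\<lambda>M. M $ 2 $ 1"] by (simp add: rosati_def)
qed (auto intro!: mat2_eqI simp: rosati_def)

lemma dag_act: "dag S = S \<Longrightarrow> dag (act r M S) = act r M S"
  by (simp add: act_def dag_scaleR dag_mult matrix_mul_assoc)

lemma pairing_determines:
  assumes "dag S = S" "dag T = T"
    and "\<And>E. E \<in> {herm 1 0 0, herm 0 0 1, herm 0 1 0, herm 0 w 0} \<Longrightarrow> det_pairing S E = det_pairing T E"
  shows "S = T"
proof -
  have 1: "S $ 1 $ 1 = T $ 1 $ 1" "S $ 2 $ 2 = T $ 2 $ 2"
    using assms(3)[of "herm 0 0 1"] assms(3)[of "herm 1 0 0"] by (simp_all add: det_pairing_eq)
  define z where "z = S $ 1 $ 2 - T $ 1 $ 2"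
  have S21: "S $ 2 $ 1 = cnj (S $ 1 $ 2) * NB" "T $ 2 $ 1 = cnj (T $ 1 $ 2) * NB"
    using assms(1,2) unfolding dag_eq_iff by auto
  have "NB * (z + cnj z) = 0"
    using assms(3)[of "herm 0 1 0"] by (simp add: det_pairing_eq S21 z_def algebra_simps)
  then have "z + cnj z = 0" by simp
  then have re: "Re z = 0" by (simp add: complex_add_cnj)
  have "NB * (z * cnj w + cnj z * w) = 0"
    using assms(3)[of "herm 0 w 0"] by (simp add: det_pairing_eq S21 z_def algebra_simps)
  then have "z * cnj w + cnj z * w = 0" by simp
  then have "Re (z * cnj w + cnj z * w) = 0" by simp
  then have "Im z = 0" using re Im_w by simp
  then have "z = 0" using re by (simp add: complex_eq_iff)
  then have "S $ 1 $ 2 = T $ 1 $ 2" by (simp add: z_def)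
  then show ?thesis using 1 S21 by (intro mat2_eqI) simp_all
qed

text \<open>An isometry is determined by its values on a basis: pulling \<open>h S\<close> back by the action of \<open>M\<close>
  gives a matrix with the same pairings with the basis as \<open>S\<close>, and the pairing is nondegenerate.\<close>

lemma isometry_eq_act:
  assumes h: "\<And>S. S \<in> Herm K B \<Longrightarrow> dag (h S) = h S"
    and pair: "\<And>S T. S \<in> Herm K B \<Longrightarrow> T \<in> Herm K B \<Longrightarrow> det_pairing (h S) (h T) = det_pairing S T"
    and M: "r > 0" "det M \<noteq> 0"
    and eq: "\<And>E. E \<in> {herm 1 0 0, herm 0 0 1, herm 0 1 0, herm 0 w 0} \<Longrightarrow> h E = act r M E"
    and S: "S \<in> Herm K B"
  shows "h S = act r M S"
proof -
  let ?E = "{herm 1 0 0, herm 0 0 1, herm 0 1 0, herm 0 w 0}"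
  have "det_pairing (act r M (herm 1 0 0)) (act r M (herm 0 0 1)) = det_pairing (herm 1 0 0) (herm 0 0 1)"
    using pair[OF basis_Herm(1,2)] eq by simp
  then have "complex_of_real ((r * cmod (det M))\<^sup>2) = 1"
    unfolding det_pairing_act by (simp add: det_pairing_eq del: of_real_power of_real_mult)
  then have one: "(r * cmod (det M))\<^sup>2 = 1" using of_real_eq_1_iff by blast
  define U where "U = act (1 / r) (inv2 M) (h S)"
  have U: "act r M U = h S" unfolding U_def act_act inv2_mult[OF M(2)] using M(1) by simp
  have "U = S"
  proof (rule pairing_determines)
    show "dag U = U" unfolding U_def by (rule dag_act[OF h[OF S]])
    show "dag S = S" by (rule HermD(2)[OF S])
    fix E assume E: "E \<in> ?E"
    then have EH: "E \<in> Herm K B" using basis_Herm by auto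
    have "det_pairing S E = det_pairing (h S) (h E)" using pair[OF S EH] by simp
    also have "\<dots> = det_pairing (act r M U) (act r M E)" unfolding U eq[OF E] ..
    also have "\<dots> = det_pairing U E" unfolding det_pairing_act one by simp
    finally show "det_pairing U E = det_pairing S E" ..
  qed
  then show ?thesis using U by simp
qed

lemma G_A_pairing:
  assumes "f \<in> carrier (G_A K B)" "S \<in> Herm K B" "T \<in> Herm K B"
  shows "det_pairing (f S) (f T) = det_pairing S T"
  unfolding det_pairing_def using G_A_D(2)[OF assms(1)] G_A_D(3)[OF assms(1), symmetric] assms(2,3) Herm_add by simp

text \<open>An element \<open>S\<close> with \<open>m * S + T\<close> ample for all \<open>m > 0\<close> is a limit of the ample elements
  \<open>S + T / m\<close>, so its image is a limit of ample elements too.\<close>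

lemma G_A_boundary_nonneg:
  assumes f: "f \<in> carrier (G_A K B)" and S: "S \<in> Herm K B" and T: "T \<in> Herm K B"
    and ample: "\<And>m::nat. m > 0 \<Longrightarrow> real m *\<^sub>R S + T \<in> ample_cone K B"
  shows "Re (f S $ 1 $ 1) \<ge> 0" "Re (f S $ 2 $ 2) \<ge> 0"
proof -
  have "real m *\<^sub>R S + T \<in> Herm K B \<and> f (real m *\<^sub>R S + T) = real m *\<^sub>R f S + f T" for m :: nat
  proof (induction m)
    case (Suc m)
    have e: "real (Suc m) *\<^sub>R S + T = (real m *\<^sub>R S + T) + S"
      "real (Suc m) *\<^sub>R f S + f T = (real m *\<^sub>R f S + f T) + f S" by (simp_all add: algebra_simps)
    show ?case unfolding e using Suc G_A_D(3)[OF f _ S, of "real m *\<^sub>R S + T"] Herm_add[OF _ S, of "real m *\<^sub>R S + T"]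
      by simp
  qed (use T in simp)
  then have fm: "f (real m *\<^sub>R S + T) = real m *\<^sub>R f S + f T" for m by blast
  have pos: "Re (P $ 1 $ 1) > 0 \<and> Re (P $ 2 $ 2) > 0" if P: "P \<in> ample_cone K B" for P
  proof -
    obtain x y b where PH: "P = mat2 (of_real x) b (cnj b * NB) (of_real y)" using Herm_coords[OF ample_Herm[OF P]] by metis
    have "x > 0" "x * y - real (ideal_norm K B) * (cmod b)\<^sup>2 > 0"
      using P unfolding ample_iff PH det_Herm by simp_all
    moreover have "real (ideal_norm K B) * (cmod b)\<^sup>2 \<ge> 0" by simp
    ultimately have "x * y > 0" by linarith
    then show ?thesis using \<open>x > 0\<close> unfolding PH by (simp add: zero_less_mult_iff)
  qed
  have "real m * Re (f S $ 1 $ 1) + Re (f T $ 1 $ 1) > 0 \<and> real m * Re (f S $ 2 $ 2) + Re (f T $ 2 $ 2) > 0" if "m > 0" for m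
    using pos[OF G_A_D(4)[OF f ample[OF that]]] unfolding fm by simp
  note m = this
  have arch: "a \<ge> 0" if "\<And>m::nat. m > 0 \<Longrightarrow> real m * a + b > 0" for a b :: real
  proof (rule ccontr)
    assume "\<not> a \<ge> 0"
    obtain m :: nat where mm: "real m > \<bar>b\<bar> / (- a)" using reals_Archimedean2 by blast
    moreover have "\<bar>b\<bar> / (- a) \<ge> 0" using \<open>\<not> a \<ge> 0\<close> by (intro divide_nonneg_pos) auto
    ultimately have "real m > 0" by linarith
    then have "real m * a + b > 0" using that by simp
    moreover have "real m * (- a) > \<bar>b\<bar>" using mm \<open>\<not> a \<ge> 0\<close> by (simp add: field_simps)
    ultimately show False by simp
  qed
  show "Re (f S $ 1 $ 1) \<ge> 0" using arch m by blast
  show "Re (f S $ 2 $ 2) \<ge> 0" using arch m by blast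
qed

text \<open>A nonzero isotropic matrix in the closure of the cone has rank one, so it is a positive
  multiple of \<open>v\<^sup>\<dagger> v\<close> for a row vector \<open>v = (p, u)\<close>; if the first diagonal entry vanishes, \<open>v = (0, 1)\<close>.\<close>

lemma isotropic_rank_one:
  assumes A: "A \<in> Herm K B" and "det A = 0" "A \<noteq> 0" "Re (A $ 1 $ 1) \<ge> 0" "Re (A $ 2 $ 2) \<ge> 0"
  shows "\<exists>r p u. r > 0 \<and> of_real r \<in> K \<and> p \<in> K \<and> u \<in> K \<and>
    A = r *\<^sub>R mat2 (cnj p * p) (cnj p * u) (cnj u * NB * p) (cnj u * NB * u)"
proof -
  obtain x y b where A': "A = mat2 (of_real x) b (cnj b * NB) (of_real y)" and b: "b \<in> Binv" "of_real x \<in> \<O>" "of_real y \<in> \<O>"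
    using Herm_coords[OF A] by metis
  have K: "b \<in> K" "of_real x \<in> K" "of_real y \<in> K" using b fracD(1)[OF frac_Binv] O_subset_K by auto
  have xy: "x * y = real (ideal_norm K B) * (cmod b)\<^sup>2"
    using assms(2) unfolding A' det_Herm of_real_eq_0_iff by simp
  have pos: "x \<ge> 0" "y \<ge> 0" using assms(4,5) by (simp_all add: A')
  show ?thesis
  proof (cases "x = 0")
    case False
    have "complex_of_real x * of_real y = NB * (b * cnj b)"
      using arg_cong[OF xy, of complex_of_real] by (simp add: complex_norm_square del: of_real_power)
    then have "A = x *\<^sub>R mat2 (cnj 1 * 1) (cnj 1 * (b / of_real x)) (cnj (b / of_real x) * NB * 1) (cnj (b / of_real x) * NB * (b / of_real x))"
      using False unfolding A' by (intro mat2_eqI) (simp_all add: field_simps)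
    then show ?thesis using False pos K by (intro exI[of _ x] exI[of _ 1] exI[of _ "b / of_real x"]) simp
  next
    case True
    then have b0: "b = 0" using xy by simp
    then have "y \<noteq> 0" using assms(3) True unfolding A' by (auto intro!: mat2_eqI)
    define r where "r = y / real (ideal_norm K B)"
    have "A = r *\<^sub>R mat2 (cnj 0 * 0) (cnj 0 * 1) (cnj 1 * NB * 0) (cnj 1 * NB * 1)"
      unfolding A' b0 True r_def by (rule mat2_eqI) simp_all
    moreover have "r > 0" "of_real r \<in> K" using pos \<open>y \<noteq> 0\<close> K by (simp_all add: r_def)
    ultimately show ?thesis by (intro exI[of _ r] exI[of _ 0] exI[of _ 1]) simp
  qed
qed

lemma act_basis:
  "act r M (herm 1 0 0) = r *\<^sub>R mat2 (cnj (M $ 1 $ 1) * M $ 1 $ 1) (cnj (M $ 1 $ 1) * M $ 1 $ 2)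
    (cnj (M $ 1 $ 2) * NB * M $ 1 $ 1) (cnj (M $ 1 $ 2) * NB * M $ 1 $ 2)"
  "act (r * real (ideal_norm K B)) M (herm 0 0 1) = r *\<^sub>R mat2 (cnj (M $ 2 $ 1) * M $ 2 $ 1) (cnj (M $ 2 $ 1) * M $ 2 $ 2)
    (cnj (M $ 2 $ 2) * NB * M $ 2 $ 1) (cnj (M $ 2 $ 2) * NB * M $ 2 $ 2)"
  by (rule mat2_eqI; simp add: act_def mult_sel rosati_def)+

definition cnj_mat :: "complex^2^2 \<Rightarrow> complex^2^2"
  where "cnj_mat M = mat2 (cnj (M $ 1 $ 1)) (cnj (M $ 1 $ 2)) (cnj (M $ 2 $ 1)) (cnj (M $ 2 $ 2))"

text \<open>Complex conjugation of the entries followed by \<open>swap\<close> preserves the orientation, so it is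
  itself the action of a matrix, namely of the antidiagonal one appearing here.\<close>

lemma swap_act_cnj:
  assumes "dag S = S"
  shows "swap (act r M (cnj_mat S)) = act (r / real (ideal_norm K B)) (cnj_mat M ** mat2 0 1 NB 0) S"
proof -
  have "act r M (cnj_mat S) = cnj_mat (act r (cnj_mat M) S)"
    by (rule mat2_eqI) (simp_all add: act_def mult_sel rosati_def cnj_mat_def)
  moreover have "swap (cnj_mat T) = act (1 / real (ideal_norm K B)) (mat2 0 1 NB 0) T" if "dag T = T" for T
    using that unfolding dag_eq_iff by (intro mat2_eqI) (simp_all add: act_def mult_sel rosati_def cnj_mat_def swap_def)
  ultimately show ?thesis using dag_act[OF assms] by (simp add: act_act)
qed

lemma det_pairing_swap: "det_pairing (swap S) (swap T) = det_pairing S T"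
  by (simp add: det_pairing_eq swap_def)

lemma inv2_in_K:
  assumes "\<And>i j. M $ i $ j \<in> K"
  shows "inv2 M $ i $ j \<in> K"
proof -
  have "det M \<in> K" unfolding det_2 using assms by simp
  then show ?thesis unfolding inv2_def mult_sel using assms exhaust_2[of i] exhaust_2[of j] by (auto simp: adj2_def)
qed

lemma eq_or_eq_cnj:
  assumes "Re v = Re z" "(cmod v)\<^sup>2 = (cmod z)\<^sup>2"
  shows "v = z \<or> v = cnj z"
proof -
  have "(Im v)\<^sup>2 = (Im z)\<^sup>2" using assms unfolding cmod_power2 by simp
  then have "Im v = Im z \<or> Im v = - Im z" by (simp add: power2_eq_iff)
  then show ?thesis using assms(1) by (auto simp: complex_eq_iff)
qed

text \<open>The two diagonal units \<open>E\<^sub>1\<close> and \<open>E\<^sub>2\<close> are isotropic, so their images are multiples of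
  \<open>v\<^sup>\<dagger> v\<close> for two row vectors over \<open>K\<close>. Let \<open>M\<^sub>0\<close> have these rows. Undoing the action of \<open>M\<^sub>0\<close> leaves an
  isometry \<open>g\<close> (up to the factor \<open>d\<close>) that rescales \<open>E\<^sub>1\<close> and \<open>E\<^sub>2\<close>. It therefore acts on their orthogonal
  complement, the plane of the entries \<open>b\<close> with the norm form, by a map \<open>\<phi>\<close>. Such a map is
  \<open>b \<mapsto> u * b\<close>, which comes from a diagonal matrix, or \<open>b \<mapsto> u * cnj b\<close>, which does so after composing
  with \<open>swap\<close>.\<close>

lemma isometry_eq_act_or_swap_act:
  assumes f: "f \<in> carrier (G_A K B)"
  shows "\<exists>r M. r > 0 \<and> of_real r \<in> K \<and> (\<forall>i j. M $ i $ j \<in> K) \<and> det M \<noteq> 0 \<and>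
    ((\<forall>S\<in>Herm K B. f S = act r M S) \<or> (\<forall>S\<in>Herm K B. swap (f S) = act r M S))"
proof -
  define n where "n = real (ideal_norm K B)"
  have n: "n > 0" and NBn: "NB = of_real n" by (simp_all add: n_def)
  let ?E1 = "herm 1 0 0" and ?E2 = "herm 0 0 1" and ?T = "\<lambda>b. herm 0 b 0"
  note fH = G_A_D(1)[OF f] and fp = G_A_pairing[OF f]
  have ampleI: "herm x 0 y \<in> ample_cone K B" if "x \<in> \<O>" "y \<in> \<O>" "cnj x = x" "cnj y = y" "Re x > 0" "Re y > 0" for x y
    unfolding ample_iff using that herm_Herm[of x y 0] fracD(2)[OF frac_Binv]
    by (auto simp: det_2 complex_eq_iff)
  have "real m *\<^sub>R ?E1 + ?E2 = herm (of_nat m) 0 1" "real m *\<^sub>R ?E2 + ?E1 = herm 1 0 (of_nat m)" for m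
    by (rule mat2_eqI; simp)+
  then have am: "real m *\<^sub>R ?E1 + ?E2 \<in> ample_cone K B" "real m *\<^sub>R ?E2 + ?E1 \<in> ample_cone K B" if "m > 0" for m
    using that by (auto intro!: ampleI)
  have p12: "det_pairing (f ?E1) (f ?E2) = 1" unfolding fp[OF basis_Herm(1,2)] by (simp add: det_pairing_eq)
  have "f ?E1 \<noteq> 0" "f ?E2 \<noteq> 0" using p12 by (auto simp: det_pairing_eq)
  moreover have "det (f ?E1) = 0" "det (f ?E2) = 0"
    unfolding G_A_D(2)[OF f basis_Herm(1)] G_A_D(2)[OF f basis_Herm(2)] by (simp_all add: det_2)
  ultimately obtain r1 p1 u1 r2 p2 u2 where
    r1: "r1 > 0" "of_real r1 \<in> K" "p1 \<in> K" "u1 \<in> K"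
      "f ?E1 = r1 *\<^sub>R mat2 (cnj p1 * p1) (cnj p1 * u1) (cnj u1 * NB * p1) (cnj u1 * NB * u1)" and
    r2: "r2 > 0" "of_real r2 \<in> K" "p2 \<in> K" "u2 \<in> K"
      "f ?E2 = r2 *\<^sub>R mat2 (cnj p2 * p2) (cnj p2 * u2) (cnj u2 * NB * p2) (cnj u2 * NB * u2)"
    using isotropic_rank_one[OF fH[OF basis_Herm(1)]] isotropic_rank_one[OF fH[OF basis_Herm(2)]]
      G_A_boundary_nonneg[OF f basis_Herm(1,2) am(1)] G_A_boundary_nonneg[OF f basis_Herm(2,1) am(2)] by metis
  define M0 where "M0 = mat2 p1 u1 p2 u2"
  have f1: "f ?E1 = act r1 M0 ?E1" unfolding r1(5) act_basis M0_def by simp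
  have f2: "f ?E2 = act (r2 * n) M0 ?E2" unfolding r2(5) n_def act_basis M0_def by simp
  have M0K: "M0 $ i $ j \<in> K" for i j using exhaust_2[of i] exhaust_2[of j] r1 r2 by (auto simp: M0_def)
  have "det_pairing (f ?E1) (f ?E2) = of_real (r1 * r2 * n) * (det M0 * cnj (det M0))"
    unfolding r1(5) r2(5) by (simp add: det_pairing_eq det_2 M0_def n_def algebra_simps)
  then have dM0: "of_real (r1 * r2 * n) * (det M0 * cnj (det M0)) = 1" unfolding p12 by simp
  then have det0: "det M0 \<noteq> 0" by auto
  define N where "N = inv2 M0"
  note MN = inv2_mult[OF det0, folded N_def]
  define d where "d = (cmod (det N))\<^sup>2"
  have "det N * det M0 = 1" unfolding det_mul[symmetric] MN by simp
  then have "(det N * cnj (det N)) * (det M0 * cnj (det M0)) = 1" by (simp add: algebra_simps) (metis complex_cnj_mult complex_cnj_one mult.left_commute mult.right_neutral)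
  then have "of_real d * (of_real (r1 * r2 * n) * (det M0 * cnj (det M0))) = complex_of_real (r1 * r2 * n)"
    unfolding d_def complex_norm_square by (simp add: mult_ac)
  then have "complex_of_real d = complex_of_real (r1 * r2 * n)" unfolding dM0 by simp
  then have d: "d = r1 * r2 * n" using of_real_eq_iff by blast
  have d0: "d > 0" unfolding d using r1 r2 n by simp
  define g where "g = (\<lambda>S. act 1 N (f S))"
  have f_g: "f S = act 1 M0 (g S)" for S unfolding g_def act_act MN by simp
  have g_pair: "det_pairing (g S) (g T) = of_real d * det_pairing S T" if "S \<in> Herm K B" "T \<in> Herm K B" for S T
    unfolding g_def det_pairing_act fp[OF that] d_def by simp
  have g1: "g ?E1 = r1 *\<^sub>R ?E1" unfolding g_def f1 act_act MN by (simp add: act_def)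
  have g2: "g ?E2 = (r2 * n) *\<^sub>R ?E2" unfolding g_def f2 act_act MN by (simp add: act_def)
  have g_dag: "dag (g S) = g S" if "S \<in> Herm K B" for S
    unfolding g_def by (rule dag_act[OF HermD(2)[OF fH[OF that]]])
  define phi where "phi = (\<lambda>b. g (?T b) $ 1 $ 2)"
  have gT: "g (?T b) = herm 0 (phi b) 0" if b: "?T b \<in> Herm K B" for b
  proof (rule mat2_eqI)
    have "det_pairing (g (?T b)) (g ?E1) = 0" "det_pairing (g (?T b)) (g ?E2) = 0"
      unfolding g_pair[OF b basis_Herm(1)] g_pair[OF b basis_Herm(2)] by (simp_all add: det_pairing_eq)
    then show "g (?T b) $ 1 $ 1 = herm 0 (phi b) 0 $ 1 $ 1" "g (?T b) $ 2 $ 2 = herm 0 (phi b) 0 $ 2 $ 2"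
      unfolding g1 g2 using r1(1) r2(1) n by (simp_all add: det_pairing_eq)
  qed (use g_dag[OF b] in \<open>simp_all add: phi_def dag_eq_iff\<close>)
  have phi_pair: "Re (phi b * cnj (phi c)) = d * Re (b * cnj c)" if "?T b \<in> Herm K B" "?T c \<in> Herm K B" for b c
  proof -
    have "NB * (phi b * cnj (phi c) + cnj (phi b * cnj (phi c))) = NB * (of_real d * (b * cnj c + cnj (b * cnj c)))"
      using g_pair[OF that] unfolding gT[OF that(1)] gT[OF that(2)] by (simp add: det_pairing_eq algebra_simps)
    then have "phi b * cnj (phi c) + cnj (phi b * cnj (phi c)) = of_real d * (b * cnj c + cnj (b * cnj c))" by simp
    then have "complex_of_real (2 * Re (phi b * cnj (phi c))) = complex_of_real (d * (2 * Re (b * cnj c)))"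
      unfolding complex_add_cnj by simp
    then show ?thesis unfolding of_real_eq_iff mult.left_commute[of d 2] by (simp only: mult_cancel_left) simp
  qed
  define u where "u = phi 1"
  have uu: "(cmod u)\<^sup>2 = d"
    using phi_pair[OF basis_Herm(3,3)] unfolding u_def cmod_power2 by (simp add: power2_eq_square)
  have u0: "u \<noteq> 0" using uu d0 by auto
  have uu': "u * cnj u = of_real d" unfolding complex_norm_square[symmetric] uu ..
  have "Re (phi w / u) = Re w"
  proof -
    have "phi w / u = phi w * cnj u / of_real d" unfolding uu'[symmetric] using u0 by simp
    then have "Re (phi w / u) = Re (phi w * cnj u) / d" by simp
    then show ?thesis using phi_pair[OF basis_Herm(4,3)] d0 unfolding u_def by simp
  qed
  moreover have "(cmod (phi w / u))\<^sup>2 = (cmod w)\<^sup>2"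
  proof -
    have "(cmod (phi w))\<^sup>2 = d * (cmod w)\<^sup>2"
      using phi_pair[OF basis_Herm(4,4)] unfolding cmod_power2 by (simp add: power2_eq_square)
    then show ?thesis using uu d0 by (simp add: norm_divide power_divide)
  qed
  ultimately have "phi w / u = w \<or> phi w / u = cnj w" by (rule eq_or_eq_cnj)
  then have cases: "phi w = u * w \<or> phi w = u * cnj w" using u0 by (auto simp: field_simps)
  \<comment> \<open>This factor makes the action of \<open>diag(1, c)\<close> with multiplier \<open>r1\<close> agree with \<open>g\<close> on \<open>E\<^sub>1\<close>, \<open>E\<^sub>2\<close> and \<open>b = 1\<close>.\<close>
  define c where "c = u / of_real r1"
  have c0: "c \<noteq> 0" using u0 r1(1) by (simp add: c_def)
  define M where "M = mat2 1 0 0 c ** M0"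
  have detM: "det M \<noteq> 0" unfolding M_def det_mul using c0 det0 by (simp add: det_2)
  have NK: "N $ i $ j \<in> K" for i j unfolding N_def by (rule inv2_in_K[OF M0K])
  have "f (?T 1) $ i $ j \<in> K" for i j
    by (rule ideal_mats_in_K[OF frac_O HermD(1)[OF fH[OF basis_Herm(3)]]])
  then have "u \<in> K" unfolding u_def phi_def g_def act_def using NK by (simp add: mult_sel rosati_def)
  then have cK: "c \<in> K" using r1(2) by (simp add: c_def)
  have MK: "M $ i $ j \<in> K" for i j
    unfolding M_def mult_sel using M0K cK exhaust_2[of i] exhaust_2[of j] by auto
  have diag: "act r1 M S = act 1 M0 (act r1 (mat2 1 0 0 c) S)" for S unfolding act_act M_def by simp
  have rc: "complex_of_real r1 * (cnj c * c) = of_real (r2 * n)"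
  proof -
    have "of_real r1 * (cnj c * c) = (u * cnj u) / of_real r1" using r1(1) by (simp add: c_def field_simps)
    also have "\<dots> = of_real (r2 * n)" unfolding uu' d using r1(1) by simp
    finally show ?thesis .
  qed
  have a1: "act r1 (mat2 1 0 0 c) ?E1 = g ?E1" unfolding g1
    by (rule mat2_eqI) (simp_all add: act_def mult_sel rosati_def)
  have a2: "act r1 (mat2 1 0 0 c) ?E2 = g ?E2" unfolding g2
    by (rule mat2_eqI) (use rc in \<open>simp_all add: act_def mult_sel rosati_def\<close>)
  have aT: "act r1 (mat2 1 0 0 c) (?T b) = herm 0 (u * b) 0" for b
    by (rule mat2_eqI) (use r1(1) in \<open>simp_all add: act_def mult_sel rosati_def c_def\<close>)
  have a3: "act r1 (mat2 1 0 0 c) (?T 1) = g (?T 1)" unfolding aT gT[OF basis_Herm(3)] u_def by simp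
  show ?thesis
  proof (cases "phi w = u * w")
    case True
    have a4: "act r1 (mat2 1 0 0 c) (?T w) = g (?T w)" unfolding aT gT[OF basis_Herm(4)] True ..
    have "f S = act r1 M S" if "S \<in> Herm K B" for S
    proof (rule isometry_eq_act[OF _ fp r1(1) detM _ that])
      show "f E = act r1 M E" if "E \<in> {?E1, ?E2, ?T 1, ?T w}" for E
        using that a1 a2 a3 a4 unfolding diag f_g by auto
    qed (use HermD(2)[OF fH] in auto)
    then show ?thesis using r1 MK detM by (intro exI[of _ r1] exI[of _ M]) simp
  next
    case False
    then have w': "phi w = u * cnj w" using cases by blast
    let ?M' = "cnj_mat M ** mat2 0 1 NB 0"
    have cE: "cnj_mat ?E1 = ?E1" "cnj_mat ?E2 = ?E2" "cnj_mat (?T 1) = ?T 1" "cnj_mat (?T w) = ?T (cnj w)"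
      by (rule mat2_eqI; simp add: cnj_mat_def)+
    have a4: "act r1 (mat2 1 0 0 c) (?T (cnj w)) = g (?T w)" unfolding aT gT[OF basis_Herm(4)] w' ..
    have detM': "det ?M' \<noteq> 0"
    proof -
      have 1: "det (cnj_mat M) = cnj (det M)" by (simp add: det_2 cnj_mat_def)
      have 2: "det (mat2 0 1 NB 0) = - NB" by (simp add: det_2)
      show ?thesis unfolding det_mul 1 2 using detM by simp
    qed
    have r': "r1 / n > 0" using r1 n by simp
    have "swap (f S) = act (r1 / n) ?M' S" if "S \<in> Herm K B" for S
    proof (rule isometry_eq_act[of "\<lambda>S. swap (f S)", OF _ _ r' detM' _ that])
      show "dag (swap (f S)) = swap (f S)" if "S \<in> Herm K B" for S by (rule HermD(2)[OF swap_Herm[OF fH[OF that]]])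
      show "det_pairing (swap (f S)) (swap (f T)) = det_pairing S T" if "S \<in> Herm K B" "T \<in> Herm K B" for S T
        unfolding det_pairing_swap by (rule fp[OF that])
      fix E assume E: "E \<in> {?E1, ?E2, ?T 1, ?T w}"
      then have "f E = act r1 M (cnj_mat E)" using a1 a2 a3 a4 unfolding diag f_g by (auto simp: cE)
      moreover have "dag E = E" using E HermD(2) basis_Herm by auto
      ultimately show "swap (f E) = act (r1 / n) ?M' E" using swap_act_cnj[of E r1 M] by (simp add: n_def)
    qed
    moreover have "?M' $ i $ j \<in> K" for i j
      unfolding mult_sel using MK exhaust_2[of i] exhaust_2[of j] by (auto simp: cnj_mat_def)
    moreover have "of_real (r1 / n) \<in> K" using r1(2) by (simp add: n_def)
    ultimately show ?thesis using r' detM' by (intro exI[of _ "r1 / n"] exI[of _ ?M']) simp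
  qed
qed


section \<open>Integrality: the content ideal of a matrix\<close>

lemma B_mult_cnj: "c \<in> B \<Longrightarrow> c' \<in> B \<Longrightarrow> c * cnj c' / NB \<in> \<O>"
proof -
  assume "c \<in> B" "c' \<in> B"
  then have "c * cnj c' \<in> B \<star> cnj ` B" by (intro ideal_multI) auto
  then show ?thesis unfolding ideal_norm_eq(1)[OF frac_B B_subset] by auto
qed

lemma cnj_B_div: "c \<in> B \<Longrightarrow> cnj c / NB \<in> Binv"
proof -
  assume "c \<in> B"
  then have "cnj c \<in> (*) NB ` Binv" unfolding NB_Binv by simp
  then show ?thesis by auto
qed

lemma Binv_cnj: "e \<in> Binv \<Longrightarrow> NB * cnj e \<in> B"
  using NB_cnj_Binv by blast

lemma B_Binv_mem: "c \<in> B \<Longrightarrow> e \<in> Binv \<Longrightarrow> c * e \<in> \<O>" "c \<in> B \<Longrightarrow> e \<in> Binv \<Longrightarrow> e * c \<in> \<O>"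
  using ideal_multI[of c B e Binv] unfolding B_Binv by (simp_all add: mult.commute)

text \<open>The elements \<open>P\<close> with \<open>(w - cnj w) * P\<close> in the order form the inverse different, so they have
  integral trace. If the norm is integral too, \<open>P\<close> is an algebraic integer.\<close>

lemma inverse_different_norm:
  assumes "P \<in> K" "(w - cnj w) * P \<in> \<O>" "P * cnj P \<in> \<O>"
  shows "P \<in> \<O>"
proof -
  obtain u v where uv: "(w - cnj w) * P = of_int u + of_int v * w" using assms(2) by (rule OE)
  have ne: "w - cnj w \<noteq> 0" using Im_w by (simp add: complex_eq_iff)
  have "(w - cnj w) * P - cnj ((w - cnj w) * P) = of_int v * (w - cnj w)"
    unfolding uv by (simp add: algebra_simps)
  then have "(w - cnj w) * (P + cnj P) = (w - cnj w) * of_int v" by (simp add: algebra_simps)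
  then have "P + cnj P = of_int v" using ne by (metis mult_left_cancel)
  then have "P + cnj P \<in> \<O>" by (simp only: O_of_int)
  then show ?thesis by (rule trace_norm_in_O[OF assms(1) _ assms(3)])
qed

text \<open>The smallest ideal \<open>J\<close> with \<open>M \<Lambda> \<subseteq> J \<Lambda>\<close>, that is, with \<open>M\<close> in \<^const>\<open>ideal_mats\<close> of \<open>J\<close>: it is generated by
  the diagonal entries, by \<open>M\<^sub>1\<^sub>2 B\<close> and by \<open>M\<^sub>2\<^sub>1\<close> times the inverse of \<open>B\<close>.\<close>

definition content_ideal :: "complex^2^2 \<Rightarrow> complex set"
  where "content_ideal M = {(M $ 1 $ 1 * a + M $ 1 $ 2 * c) + (M $ 2 $ 1 * e + M $ 2 $ 2 * d) | a c e d.
    a \<in> \<O> \<and> c \<in> B \<and> e \<in> Binv \<and> d \<in> \<O>}"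

lemma content_idealI:
  "a \<in> \<O> \<Longrightarrow> c \<in> B \<Longrightarrow> e \<in> Binv \<Longrightarrow> d \<in> \<O> \<Longrightarrow>
    (M $ 1 $ 1 * a + M $ 1 $ 2 * c) + (M $ 2 $ 1 * e + M $ 2 $ 2 * d) \<in> content_ideal M"
  unfolding content_ideal_def by blast

lemma content_ideal_frac:
  assumes MK: "\<And>i j. M $ i $ j \<in> K" and "det M \<noteq> 0"
  shows "frac_ideal (content_ideal M)"
proof -
  note fB = fracD[OF frac_B] and fI = fracD[OF frac_Binv]
  obtain c0 where c0: "c0 \<in> B" "c0 \<noteq> 0" using fB(6) by blast
  have "M $ 1 $ 1 \<noteq> 0 \<or> M $ 1 $ 2 \<noteq> 0" using assms(2) by (auto simp: det_2)
  moreover have "M $ 1 $ 1 \<in> content_ideal M" using content_idealI[of 1 0 0 0 M] fB(2) fI(2) by simp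
  moreover have "M $ 1 $ 2 * c0 \<in> content_ideal M" using content_idealI[of 0 c0 0 0 M] c0 fI(2) by simp
  ultimately obtain x where x: "x \<in> content_ideal M" "x \<noteq> 0" using c0(2) by (metis mult_eq_0_iff)
  obtain d1 where d1: "d1 > 0" "of_int d1 * M $ 1 $ 1 \<in> \<O>" using K_denominator[OF MK] by blast
  obtain d2 where d2: "d2 > 0" "of_int d2 * M $ 1 $ 2 \<in> \<O>" using K_denominator[OF MK] by blast
  obtain d3 where d3: "d3 > 0" "of_int d3 * M $ 2 $ 1 \<in> \<O>" using K_denominator[OF MK] by blast
  obtain d4 where d4: "d4 > 0" "of_int d4 * M $ 2 $ 2 \<in> \<O>" using K_denominator[OF MK] by blast
  let ?d = "of_int d1 * of_int d2 * of_int d3 * of_int d4 * NB"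
  show ?thesis
  proof (rule frac_idealI[OF _ _ _ x, of ?d])
    show "z \<in> K" if "z \<in> content_ideal M" for z
      using that MK O_subset_K fB(1) fI(1) by (auto simp: content_ideal_def)
    show "y + z \<in> content_ideal M" if y: "y \<in> content_ideal M" and z: "z \<in> content_ideal M" for y z
    proof -
      obtain a c e d where 1: "a \<in> \<O>" "c \<in> B" "e \<in> Binv" "d \<in> \<O>"
        "y = (M $ 1 $ 1 * a + M $ 1 $ 2 * c) + (M $ 2 $ 1 * e + M $ 2 $ 2 * d)" using y unfolding content_ideal_def by blast
      obtain a' c' e' d' where 2: "a' \<in> \<O>" "c' \<in> B" "e' \<in> Binv" "d' \<in> \<O>"
        "z = (M $ 1 $ 1 * a' + M $ 1 $ 2 * c') + (M $ 2 $ 1 * e' + M $ 2 $ 2 * d')" using z unfolding content_ideal_def by blast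
      have "y + z = (M $ 1 $ 1 * (a + a') + M $ 1 $ 2 * (c + c')) + (M $ 2 $ 1 * (e + e') + M $ 2 $ 2 * (d + d'))"
        unfolding 1(5) 2(5) by (simp add: algebra_simps)
      then show ?thesis using content_idealI[OF O_add[OF 1(1) 2(1)] fB(3)[OF 1(2) 2(2)] fI(3)[OF 1(3) 2(3)] O_add[OF 1(4) 2(4)]]
        by metis
    qed
    show "s * y \<in> content_ideal M" if s: "s \<in> \<O>" and y: "y \<in> content_ideal M" for s y
    proof -
      obtain a c e d where 1: "a \<in> \<O>" "c \<in> B" "e \<in> Binv" "d \<in> \<O>"
        "y = (M $ 1 $ 1 * a + M $ 1 $ 2 * c) + (M $ 2 $ 1 * e + M $ 2 $ 2 * d)" using y unfolding content_ideal_def by blast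
      have "s * y = (M $ 1 $ 1 * (s * a) + M $ 1 $ 2 * (s * c)) + (M $ 2 $ 1 * (s * e) + M $ 2 $ 2 * (s * d))"
        unfolding 1(5) by (simp add: algebra_simps)
      then show ?thesis using content_idealI[OF O_mult[OF s 1(1)] fB(4)[OF s 1(2)] fI(4)[OF s 1(3)] O_mult[OF s 1(4)]]
        by metis
    qed
    show "?d * y \<in> \<O>" if y: "y \<in> content_ideal M" for y
    proof -
      obtain a c e d where 1: "a \<in> \<O>" "c \<in> B" "e \<in> Binv" "d \<in> \<O>"
        "y = (M $ 1 $ 1 * a + M $ 1 $ 2 * c) + (M $ 2 $ 1 * e + M $ 2 $ 2 * d)" using y unfolding content_ideal_def by blast
      have NBO: "NB \<in> \<O>" by simp
      have "cnj (NB * cnj e) \<in> \<O>" by (rule O_cnj[OF subsetD[OF B_subset Binv_cnj[OF 1(3)]]])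
      then have e: "NB * e \<in> \<O>" by simp
      have c: "c \<in> \<O>" by (rule subsetD[OF B_subset 1(2)])
      have "?d * y = of_int (d2 * d3 * d4) * NB * (of_int d1 * M $ 1 $ 1) * a + of_int (d1 * d3 * d4) * NB * (of_int d2 * M $ 1 $ 2) * c
        + (of_int (d1 * d2 * d4) * (of_int d3 * M $ 2 $ 1) * (NB * e) + of_int (d1 * d2 * d3) * NB * (of_int d4 * M $ 2 $ 2) * d)"
        unfolding 1(5) by (simp add: algebra_simps)
      also have "\<dots> \<in> \<O>"
        by (intro O_add O_mult O_of_int NBO d1(2) d2(2) d3(2) d4(2) 1(1,4) c e)
      finally show ?thesis .
    qed
  qed (use d1 d2 d3 d4 in simp_all)
qed

text \<open>Let \<open>J\<^sub>1\<close> and \<open>J\<^sub>2\<close> be the contents of the two rows. The images of the two diagonal units are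
  integral, which says that \<open>r * (x * cnj y)\<close> is integral for \<open>x, y\<close> in the same \<open>J\<^sub>i\<close>. For the mixed products
  the off-diagonal elements \<open>T(b)\<close> give only a trace, that is, a sum of two such products. But
  \<open>w T(e) - T(cnj w * e)\<close> has the single entry \<open>(w - cnj w) * e\<close>, so the mixed products are integral after
  multiplication by \<open>w - cnj w\<close>. Their norms are products of two integral terms from the single rows,
  so the products lie in the order themselves.\<close>

lemma act_Herm_imp_content:
  assumes MK: "\<And>i j. M $ i $ j \<in> K" and r: "r > 0" "of_real r \<in> K"
    and H: "\<And>S. S \<in> Herm K B \<Longrightarrow> act r M S \<in> Herm K B"
    and x: "x \<in> content_ideal M" and y: "y \<in> content_ideal M"
  shows "of_real r * (x * cnj y) \<in> \<O>"
proof -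
  let ?r = "complex_of_real r"
  let ?a = "M $ 1 $ 1" and ?b = "M $ 1 $ 2" and ?c = "M $ 2 $ 1" and ?d = "M $ 2 $ 2"
  let ?s = "w - cnj w"
  note fI = fracD[OF frac_Binv] and fB = fracD[OF frac_B]
  have end_mem: "P $ 1 $ 1 \<in> \<O>" "P $ 2 $ 2 \<in> \<O>" "P $ 1 $ 2 \<in> Binv" "P $ 2 $ 1 \<in> B" if "P \<in> ideal_mats \<O>" for P
    using that by (simp_all add: ideal_mats_def frac_B frac_Binv)
  \<comment> \<open>Products within one row.\<close>
  note h1 = end_mem[OF HermD(1)[OF H[OF basis_Herm(1)]]]
  have a1: "?r * (cnj ?a * ?a) \<in> \<O>" "?r * (cnj ?b * NB * ?b) \<in> \<O>" "?r * (cnj ?a * ?b) \<in> Binv"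
    using h1 unfolding act_basis by simp_all
  note h2 = end_mem[OF HermD(1)[OF H[OF basis_Herm(2)]]]
  have a2: "?r * (cnj ?c * ?c / NB) \<in> \<O>" "?r * (cnj ?d * ?d) \<in> \<O>" "?r * (cnj ?d * ?c) \<in> B"
    using h2 by (simp_all add: act_def mult_sel rosati_def mult_ac)
  have a1': "?r * (?a * cnj ?b * cnj c) \<in> \<O>" if "c \<in> B" for c
    using O_cnj[OF B_Binv_mem(2)[OF that a1(3)]] by (simp add: mult_ac)
  have row1: "?r * ((?a * a + ?b * c) * cnj (?a * a' + ?b * c')) \<in> \<O>"
    if m: "a \<in> \<O>" "c \<in> B" "a' \<in> \<O>" "c' \<in> B" for a c a' c'
  proof -
    have "?r * ((?a * a + ?b * c) * cnj (?a * a' + ?b * c')) =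
      (?r * (cnj ?a * ?a)) * (a * cnj a') + (?r * (?a * cnj ?b * cnj c')) * a
      + (cnj (?r * (?a * cnj ?b * cnj c)) * cnj a' + (?r * (cnj ?b * NB * ?b)) * (c * cnj c' / NB))"
      by (simp add: field_simps)
    also have "\<dots> \<in> \<O>"
      by (intro O_add O_mult O_cnj a1 a1' B_mult_cnj m)
    finally show ?thesis .
  qed
  have a2': "?r * (cnj ?d * ?c * e) \<in> \<O>" if "e \<in> Binv" for e
    using B_Binv_mem(1)[OF a2(3) that] by (simp add: mult_ac)
  have a2'': "NB * (e * cnj e') \<in> \<O>" if "e \<in> Binv" "e' \<in> Binv" for e e'
    using B_Binv_mem(1)[OF Binv_cnj[OF that(2)] that(1)] by (simp add: mult_ac)
  have row2: "?r * ((?c * e + ?d * d) * cnj (?c * e' + ?d * d')) \<in> \<O>"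
    if m: "e \<in> Binv" "d \<in> \<O>" "e' \<in> Binv" "d' \<in> \<O>" for e d e' d'
  proof -
    have "?r * ((?c * e + ?d * d) * cnj (?c * e' + ?d * d')) =
      (?r * (cnj ?c * ?c / NB)) * (NB * (e * cnj e')) + (?r * (cnj ?d * ?c * e)) * cnj d'
      + (cnj (?r * (cnj ?d * ?c * e')) * d + (?r * (cnj ?d * ?d)) * (d * cnj d'))"
      by (simp add: field_simps)
    also have "\<dots> \<in> \<O>"
      by (intro O_add O_mult O_cnj a2 a2' a2'' m)
    finally show ?thesis .
  qed
  \<comment> \<open>Products of the conjugated first row with the second row, times \<open>w - cnj w\<close>.\<close>
  have mixed: "?s * (?r * (cnj ?a * ?c)) * e \<in> \<O>" "?s * (?r * (cnj ?a * ?d)) * e \<in> Binv"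
    "?s * (?r * (cnj ?b * NB * ?c)) * e \<in> B" "?s * (?r * (cnj ?b * NB * ?d)) * e \<in> \<O>" if e: "e \<in> Binv" for e
  proof -
    have we: "cnj w * e \<in> Binv" using fI(4)[OF O_cnj[OF w_in_O] e] .
    have T: "herm 0 e 0 \<in> Herm K B" "herm 0 (cnj w * e) 0 \<in> Herm K B" using e we by (auto intro: herm_Herm)
    note p = end_mem[OF HermD(1)[OF H[OF T(1)]]] and p' = end_mem[OF HermD(1)[OF H[OF T(2)]]]
    have dO: "x \<in> \<O> \<Longrightarrow> y \<in> \<O> \<Longrightarrow> w * x - y \<in> \<O>" for x y by simp
    have dB: "x \<in> B \<Longrightarrow> y \<in> B \<Longrightarrow> w * x - y \<in> B" for x y
      using fB(3)[OF fB(4)[OF w_in_O] fB(5)] by simp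
    have dI: "x \<in> Binv \<Longrightarrow> y \<in> Binv \<Longrightarrow> w * x - y \<in> Binv" for x y
      using fI(3)[OF fI(4)[OF w_in_O] fI(5)] by simp
    show "?s * (?r * (cnj ?a * ?c)) * e \<in> \<O>"
      using dO[OF p(1) p'(1)] by (simp add: act_def mult_sel rosati_def algebra_simps)
    show "?s * (?r * (cnj ?b * NB * ?d)) * e \<in> \<O>"
      using dO[OF p(2) p'(2)] by (simp add: act_def mult_sel rosati_def algebra_simps)
    show "?s * (?r * (cnj ?a * ?d)) * e \<in> Binv"
      using dI[OF p(3) p'(3)] by (simp add: act_def mult_sel rosati_def algebra_simps)
    show "?s * (?r * (cnj ?b * NB * ?c)) * e \<in> B"
      using dB[OF p(4) p'(4)] by (simp add: act_def mult_sel rosati_def algebra_simps)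
  qed
  have ad: "?s * (?r * (cnj ?a * ?d)) \<in> \<O>"
  proof -
    have "Binv \<star> B = \<O>" using B_Binv by (simp only: ideal_mult_comm)
    from ideal_quotient_memI[OF frac_Binv this mixed(2)]
    have "?s * (?r * (cnj ?a * ?d)) \<in> Binv \<star> B" by blast
    then show ?thesis unfolding \<open>Binv \<star> B = \<O>\<close> .
  qed
  have bc: "?s * (?r * (cnj ?b * ?c)) * e * cnj c \<in> \<O>" if "e \<in> Binv" "c \<in> B" for e c
  proof -
    have "?s * (?r * (cnj ?b * ?c)) * e * cnj c = (?s * (?r * (cnj ?b * NB * ?c)) * e) * (cnj c / NB)" by simp
    also have "\<dots> \<in> \<O>" by (rule B_Binv_mem(1)[OF mixed(3)[OF that(1)] cnj_B_div[OF that(2)]])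
    finally show ?thesis .
  qed
  have bd: "?s * (?r * (cnj ?b * ?d)) * cnj c \<in> \<O>" if "c \<in> B" for c
    using mixed(4)[OF cnj_B_div[OF that]] by (simp add: mult.assoc)
  have s_mixed: "?s * (?r * (cnj (?a * a + ?b * c) * (?c * e + ?d * d))) \<in> \<O>"
    if m: "a \<in> \<O>" "c \<in> B" "e \<in> Binv" "d \<in> \<O>" for a c e d
  proof -
    have "?s * (?r * (cnj (?a * a + ?b * c) * (?c * e + ?d * d))) =
      (?s * (?r * (cnj ?a * ?c)) * e) * cnj a + (?s * (?r * (cnj ?a * ?d))) * (cnj a * d)
      + ((?s * (?r * (cnj ?b * ?c)) * e * cnj c) + (?s * (?r * (cnj ?b * ?d)) * cnj c) * d)"
      by (simp add: algebra_simps)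
    also have "\<dots> \<in> \<O>" by (intro O_add O_mult O_cnj mixed(1) ad bc bd m)
    finally show ?thesis .
  qed
  have row12: "?r * (cnj (?a * a + ?b * c) * (?c * e + ?d * d)) \<in> \<O>"
    if m: "a \<in> \<O>" "c \<in> B" "e \<in> Binv" "d \<in> \<O>" for a c e d
  proof (rule inverse_different_norm[OF _ s_mixed[OF m]])
    let ?x = "?a * a + ?b * c" and ?y = "?c * e + ?d * d"
    show "?r * (cnj ?x * ?y) \<in> K"
      by (intro K_closed r K_cnj MK O_subset_K[OF m(1)] O_subset_K[OF m(4)] fB(1)[OF m(2)] fI(1)[OF m(3)])
    have "(?r * (cnj ?x * ?y)) * cnj (?r * (cnj ?x * ?y)) = (?r * (?x * cnj ?x)) * (?r * (?y * cnj ?y))"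
      by (simp only: complex_cnj_mult complex_cnj_complex_of_real complex_cnj_cnj mult_ac)
    also have "\<dots> \<in> \<O>" by (rule O_mult[OF row1[OF m(1,2,1,2)] row2[OF m(3,4,3,4)]])
    finally show "(?r * (cnj ?x * ?y)) * cnj (?r * (cnj ?x * ?y)) \<in> \<O>" .
  qed
  obtain a c e d where 1: "a \<in> \<O>" "c \<in> B" "e \<in> Binv" "d \<in> \<O>" "x = (?a * a + ?b * c) + (?c * e + ?d * d)"
    using x unfolding content_ideal_def by blast
  obtain a' c' e' d' where 2: "a' \<in> \<O>" "c' \<in> B" "e' \<in> Binv" "d' \<in> \<O>" "y = (?a * a' + ?b * c') + (?c * e' + ?d * d')"
    using y unfolding content_ideal_def by blast
  have split: "?r * ((x1 + x2) * cnj (y1 + y2)) = ?r * (x1 * cnj y1) + ?r * (x2 * cnj y2)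
    + (cnj (?r * (cnj x1 * y2)) + ?r * (cnj y1 * x2))" for x1 x2 y1 y2
    by (simp add: algebra_simps)
  show ?thesis unfolding 1(5) 2(5)
    by (subst split) (intro O_add O_cnj row1 row2 row12 1 2)
qed

text \<open>Let \<open>J\<close> be the content ideal and \<open>J \<star> cnj ` J = s \<O>\<close>. Integrality gives that \<open>r * s\<close> is a positive
  integer. On the other hand \<open>det M\<close> lies in \<open>J \<star> J\<close> and has absolute value \<open>1 / r\<close>, so \<open>1 / (r * s)\<^sup>2\<close> is an
  integer as well. Hence \<open>r * s = 1\<close>, and \<open>det M\<close>, having the norm of \<open>J \<star> J\<close>, generates it.\<close>

lemma integral_act_similitude:
  assumes MK: "\<And>i j. M $ i $ j \<in> K" and r: "r > 0" "of_real r \<in> K"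
    and H: "\<And>S. S \<in> Herm K B \<Longrightarrow> act r M S \<in> Herm K B"
    and det: "r * cmod (det M) = 1"
  shows "\<exists>J. ideal_similitude J M \<and> J \<star> cnj ` J = (*) (of_real (1 / r)) ` \<O>"
proof -
  let ?J = "content_ideal M"
  have det0: "det M \<noteq> 0" using det by auto
  have J: "frac_ideal ?J" by (rule content_ideal_frac[OF MK det0])
  note fI = fracD[OF frac_Binv] and fB = fracD[OF frac_B]
  have M: "M \<in> ideal_mats ?J"
  proof -
    have "M $ 1 $ 1 \<in> ?J" "M $ 2 $ 2 \<in> ?J"
      using content_idealI[of 1 0 0 0 M] content_idealI[of 0 0 0 1 M] fI(2) fB(2) by simp_all
    moreover have "M $ 1 $ 2 \<in> ?J \<star> Binv"
    proof (rule ideal_quotient_memI[OF J B_Binv])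
      show "M $ 1 $ 2 * c \<in> ?J" if "c \<in> B" for c using content_idealI[of 0 c 0 0 M] that fI(2) by simp
    qed
    moreover have "M $ 2 $ 1 \<in> ?J \<star> B"
    proof (rule ideal_quotient_memI[OF J B_Binv[unfolded ideal_mult_comm[of B]]])
      show "M $ 2 $ 1 * e \<in> ?J" if "e \<in> Binv" for e using content_idealI[of 0 0 e 0 M] that fB(2) by simp
    qed
    ultimately show ?thesis by (simp add: ideal_mats_def)
  qed
  obtain s where s: "s > 0" "?J \<star> cnj ` ?J = (*) (of_real s) ` \<O>" using ex_ideal_norm[OF J] by blast
  have "?J \<star> cnj ` ?J \<subseteq> {z. of_real r * z \<in> \<O>}"
  proof (rule ideal_mult_least)
    show "i * j \<in> {z. of_real r * z \<in> \<O>}" if "i \<in> ?J" "j \<in> cnj ` ?J" for i j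
      using that act_Herm_imp_content[OF MK r H] by blast
  qed (simp add: distrib_left)
  moreover have "of_real s * 1 \<in> ?J \<star> cnj ` ?J" unfolding s(2) by (rule imageI) simp
  ultimately have "of_real (r * s) \<in> \<O>" by auto
  then obtain m :: int where m: "r * s = m" using O_real_int by blast
  have dJ: "det M \<in> ?J \<star> ?J" by (rule ideal_mats_det[OF J M])
  have JJ: "(?J \<star> ?J) \<star> cnj ` (?J \<star> ?J) = (*) (of_real (s * s)) ` \<O>"
  proof -
    have "(?J \<star> ?J) \<star> cnj ` (?J \<star> ?J) = (?J \<star> cnj ` ?J) \<star> (?J \<star> cnj ` ?J)"
      unfolding cnj_ideal_mult by (simp only: ideal_mult_ac)
    then show ?thesis unfolding s(2) scale_O_mult by simp
  qed
  have "det M * cnj (det M) \<in> (?J \<star> ?J) \<star> cnj ` (?J \<star> ?J)" using dJ by (intro ideal_multI) auto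
  then obtain z where z: "z \<in> \<O>" "of_real ((cmod (det M))\<^sup>2) = of_real (s * s) * z"
    unfolding JJ complex_norm_square by blast
  then have "z = of_real ((cmod (det M))\<^sup>2 / (s * s))" using s(1) by (simp add: field_simps)
  then obtain k :: int where k: "(cmod (det M))\<^sup>2 / (s * s) = k" using O_real_int z(1) by blast
  have "(r * s)\<^sup>2 * ((cmod (det M))\<^sup>2 / (s * s)) = (r * cmod (det M))\<^sup>2"
    using s(1) by (simp add: power_mult_distrib power2_eq_square)
  also have "\<dots> = 1" unfolding det by simp
  finally have "real_of_int (m\<^sup>2 * k) = 1" unfolding k m by simp
  then have "m\<^sup>2 * k = 1" by linarith
  then have "m\<^sup>2 = 1 \<or> m\<^sup>2 = -1" using zmult_eq_1_iff by blast
  moreover have "m > 0" using m r s by (metis mult_pos_pos of_int_0_less_iff)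
  moreover have "m\<^sup>2 \<ge> 0" by simp
  ultimately have "m = 1" by (simp add: power2_eq_1_iff) 
  then have rs: "r * s = 1" using m by simp
  then have "r * cmod (det M) = r * s" using det by simp
  then have "cmod (det M) = s" using r(1) by (simp only: mult_cancel_left) simp
  then have s': "s = 1 / r" "cmod (det M) = s" using r(1) rs by (simp_all add: field_simps)
  have "?J \<star> ?J = (*) (det M) ` \<O>"
  proof (intro equalityI subsetI)
    fix x assume "x \<in> ?J \<star> ?J"
    then have "x * cnj (det M) \<in> (*) (of_real (s * s)) ` \<O>" unfolding JJ[symmetric] using dJ by (intro ideal_multI) auto
    then obtain z where z: "z \<in> \<O>" "x * cnj (det M) = of_real (s * s) * z" by blast
    have "of_real (s * s) = det M * cnj (det M)" unfolding complex_norm_square[symmetric] s'(2)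
      by (simp add: power2_eq_square)
    then have "x = det M * z" using z(2) det0 by simp
    then show "x \<in> (*) (det M) ` \<O>" using z(1) by blast
  next
    fix x assume "x \<in> (*) (det M) ` \<O>"
    then show "x \<in> ?J \<star> ?J" using fracD(4)[OF frac_mult[OF J J] _ dJ] by (auto simp: mult.commute)
  qed
  then have "ideal_similitude ?J M" using J M det0 by (simp add: ideal_similitude_def)
  then show ?thesis using s(2) s'(1) by blast
qed


section \<open>Cosets of the automorphisms\<close>

text \<open>Steinitz's isomorphism. Take any \<open>a \<noteq> 0\<close> in \<open>I\<close> as upper left entry; the integral ideal
  \<open>a I\<^bsup>-1\<^esup>\<close> contains a nonzero integer \<open>N\<close>. Choose the upper right entry \<open>m\<close> such that \<open>m (I B\<^bsup>-1\<^esup>)\<^bsup>-1\<^esup>\<close> contains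
  an integer \<open>s\<close> prime to \<open>N\<close>. A relation \<open>u * s + v * N = 1\<close>, multiplied by the generator \<open>k\<close> of \<open>I \<star> I\<close>,
  then provides a second row for which the determinant is \<open>k\<close>.\<close>

lemma ex_ideal_similitude:
  assumes I: "frac_ideal I" and k: "k \<in> K - {0}" "I \<star> I = (*) k ` \<O>"
  shows "\<exists>M. ideal_similitude I M"
proof -
  obtain a where a: "a \<in> I" "a \<noteq> 0" using fracD(6)[OF I] by blast
  have inv: "frac_ideal (ideal_inverse K I)" "I \<star> ideal_inverse K I = \<O>" using ideal_inverse[OF I] by auto
  let ?X = "(*) a ` ideal_inverse K I"
  have X: "frac_ideal ?X" by (rule frac_scale[OF inv(1) fracD(1)[OF I a(1)] a(2)])
  have XO: "?X \<subseteq> \<O>" using ideal_multI[OF a(1)] inv(2) by blast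
  obtain z where z: "z \<in> ?X" "z \<noteq> 0" using fracD(6)[OF X] by blast
  have "cnj z * z \<in> ?X" by (rule fracD(4)[OF X O_cnj[OF subsetD[OF XO z(1)]] z(1)])
  then have zz: "of_real ((cmod z)\<^sup>2) \<in> ?X" unfolding complex_norm_square by (simp only: mult.commute)
  then obtain N :: int where N: "(cmod z)\<^sup>2 = N" using O_real_int[OF subsetD[OF XO zz]] by blast
  have "N \<noteq> 0" using z(2) N by auto
  have NX: "of_int N \<in> ?X" using zz unfolding N by simp
  let ?F = "I \<star> Binv"
  have F: "frac_ideal ?F" by (rule frac_mult[OF I frac_Binv])
  obtain m s where m: "m \<in> ?F" "gcd s N = 1" "of_int s \<in> (*) m ` ideal_inverse K ?F"
    using ex_coprime_element[OF F \<open>N \<noteq> 0\<close>] by (elim bexE exE conjE)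
  have invF: "?F \<star> ideal_inverse K ?F = \<O>" "frac_ideal (ideal_inverse K ?F)" using ideal_inverse[OF F] by auto
  obtain g where g: "g \<in> ideal_inverse K ?F" "of_int s = m * g" using m(3) by blast
  obtain h where h: "h \<in> ideal_inverse K I" "of_int N = a * h" using NX by blast
  obtain u v where uv: "u * s + v * N = 1" using bezout_int[of s N] m(2) by auto
  have kII: "k \<in> I \<star> I" unfolding k(2) by (rule image_eqI[of _ _ 1]) simp_all
  have "k * h \<in> I"
  proof -
    have "k * h \<in> (I \<star> I) \<star> ideal_inverse K I" by (rule ideal_multI[OF kII h(1)])
    then show ?thesis unfolding ideal_mult_assoc inv(2) using I by simp
  qed
  moreover have "k * g \<in> I \<star> B"
  proof -
    have IB: "frac_ideal (I \<star> B)" by (rule frac_mult[OF I frac_B])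
    have "I \<star> I = (I \<star> I) \<star> (B \<star> Binv)" unfolding B_Binv using frac_mult[OF I I] by simp
    also have "\<dots> = (I \<star> B) \<star> ?F" by (simp only: ideal_mult_ac)
    finally have "k \<in> (I \<star> B) \<star> ?F" using kII by simp
    then have "k * g \<in> ((I \<star> B) \<star> ?F) \<star> ideal_inverse K ?F" by (rule ideal_multI[OF _ g(1)])
    then show ?thesis unfolding ideal_mult_assoc[of "I \<star> B"] invF using IB by simp
  qed
  ultimately have mem: "of_int v * (k * h) \<in> I" "of_int (- u) * (k * g) \<in> I \<star> B"
    by (blast intro: fracD(4)[OF I O_of_int] fracD(4)[OF frac_mult[OF I frac_B] O_of_int])+
  define M where "M = mat2 a m (of_int (- u) * (k * g)) (of_int v * (k * h))"
  have "det M = k * (of_int u * (m * g) + of_int v * (a * h))" by (simp add: M_def det_2 algebra_simps)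
  also have "\<dots> = k * of_int (u * s + v * N)" unfolding g(2)[symmetric] h(2)[symmetric] by simp
  finally have "det M = k" unfolding uv by simp
  moreover have "M \<in> ideal_mats I" using mem a m(1) by (simp add: ideal_mats_def M_def)
  ultimately show ?thesis using I k unfolding ideal_similitude_def by blast
qed

lemma ideal_similitude_unique:
  assumes "ideal_similitude I M" "ideal_similitude J M"
  shows "I = J"
proof -
  have sub: "J \<subseteq> I" if I: "ideal_similitude I M" and J: "ideal_similitude J M" for I J
  proof
    fix x assume x: "x \<in> J"
    have *: "frac_ideal I" "M \<in> ideal_mats I" "det M \<noteq> 0" "frac_ideal J" using I J by (auto simp: ideal_similitude_def)
    have inv: "frac_ideal (ideal_inverse K J)" "J \<star> ideal_inverse K J = \<O>" using ideal_inverse[OF *(4)] by auto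
    have "inv2 M \<in> ideal_mats (ideal_inverse K J)"
      using ideal_similitude_inv[OF J] by (simp add: ideal_similitude_def)
    then have "M ** inv2 M \<in> ideal_mats (I \<star> ideal_inverse K J)"
      by (rule ideal_mats_mult[OF *(1) inv(1) *(2)])
    then have "1 \<in> I \<star> ideal_inverse K J" unfolding inv2_mult[OF *(3)] by (simp add: ideal_mats_def)
    then have "x * 1 \<in> J \<star> (I \<star> ideal_inverse K J)" by (rule ideal_multI[OF x])
    also have "J \<star> (I \<star> ideal_inverse K J) = I \<star> (J \<star> ideal_inverse K J)" by (rule ideal_mult_left_comm)
    finally show "x \<in> I" unfolding inv(2) using *(1) by simp
  qed
  show ?thesis using sub[OF assms] sub[OF assms(2,1)] by blast
qed

lemma Units_order_iff: "x \<in> Units (order_ring K) \<longleftrightarrow> x \<in> \<O> \<and> (\<exists>y\<in>\<O>. x * y = 1)"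
  by (auto simp: Units_def mult.commute)

lemma Aut_A_iff: "P \<in> Aut_A K B \<longleftrightarrow> ideal_similitude \<O> P"
proof
  assume "P \<in> Aut_A K B"
  then obtain y where P: "P \<in> ideal_mats \<O>" "det P \<in> \<O>" "y \<in> \<O>" "det P * y = 1"
    unfolding Aut_A_def Units_order_iff End_A_eq by blast
  have "x \<in> (*) (det P) ` \<O>" if "x \<in> \<O>" for x
  proof (rule image_eqI)
    show "x = det P * (y * x)" unfolding mult.assoc[symmetric] P(4) by simp
  qed (use P(3) that in simp)
  then have "\<O> = (*) (det P) ` \<O>" using P(2) by auto
  then show "ideal_similitude \<O> P" using P frac_O by (auto simp: ideal_similitude_def)
next
  assume P: "ideal_similitude \<O> P"
  then have P': "P \<in> ideal_mats \<O>" "\<O> = (*) (det P) ` \<O>" using frac_O by (auto simp: ideal_similitude_def)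
  have "det P \<in> \<O> \<star> \<O>" by (rule ideal_mats_det[OF frac_O P'(1)])
  then have d: "det P \<in> \<O>" using frac_O by simp
  have "1 \<in> (*) (det P) ` \<O>" using P'(2) O_zero_one(2) by simp
  then obtain y where "y \<in> \<O>" "1 = det P * y" by blast
  then show "P \<in> Aut_A K B" unfolding Aut_A_def Units_order_iff End_A_eq using d P'(1) by auto
qed

lemma O_norm: "\<O> \<star> cnj ` \<O> = (*) (of_real 1) ` \<O>"
  using frac_O by simp

lemma h_map_eq: "h_map K B P = restrict (act 1 P) (Herm K B)"
  unfolding h_map_def by (rule restrict_ext) (simp add: act_def)

lemma H_A_eq: "H_A K B = {restrict (act 1 P) (Herm K B) | P. ideal_similitude \<O> P}"
  unfolding H_A_def h_map_eq Aut_A_iff[symmetric] by blast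

lemma similitude_O_in_G_A:
  "ideal_similitude \<O> P \<Longrightarrow> restrict (act 1 P) (Herm K B) \<in> carrier (G_A K B)"
  using similitude_in_G_A[of \<O> P 1] O_norm by simp

lemma similitude_O_Herm:
  "ideal_similitude \<O> P \<Longrightarrow> S \<in> Herm K B \<Longrightarrow> act 1 P S \<in> Herm K B"
  using act_Herm[of \<O> 1 P S] O_norm by (simp add: ideal_similitude_def)

lemma subgroup_H_A: "subgroup (H_A K B) (G_A K B)"
proof -
  interpret group "G_A K B" by (rule group_G_A)
  have mult: "restrict (act 1 P) (Herm K B) \<otimes>\<^bsub>G_A K B\<^esub> restrict (act 1 Q) (Herm K B) = restrict (act 1 (Q ** P)) (Herm K B)"
    if "ideal_similitude \<O> P" "ideal_similitude \<O> Q" for P Q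
    unfolding G_A_mult[OF similitude_O_in_G_A[OF that(1)] similitude_O_in_G_A[OF that(2)]] compose_def
    by (rule restrict_ext) (simp add: similitude_O_Herm[OF that(2)] act_act)
  have closed: "ideal_similitude \<O> (P ** Q)" if "ideal_similitude \<O> P" "ideal_similitude \<O> Q" for P Q
    using ideal_similitude_mult[OF that] frac_O by simp
  have inv_O: "ideal_inverse K \<O> = \<O>" using ideal_inverse(1,2)[OF frac_O] by simp
  have invc: "ideal_similitude \<O> (inv2 P)" if "ideal_similitude \<O> P" for P
    using ideal_similitude_inv[OF that] unfolding inv_O .
  have one: "ideal_similitude \<O> (mat 1)"
    using frac_O fracD(2)[OF frac_Binv] fracD(2)[OF frac_B]
    by (simp add: ideal_similitude_def ideal_mats_def frac_B frac_Binv)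
  show ?thesis
  proof (rule subgroupI)
    show "H_A K B \<subseteq> carrier (G_A K B)" unfolding H_A_eq using similitude_O_in_G_A by blast
    show "H_A K B \<noteq> {}" unfolding H_A_eq using one by blast
  next
    fix h assume "h \<in> H_A K B"
    then obtain P where P: "ideal_similitude \<O> P" "h = restrict (act 1 P) (Herm K B)" unfolding H_A_eq by blast
    have dP: "det P \<noteq> 0" using P(1) by (simp add: ideal_similitude_def)
    let ?g = "restrict (act 1 (inv2 P)) (Herm K B)"
    have "?g \<otimes>\<^bsub>G_A K B\<^esub> h = \<one>\<^bsub>G_A K B\<^esub>"
      unfolding P(2) mult[OF invc[OF P(1)] P(1)] inv2_mult[OF dP] G_A_one by (rule restrict_ext) simp
    then have "inv\<^bsub>G_A K B\<^esub> h = ?g"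
      by (rule inv_equality) (simp_all add: P(2) similitude_O_in_G_A[OF P(1)] similitude_O_in_G_A[OF invc[OF P(1)]])
    then show "inv\<^bsub>G_A K B\<^esub> h \<in> H_A K B" unfolding H_A_eq using invc[OF P(1)] by blast
  next
    fix g h assume "g \<in> H_A K B" "h \<in> H_A K B"
    then obtain P Q where "ideal_similitude \<O> P" "g = restrict (act 1 P) (Herm K B)"
      "ideal_similitude \<O> Q" "h = restrict (act 1 Q) (Herm K B)" unfolding H_A_eq by blast
    then show "g \<otimes>\<^bsub>G_A K B\<^esub> h \<in> H_A K B" unfolding H_A_eq using mult closed by blast
  qed
qed

lemma gamma_eq: "gamma K B I M = restrict (act (1 / real (ideal_norm K I)) M) (Herm K B)"
  unfolding gamma_def by (rule restrict_ext) (simp add: act_def)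

lemma gamma_facts:
  assumes I: "nonzero_ideal K I" and M: "ideal_similitude I M"
  shows "gamma K B I M \<in> carrier (G_A K B)" "gamma' K B I M \<in> carrier (G_A K B)"
    "S \<in> Herm K B \<Longrightarrow> act (1 / real (ideal_norm K I)) M S \<in> Herm K B"
    "gamma' K B I M = tau K B \<otimes>\<^bsub>G_A K B\<^esub> gamma K B I M"
proof -
  interpret group "G_A K B" by (rule group_G_A)
  note n = ideal_norm_eq[OF nonzero_idealD[OF I]]
  have r: "real (ideal_norm K I) > 0" using n(2) by simp
  show g: "gamma K B I M \<in> carrier (G_A K B)" unfolding gamma_eq by (rule similitude_in_G_A[OF M r n(1)])
  show g': "gamma' K B I M = tau K B \<otimes>\<^bsub>G_A K B\<^esub> gamma K B I M"
    unfolding gamma'_def G_A_mult[OF tau_in_G_A g] ..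
  show "gamma' K B I M \<in> carrier (G_A K B)" unfolding g' by (rule m_closed[OF tau_in_G_A g])
  show "act (1 / real (ideal_norm K I)) M S \<in> Herm K B" if "S \<in> Herm K B"
    using act_Herm[OF nonzero_idealD(1)[OF I] r n(1) _ that] M by (simp add: ideal_similitude_def)
qed

text \<open>An equality of this kind, composed with the inverse of the action of \<open>X\<close>, would present \<open>swap\<close>
  itself as the action of a matrix.\<close>

lemma swap_act_neq_act:
  assumes X: "ideal_similitude J X" "r > 0" "J \<star> cnj ` J = (*) (of_real r) ` \<O>" and s: "s > 0"
    and eq: "\<And>S. S \<in> Herm K B \<Longrightarrow> swap (act (1 / r) X S) = act s Y S"
  shows False
proof -
  have J: "frac_ideal J" "det X \<noteq> 0" using X(1) by (auto simp: ideal_similitude_def)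
  have inv: "inv2 X \<in> ideal_mats (ideal_inverse K J)" "frac_ideal (ideal_inverse K J)"
    using ideal_similitude_inv[OF X(1)] by (auto simp: ideal_similitude_def)
  show False
  proof (rule act_not_swap)
    show "s * r > 0" using s X(2) by simp
    fix S assume S: "S \<in> Herm K B"
    have "act (1 / (1 / r)) (inv2 X) S \<in> Herm K B"
      by (rule act_Herm[OF inv(2) _ ideal_inverse_norm[OF J(1) X(2,3)] inv(1) S]) (use X(2) in simp)
    from eq[OF this] show "act (s * r) (inv2 X ** Y) S = swap S"
      unfolding act_act inv2_mult[OF J(2)] using X(2) by simp
  qed
qed

lemma same_ideal_class_if_act_eq:
  assumes X: "ideal_similitude I X" "r > 0" and Y: "ideal_similitude J Y" "s > 0"
    and eq: "\<And>S. S \<in> Herm K B \<Longrightarrow> act r X S = act s Y S"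
  shows "ideal_class K I = ideal_class K J"
proof -
  have *: "frac_ideal I" "X \<in> ideal_mats I" "det X \<noteq> 0" "frac_ideal J" "Y \<in> ideal_mats J" "det Y \<noteq> 0"
    using X Y by (auto simp: ideal_similitude_def)
  obtain k where k: "X = mat k ** Y" using act_eq_scalar[OF eq X(2) Y(2) *(6)] by blast
  have "mat k = X ** inv2 Y" unfolding k matrix_mul_assoc[symmetric] inv2_mult[OF *(6)] by simp
  then have "k = (X ** inv2 Y) $ 1 $ 1" by (metis mat_sel(1))
  also have "\<dots> \<in> K" unfolding mult_sel
    using ideal_mats_in_K[OF *(1,2)] inv2_in_K[OF ideal_mats_in_K[OF *(4,5)]] by simp
  finally have kK: "k \<in> K" .
  have k0: "k \<noteq> 0" using *(3) unfolding k det_mul by auto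
  have "ideal_similitude ((*) k ` J) X" unfolding k by (rule ideal_similitude_scale[OF Y(1) kK k0])
  then have "I = (*) k ` J" by (rule ideal_similitude_unique[OF X(1)])
  then show ?thesis using ideal_class_eq_iff[OF *(1,4)] kK k0 by blast
qed

text \<open>The matrix \<open>X\<close> carries \<open>\<Lambda>\<close> to \<open>J \<Lambda>\<close> for an ideal \<open>J\<close> whose square is principal. So \<open>J = k I\<close> for a
  representative \<open>I\<close>, and \<open>X\<close> and \<open>k * M I\<close> differ on the left by an automorphism of \<open>\<Lambda>\<close>.\<close>

lemma G_A_factor:
  assumes R: "\<forall>I\<in>R. nonzero_ideal K I" "bij_betw (ideal_class K) R (class_group_2_torsion K)"
    and M: "\<And>I. I \<in> R \<Longrightarrow> ideal_similitude I (M I)"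
    and f: "\<And>S. S \<in> Herm K B \<Longrightarrow> act r X S \<in> Herm K B" "r * cmod (det X) = 1"
    and X: "r > 0" "of_real r \<in> K" "\<And>i j. X $ i $ j \<in> K"
  shows "\<exists>I\<in>R. \<exists>P. ideal_similitude \<O> P \<and> (\<forall>S. act r X S = act (1 / real (ideal_norm K I)) (M I) (act 1 P S))"
proof -
  obtain J where J: "ideal_similitude J X" "J \<star> cnj ` J = (*) (of_real (1 / r)) ` \<O>"
    using integral_act_similitude[OF X(3,1,2) f] by blast
  have JX: "frac_ideal J" "X \<in> ideal_mats J" "det X \<noteq> 0" "J \<star> J = (*) (det X) ` \<O>"
    using J(1) by (auto simp: ideal_similitude_def)
  have "det X \<in> K - {0}" using JX(3) X(3) by (simp add: det_2)
  then have "ideal_class K J \<in> class_group_2_torsion K"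
    using ideal_class_2_torsion_iff[OF JX(1)] JX(4) by blast
  then obtain I where I: "I \<in> R" "ideal_class K J = ideal_class K I" using R(2) by (auto simp: bij_betw_def)
  have nI: "nonzero_ideal K I" using I(1) R(1) by blast
  note n = ideal_norm_eq[OF nonzero_idealD[OF nI]]
  obtain k where k: "k \<in> K" "k \<noteq> 0" "J = (*) k ` I"
    using I(2) ideal_class_eq_iff[OF JX(1) nonzero_idealD(1)[OF nI]] by blast
  have "J \<star> cnj ` J = (*) (k * cnj k) ` (I \<star> cnj ` I)"
    unfolding k(3) cnj_scale ideal_mult_scale ideal_mult_scale_right image_scale_scale by (simp only: mult.commute)
  also have "\<dots> = (*) (of_real ((cmod k)\<^sup>2 * real (ideal_norm K I))) ` \<O>"
    unfolding n(1) image_scale_scale of_real_mult complex_norm_square ..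
  finally have "1 / r = (cmod k)\<^sup>2 * real (ideal_norm K I)"
    unfolding J(2) using X(1) k(2) n(2) by (intro scaled_O_unique) simp_all
  then have rn: "r * (cmod k)\<^sup>2 = 1 / real (ideal_norm K I)" using X(1) k(2) n(2) by (simp add: field_simps)
  define X' where "X' = mat (inverse k) ** X"
  have "ideal_similitude ((*) (inverse k) ` J) X'"
    unfolding X'_def using k by (intro ideal_similitude_scale J(1)) auto
  then have X': "ideal_similitude I X'" unfolding k(3) image_scale_scale using k(2) by simp
  have XX': "X = mat k ** X'" unfolding X'_def matrix_mul_assoc mat_mat_mult using k(2) by simp
  have dM: "det (M I) \<noteq> 0" using M[OF I(1)] by (simp add: ideal_similitude_def)
  have "ideal_similitude (I \<star> ideal_inverse K I) (X' ** inv2 (M I))"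
    by (rule ideal_similitude_mult[OF X' ideal_similitude_inv[OF M[OF I(1)]]])
  then have P: "ideal_similitude \<O> (X' ** inv2 (M I))" unfolding ideal_inverse(2)[OF nonzero_idealD(1)[OF nI]] .
  have "act r X S = act (1 / real (ideal_norm K I)) (M I) (act 1 (X' ** inv2 (M I)) S)" for S
    unfolding act_act matrix_mul_assoc[symmetric] inv2_mult[OF dM] unfolding XX' act_scale rn by simp
  then show ?thesis using I(1) P by blast
qed

lemma coset_representatives:
  assumes R: "\<forall>I\<in>R. nonzero_ideal K I" "bij_betw (ideal_class K) R (class_group_2_torsion K)"
    and M: "\<And>I. I \<in> R \<Longrightarrow> ideal_similitude I (M I)"
  shows "bij_betw (\<lambda>(I, twisted). (if twisted then gamma' K B I (M I) else gamma K B I (M I)) <#\<^bsub>G_A K B\<^esub> H_A K B)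
    (R \<times> (UNIV :: bool set)) (lcosets\<^bsub>G_A K B\<^esub> H_A K B)"
proof -
  interpret group "G_A K B" by (rule group_G_A)
  interpret H: subgroup "H_A K B" "G_A K B" by (rule subgroup_H_A)
  define g where "g = (\<lambda>I tw. if tw then gamma' K B I (M I) else gamma K B I (M I))"
  have nz: "nonzero_ideal K I" if "I \<in> R" for I using R(1) that by blast
  note gf = gamma_facts[OF nz M]
  have gG: "g I tw \<in> carrier (G_A K B)" if "I \<in> R" for I tw using gf(1,2)[OF that that] by (simp add: g_def)
  let ?n = "\<lambda>I. real (ideal_norm K I)"
  have npos: "1 / ?n I > 0" "?n I > 0" if "I \<in> R" for I using ideal_norm_eq(2)[OF nonzero_idealD[OF nz[OF that]]] by simp_all
  have g_app: "g I tw S = (if tw then swap (act (1 / ?n I) (M I) S) else act (1 / ?n I) (M I) S)"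
    if "I \<in> R" "S \<in> Herm K B" for I tw S
    unfolding g_def gamma'_def tau_eq gamma_eq using that gf(3)[OF that(1,1,2)] by (simp add: compose_eq)
  have coset_eq: "f <#\<^bsub>G_A K B\<^esub> H_A K B = f' <#\<^bsub>G_A K B\<^esub> H_A K B \<longleftrightarrow> (\<exists>h\<in>H_A K B. f = f' \<otimes>\<^bsub>G_A K B\<^esub> h)"
    if "f \<in> carrier (G_A K B)" "f' \<in> carrier (G_A K B)" for f f'
  proof
    assume "f <#\<^bsub>G_A K B\<^esub> H_A K B = f' <#\<^bsub>G_A K B\<^esub> H_A K B"
    then have "f \<in> f' <#\<^bsub>G_A K B\<^esub> H_A K B" using lcos_self[OF that(1) subgroup_H_A] by simp
    then show "\<exists>h\<in>H_A K B. f = f' \<otimes>\<^bsub>G_A K B\<^esub> h" by (auto simp: l_coset_def)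
  next
    assume "\<exists>h\<in>H_A K B. f = f' \<otimes>\<^bsub>G_A K B\<^esub> h"
    then have "f \<in> f' <#\<^bsub>G_A K B\<^esub> H_A K B" by (auto simp: l_coset_def)
    from l_repr_independence[OF this that(2) subgroup_H_A]
    show "f <#\<^bsub>G_A K B\<^esub> H_A K B = f' <#\<^bsub>G_A K B\<^esub> H_A K B" ..
  qed
  have "inj_on (\<lambda>(I, tw). g I tw <#\<^bsub>G_A K B\<^esub> H_A K B) (R \<times> UNIV)"
  proof (rule inj_onI, clarify)
    fix I tw J tw'
    assume IJ: "I \<in> R" "J \<in> R" and "g I tw <#\<^bsub>G_A K B\<^esub> H_A K B = g J tw' <#\<^bsub>G_A K B\<^esub> H_A K B"
    then obtain h where h: "h \<in> H_A K B" "g I tw = g J tw' \<otimes>\<^bsub>G_A K B\<^esub> h"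
      using coset_eq[OF gG[OF IJ(1)] gG[OF IJ(2)]] by blast
    obtain P where P: "ideal_similitude \<O> P" "h = restrict (act 1 P) (Herm K B)" using h(1) unfolding H_A_eq by blast
    have hG: "h \<in> carrier (G_A K B)" using h(1) H.subset by blast
    define Y where "Y = P ** M J"
    have Y: "ideal_similitude J Y"
      using ideal_similitude_mult[OF P(1) M[OF IJ(2)]] nonzero_idealD(1)[OF nz[OF IJ(2)]] by (simp add: Y_def)
    have eq: "g I tw S = (if tw' then swap (act (1 / ?n J) Y S) else act (1 / ?n J) Y S)" if S: "S \<in> Herm K B" for S
    proof -
      have "g I tw S = g J tw' (act 1 P S)"
        unfolding h(2) G_A_mult[OF gG[OF IJ(2)] hG] compose_eq[OF S] unfolding P(2) using S by simp
      then show ?thesis unfolding g_app[OF IJ(2) similitude_O_Herm[OF P(1) S]] act_act Y_def by simp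
    qed
    note nI = ideal_norm_eq(1)[OF nonzero_idealD[OF nz[OF IJ(1)]]] and nJ = ideal_norm_eq(1)[OF nonzero_idealD[OF nz[OF IJ(2)]]]
    \<comment> \<open>The two kinds of representatives differ in orientation.\<close>
    have tw: "tw = tw'"
    proof (rule ccontr)
      assume "tw \<noteq> tw'"
      then consider "tw" "\<not> tw'" | "\<not> tw" "tw'" by blast
      then show False
      proof cases
        case 1
        then have "swap (act (1 / ?n I) (M I) S) = act (1 / ?n J) Y S" if "S \<in> Herm K B" for S
          using eq[OF that] g_app[OF IJ(1) that] by simp
        then show False by (rule swap_act_neq_act[OF M[OF IJ(1)] npos(2)[OF IJ(1)] nI npos(1)[OF IJ(2)]])
      next
        case 2
        then have "swap (act (1 / ?n J) Y S) = act (1 / ?n I) (M I) S" if "S \<in> Herm K B" for S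
          using eq[OF that] g_app[OF IJ(1) that] by simp
        then show False by (rule swap_act_neq_act[OF Y npos(2)[OF IJ(2)] nJ npos(1)[OF IJ(1)]])
      qed
    qed
    have "act (1 / ?n I) (M I) S = act (1 / ?n J) Y S" if "S \<in> Herm K B" for S
    proof (cases tw)
      case True
      then have "swap (act (1 / ?n I) (M I) S) = swap (act (1 / ?n J) Y S)"
        using eq[OF that] g_app[OF IJ(1) that] tw by simp
      then show ?thesis by (metis swap_swap)
    next
      case False
      then show ?thesis using eq[OF that] g_app[OF IJ(1) that] tw by simp
    qed
    then have "ideal_class K I = ideal_class K J"
      by (rule same_ideal_class_if_act_eq[OF M[OF IJ(1)] npos(1)[OF IJ(1)] Y npos(1)[OF IJ(2)]])
    then have "I = J" using R(2) IJ by (auto simp: bij_betw_def inj_on_def)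
    then show "I = J \<and> tw = tw'" using tw by simp
  qed
  moreover have "(\<lambda>(I, tw). g I tw <#\<^bsub>G_A K B\<^esub> H_A K B) ` (R \<times> UNIV) = lcosets\<^bsub>G_A K B\<^esub> H_A K B"
  proof (intro equalityI subsetI)
    fix c assume "c \<in> (\<lambda>(I, tw). g I tw <#\<^bsub>G_A K B\<^esub> H_A K B) ` (R \<times> UNIV)"
    then show "c \<in> lcosets\<^bsub>G_A K B\<^esub> H_A K B" using gG by (auto simp: LCOSETS_def)
  next
    fix c assume "c \<in> lcosets\<^bsub>G_A K B\<^esub> H_A K B"
    then obtain f where f: "f \<in> carrier (G_A K B)" "c = f <#\<^bsub>G_A K B\<^esub> H_A K B" by (auto simp: LCOSETS_def)
    obtain r X where X: "r > 0" "of_real r \<in> K" "\<And>i j. X $ i $ j \<in> K" "det X \<noteq> 0"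
      "(\<forall>S\<in>Herm K B. f S = act r X S) \<or> (\<forall>S\<in>Herm K B. swap (f S) = act r X S)"
      using isometry_eq_act_or_swap_act[OF f(1)] by blast
    then obtain tw where tw: "\<And>S. S \<in> Herm K B \<Longrightarrow> f S = (if tw then swap (act r X S) else act r X S)"
      by (metis swap_swap)
    have H: "act r X S \<in> Herm K B" and d: "det (act r X S) = det S" if S: "S \<in> Herm K B" for S
    proof -
      have *: "act r X S = (if tw then swap (f S) else f S)" using tw[OF S] by simp
      show "act r X S \<in> Herm K B" unfolding * using G_A_D(1)[OF f(1) S] swap_Herm by simp
      show "det (act r X S) = det S" unfolding * using G_A_D(2)[OF f(1) S] by (simp add: swap_def det_2 mult.commute)
    qed
    \<comment> \<open>Comparing determinants at the identity matrix gives the modulus of \<open>det X\<close>.\<close>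
    have "herm 1 0 1 \<in> Herm K B" by (rule herm_Herm) (simp_all add: fracD(2)[OF frac_Binv])
    from d[OF this] have "complex_of_real ((r * cmod (det X))\<^sup>2) = 1"
      unfolding det_act by (simp add: det_2 del: of_real_power of_real_mult)
    then have "(r * cmod (det X))\<^sup>2 = 1" using of_real_eq_1_iff by blast
    moreover have "r * cmod (det X) \<ge> 0" using X(1) by simp
    ultimately have rd: "r * cmod (det X) = 1" by (simp add: power2_eq_1_iff)
    obtain I P where I: "I \<in> R" "ideal_similitude \<O> P"
      "\<And>S. act r X S = act (1 / ?n I) (M I) (act 1 P S)"
      using G_A_factor[OF R M H rd X(1,2,3)] by blast
    define h where "h = restrict (act 1 P) (Herm K B)"
    have h: "h \<in> H_A K B" "h \<in> carrier (G_A K B)" unfolding h_def H_A_eq using I(2) similitude_O_in_G_A by blast+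
    have "f = g I tw \<otimes>\<^bsub>G_A K B\<^esub> h"
      unfolding G_A_mult[OF gG[OF I(1)] h(2)]
    proof (rule extensionalityI[OF G_A_D(5)[OF f(1)] compose_extensional])
      fix S assume S: "S \<in> Herm K B"
      show "f S = compose (Herm K B) (g I tw) h S"
        unfolding compose_eq[OF S] h_def restrict_apply'[OF S] g_app[OF I(1) similitude_O_Herm[OF I(2) S]]
          I(3)[symmetric] by (rule tw[OF S])
    qed
    then have "c = g I tw <#\<^bsub>G_A K B\<^esub> H_A K B"
      unfolding f(2) using coset_eq[OF f(1) gG[OF I(1)]] h(1) by blast
    then show "c \<in> (\<lambda>(I, tw). g I tw <#\<^bsub>G_A K B\<^esub> H_A K B) ` (R \<times> UNIV)" using I(1) by force
  qed
  ultimately show ?thesis unfolding bij_betw_def g_def by simp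
qed

end

section \<open>Representatives of the isometries modulo automorphisms\<close>

theorem proposition3p3:
  fixes K B :: "complex set" and R :: "complex set set"
  assumes "imaginary_quadratic_field K"
    and "nonzero_ideal K B"
    and "\<forall>I\<in>R. nonzero_ideal K I"
    and "bij_betw (ideal_class K) R (class_group_2_torsion K)"
  shows "(\<forall>M :: complex set \<Rightarrow> complex^2^2.
            (\<forall>I\<in>R. module_iso_matrix K B I (M I)) \<longrightarrow>
            (\<forall>I\<in>R. gamma K B I (M I) \<in> carrier (G_A K B) \<and>
                    gamma' K B I (M I) \<in> carrier (G_A K B)) \<and>
            bij_betw
              (\<lambda>(I, twisted). (if twisted then gamma' K B I (M I) else gamma K B I (M I))
                                <#\<^bsub>G_A K B\<^esub> H_A K B)
              (R \<times> (UNIV :: bool set))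
              (lcosets\<^bsub>G_A K B\<^esub> H_A K B))
         \<and> finite (lcosets\<^bsub>G_A K B\<^esub> H_A K B)
         \<and> card (lcosets\<^bsub>G_A K B\<^esub> H_A K B) = 2 * card (class_group_2_torsion K)"
proof -
  obtain w t q where "quad_order K w t q" using ex_quad_order[OF assms(1)] by blast
  then interpret quad_torus K w t q B
    using assms(2) by (simp add: quad_torus_def quad_torus_axioms_def)
  have sim: "ideal_similitude I (M I)"
    if "\<forall>I\<in>R. module_iso_matrix K B I (M I)" "I \<in> R" for M :: "complex set \<Rightarrow> complex^2^2" and I
  proof -
    have "nonzero_ideal K I" "module_iso_matrix K B I (M I)" using assms(3) that by auto
    then show ?thesis by (simp only: module_iso_iff)
  qed
  have "\<exists>M. ideal_similitude I M" if I: "I \<in> R" for I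
  proof -
    have fI: "frac_ideal I" by (rule nonzero_idealD(1)) (use assms(3) I in blast)
    have "ideal_class K I \<in> class_group_2_torsion K" using assms(4) I by (auto simp: bij_betw_def)
    then obtain k where k: "k \<in> K - {0}" "I \<star> I = (*) k ` max_order K"
      unfolding ideal_class_2_torsion_iff[OF fI] by (elim bexE)
    show ?thesis by (rule ex_ideal_similitude[OF fI k])
  qed
  then have "\<forall>I\<in>R. \<exists>M. ideal_similitude I M" by (intro ballI)
  from bchoice[OF this] obtain M0 where "\<forall>I\<in>R. ideal_similitude I (M0 I)" by (elim exE)
  then have M0: "ideal_similitude I (M0 I)" if "I \<in> R" for I using that by (rule bspec)
  note bij = coset_representatives[OF assms(3,4) M0]
  have cR: "finite R" "card R = card (class_group_2_torsion K)"
    using bij_betw_finite[OF assms(4)] bij_betw_same_card[OF assms(4)] finite_class_group_2_torsion by auto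
  have "finite (lcosets\<^bsub>G_A K B\<^esub> H_A K B)" using bij_betw_finite[OF bij] cR(1) by simp
  moreover have "card (lcosets\<^bsub>G_A K B\<^esub> H_A K B) = 2 * card (class_group_2_torsion K)"
    using bij_betw_same_card[OF bij] cR by (simp add: card_cartesian_product)
  moreover have "gamma K B I (M I) \<in> carrier (G_A K B) \<and> gamma' K B I (M I) \<in> carrier (G_A K B)"
    if "\<forall>I\<in>R. module_iso_matrix K B I (M I)" "I \<in> R" for M :: "complex set \<Rightarrow> complex^2^2" and I
    using gamma_facts(1,2)[OF bspec[OF assms(3) that(2)] sim[OF that]] by (rule conjI)
  ultimately show ?thesis
    by (intro conjI allI impI ballI coset_representatives[OF assms(3,4) sim]) simp_all
qed

end
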